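(* Let $a\ge2$ and $r\ge1$ be integers and $H=\langle a,a+1,\dots,a+r\rangle$. Let $R=k[\![H]\!]$, where $k$ is an infinite field. Let $\mathfrak{c}$ be the conductor of $R$. Then the following statements hold. (1) There are equalities $\mathrm{ext}_R(R/\mathfrak{c})=\mathrm{fl}\,R$ and $\mathrm{ext}_R\,\mathfrak{c}=\mathrm{tf}\,R$. (2) The IKE-closed subcategories of $\mathrm{mod}\,R$ are exactly $0$, $\mathrm{fl}\,R$, $\mathrm{tf}\,R$ and $\mathrm{mod}\,R$. In particular, every IKE-closed subcategory of $\mathrm{mod}\,R$ is torsionfree, i.e. closed under submodules and extensions.
   Context: $\mathrm{mod}\,R$ is the category of finitely generated $R$-modules; subcategories are strictly full (full and closed under isomorphism) and nonempty. $\langle a_1,\dots,a_s\rangle\subseteq\mathbb{N}=\{0,1,2,\dots\}$ is the set of all $\mathbb{N}$-linear combinations of $a_1,\dots,a_s$. For a numerical semigroup $H$ (a subsemigroup of $\mathbb{N}$ containing $0$ with finite complement), $k[\![H]\!]$ is the completion of $k[t^h\mid h\in H]\subseteq k[t]$ at the ideal generated by the $t^h$ with $0\neq h\in H$; equivalently the ring of power series in $k[\![t]\!]$ supported on exponents in $H$. Its integral closure is $S=k[\![t]\!]$; the conductor is $\mathfrak{c}=R:_QS=\{x\in Q\mid xS\subseteq R\}$, $Q$ being the fraction field of $R$. For $M\in\mathrm{mod}\,R$, $\mathrm{ext}_RM$ is the smallest strictly full subcategory of $\mathrm{mod}\,R$ containing $M$ and closed under direct summands and extensions. $\mathrm{fl}\,R$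 and $\mathrm{tf}\,R$ are the subcategories of modules of finite length and of (finitely generated) torsionfree modules, respectively; $0$ is the subcategory of zero modules. A subcategory $\mathcal{X}$ is closed under extensions if for each exact sequence $0\to L\to M\to N\to0$ with $L,N\in\mathcal{X}$ one has $M\in\mathcal{X}$. It is IKE-closed if it is closed under extensions and the image and kernel of every homomorphism between modules in $\mathcal{X}$ lie in $\mathcal{X}$. *)

theory Defs
  imports
    "HOL-Computational_Algebra.Formal_Laurent_Series"
    "HOL-Library.Extended_Nat"
    "HOL-Algebra.Module"
    "HOL-Algebra.QuotRing"
begin

section \<open>Modules over a ring record\<close>

text \<open>
  A module record inherits the fields \<open>mult\<close> and \<open>one\<close> from rings; the locale \<open>module\<close> does not
  constrain them, and nothing below depends on them.
\<close>

definition mod_hom ::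
  "('r, 'c) ring_scheme \<Rightarrow> ('r, 'm, 'd) module_scheme \<Rightarrow> ('r, 'n, 'e) module_scheme \<Rightarrow> ('m \<Rightarrow> 'n) set"
  where "mod_hom R M N =
    {f \<in> carrier M \<rightarrow> carrier N.
      (\<forall>x \<in> carrier M. \<forall>y \<in> carrier M. f (x \<oplus>\<^bsub>M\<^esub> y) = f x \<oplus>\<^bsub>N\<^esub> f y) \<and>
      (\<forall>r \<in> carrier R. \<forall>x \<in> carrier M. f (r \<odot>\<^bsub>M\<^esub> x) = r \<odot>\<^bsub>N\<^esub> f x)}"

definition mod_iso ::
  "('r, 'c) ring_scheme \<Rightarrow> ('r, 'm, 'd) module_scheme \<Rightarrow> ('r, 'n, 'e) module_scheme \<Rightarrow> bool"
  where "mod_iso R M N \<longleftrightarrow> (\<exists>f \<in> mod_hom R M N. bij_betw f (carrier M) (carrier N))"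

definition short_exact ::
  "('r, 'c) ring_scheme \<Rightarrow> ('r, 'l, 'd) module_scheme \<Rightarrow> ('r, 'm, 'e) module_scheme
    \<Rightarrow> ('r, 'n, 'f) module_scheme \<Rightarrow> ('l \<Rightarrow> 'm) \<Rightarrow> ('m \<Rightarrow> 'n) \<Rightarrow> bool"
  where "short_exact R L M N f g \<longleftrightarrow>
    f \<in> mod_hom R L M \<and> g \<in> mod_hom R M N \<and>
    inj_on f (carrier L) \<and> f ` carrier L = a_kernel M N g \<and> g ` carrier M = carrier N"

definition direct_sum ::
  "('r, 'm, 'd) module_scheme \<Rightarrow> ('r, 'n, 'e) module_scheme \<Rightarrow> ('r, 'm \<times> 'n) module"
  where "direct_sum M N =
    \<lparr>carrier = carrier M \<times> carrier N,
     monoid.mult = undefined, one = undefined,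
     zero = (\<zero>\<^bsub>M\<^esub>, \<zero>\<^bsub>N\<^esub>),
     add = (\<lambda>(x, y) (x', y'). (x \<oplus>\<^bsub>M\<^esub> x', y \<oplus>\<^bsub>N\<^esub> y')),
     module.smult = (\<lambda>r (x, y). (r \<odot>\<^bsub>M\<^esub> x, r \<odot>\<^bsub>N\<^esub> y))\<rparr>"

definition finitely_generated :: "('r, 'c) ring_scheme \<Rightarrow> ('r, 'm, 'd) module_scheme \<Rightarrow> bool"
  where "finitely_generated R M \<longleftrightarrow>
    (\<exists>G. finite G \<and> G \<subseteq> carrier M \<and> (\<forall>N. submodule N R M \<and> G \<subseteq> N \<longrightarrow> N = carrier M))"

definition mod_length :: "('r, 'c) ring_scheme \<Rightarrow> ('r, 'm, 'd) module_scheme \<Rightarrow> enat"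
  where "mod_length R M =
    (SUP n \<in> {n. \<exists>N. (\<forall>i\<le>n. submodule (N i) R M) \<and> (\<forall>i<n. N i \<subset> N (Suc i))}. enat n)"

text \<open>Quantifying over the nonzero scalars is the right notion because the rings below are domains.\<close>

definition torsionfree :: "('r, 'c) ring_scheme \<Rightarrow> ('r, 'm, 'd) module_scheme \<Rightarrow> bool"
  where "torsionfree R M \<longleftrightarrow>
    (\<forall>r \<in> carrier R. \<forall>x \<in> carrier M. r \<noteq> \<zero>\<^bsub>R\<^esub> \<and> r \<odot>\<^bsub>M\<^esub> x = \<zero>\<^bsub>M\<^esub> \<longrightarrow> x = \<zero>\<^bsub>M\<^esub>)"

text \<open>The ring \<open>A\<close> as a module over \<open>R\<close> along a ring homomorphism from \<open>R\<close> to \<open>A\<close>.\<close>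

definition module_via :: "('r \<Rightarrow> 'a) \<Rightarrow> ('a, 'c) ring_scheme \<Rightarrow> ('r, 'a) module"
  where "module_via \<phi> A =
    \<lparr>carrier = carrier A, monoid.mult = monoid.mult A, one = one A, zero = zero A, add = add A,
     module.smult = (\<lambda>r x. \<phi> r \<otimes>\<^bsub>A\<^esub> x)\<rparr>"

definition ideal_module :: "('r, 'c) ring_scheme \<Rightarrow> 'r set \<Rightarrow> ('r, 'r) module"
  where "ideal_module R I = (module_via id R)\<lparr>carrier := I\<rparr>"

definition quotient_module :: "('r, 'c) ring_scheme \<Rightarrow> 'r set \<Rightarrow> ('r, 'r set) module"
  where "quotient_module R I = module_via (\<lambda>r. I +>\<^bsub>R\<^esub> r) (R Quot I)"


section \<open>Subcategories of the category of finitely generated modules\<close>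

text \<open>
  HOL has no proper class of all modules, so the objects are the finitely generated modules whose
  carrier is a subset of a type \<open>'m\<close>. A full subcategory is the set of its objects. If the
  cardinality of \<open>'m\<close> is large enough, every finitely generated module is isomorphic to one of
  these objects, and then strictly full subcategories do not depend on the choice of \<open>'m\<close>.
  Every subcategory considered here is full, nonempty and closed under isomorphism.
\<close>

definition fg_modules :: "('r, 'c) ring_scheme \<Rightarrow> ('r, 'm) module set"
  where "fg_modules R = {M. module R M \<and> finitely_generated R M}"

definition zero_modules :: "('r, 'c) ring_scheme \<Rightarrow> ('r, 'm) module set"
  where "zero_modules R = {M \<in> fg_modules R. carrier M = {\<zero>\<^bsub>M\<^esub>}}"

definition fl_modules :: "('r, 'c) ring_scheme \<Rightarrow> ('r, 'm) module set"
  where "fl_modules R = {M \<in> fg_modules R. mod_length R M < \<infinity>}"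

definition tf_modules :: "('r, 'c) ring_scheme \<Rightarrow> ('r, 'm) module set"
  where "tf_modules R = {M \<in> fg_modules R. torsionfree R M}"

definition subcategory :: "('r, 'c) ring_scheme \<Rightarrow> ('r, 'm) module set \<Rightarrow> bool"
  where "subcategory R X \<longleftrightarrow>
    X \<subseteq> fg_modules R \<and> X \<noteq> {} \<and> (\<forall>M \<in> X. \<forall>N \<in> fg_modules R. mod_iso R M N \<longrightarrow> N \<in> X)"

definition extension_closed :: "('r, 'c) ring_scheme \<Rightarrow> ('r, 'm) module set \<Rightarrow> bool"
  where "extension_closed R X \<longleftrightarrow>
    (\<forall>L \<in> X. \<forall>N \<in> X. \<forall>M \<in> fg_modules R. \<forall>f g. short_exact R L M N f g \<longrightarrow> M \<in> X)"

definition summand_closed :: "('r, 'c) ring_scheme \<Rightarrow> ('r, 'm) module set \<Rightarrow> bool"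
  where "summand_closed R X \<longleftrightarrow>
    (\<forall>M \<in> X. \<forall>N \<in> fg_modules R. \<forall>L :: ('r, 'm) module \<in> fg_modules R.
      mod_iso R M (direct_sum N L) \<longrightarrow> N \<in> X)"

definition image_closed :: "('r, 'c) ring_scheme \<Rightarrow> ('r, 'm) module set \<Rightarrow> bool"
  where "image_closed R X \<longleftrightarrow>
    (\<forall>M \<in> X. \<forall>N \<in> X. \<forall>f \<in> mod_hom R M N. N\<lparr>carrier := f ` carrier M\<rparr> \<in> X)"

definition kernel_closed :: "('r, 'c) ring_scheme \<Rightarrow> ('r, 'm) module set \<Rightarrow> bool"
  where "kernel_closed R X \<longleftrightarrow>
    (\<forall>M \<in> X. \<forall>N \<in> X. \<forall>f \<in> mod_hom R M N. M\<lparr>carrier := a_kernel M N f\<rparr> \<in> X)"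

definition submodule_closed :: "('r, 'c) ring_scheme \<Rightarrow> ('r, 'm) module set \<Rightarrow> bool"
  where "submodule_closed R X \<longleftrightarrow>
    (\<forall>M \<in> X. \<forall>N. submodule N R M \<longrightarrow> M\<lparr>carrier := N\<rparr> \<in> X)"

definition IKE_closed :: "('r, 'c) ring_scheme \<Rightarrow> ('r, 'm) module set \<Rightarrow> bool"
  where "IKE_closed R X \<longleftrightarrow>
    subcategory R X \<and> image_closed R X \<and> kernel_closed R X \<and> extension_closed R X"

definition torsionfree_subcategory :: "('r, 'c) ring_scheme \<Rightarrow> ('r, 'm) module set \<Rightarrow> bool"
  where "torsionfree_subcategory R X \<longleftrightarrow>
    subcategory R X \<and> submodule_closed R X \<and> extension_closed R X"

text \<open>
  The carrier of \<open>M\<close> may live in another type \<open>'n\<close>; a strictly full subcategory contains \<open>M\<close> when it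
  contains an isomorphic copy of \<open>M\<close>.
\<close>

definition ext_closure ::
  "('r, 'c) ring_scheme \<Rightarrow> ('r, 'n, 'd) module_scheme \<Rightarrow> ('r, 'm) module set"
  where "ext_closure R M =
    \<Inter> {X. subcategory R X \<and> (\<exists>N \<in> X. mod_iso R N M) \<and> summand_closed R X \<and> extension_closed R X}"


section \<open>Numerical semigroup rings\<close>

text \<open>The generating set is meant to be finite.\<close>

definition nat_combinations :: "nat set \<Rightarrow> nat set"
  where "nat_combinations A = {\<Sum>x\<in>A. c x * x | c :: nat \<Rightarrow> nat. True}"

definition semigroup_ring :: "nat set \<Rightarrow> ('k::field) fps ring"
  where "semigroup_ring H =
    \<lparr>carrier = {f. \<forall>n. fps_nth f n \<noteq> 0 \<longrightarrow> n \<in> H}, monoid.mult = (*), one = 1, zero = 0, add = (+)\<rparr>"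

text \<open>
  All subrings of \<open>k[[t]]\<close> have their fraction fields inside the field \<open>k((t))\<close> of Laurent series.
\<close>

definition fraction_field :: "('k::field) fps set \<Rightarrow> 'k fls set"
  where "fraction_field A = {fps_to_fls u / fps_to_fls v | u v. u \<in> A \<and> v \<in> A \<and> v \<noteq> 0}"

text \<open>
  The conductor is the set of all \<open>x\<close> in the fraction field with \<open>x S \<subseteq> R\<close>, where \<open>S = k[[t]]\<close> is the
  whole type of power series. Since \<open>1 \<in> S\<close>, each such \<open>x\<close> is a power series, so pulling this set
  back along the embedding of \<open>k[[t]]\<close> into \<open>k((t))\<close> loses no element.
\<close>

definition conductor :: "nat set \<Rightarrow> ('k::field) fps set"
  where "conductor H = fps_to_fls -`
    {x \<in> fraction_field (carrier (semigroup_ring H)).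
      \<forall>s :: 'k fps. x * fps_to_fls s \<in> fps_to_fls ` carrier (semigroup_ring H)}"

end

theory Submission
  imports Defs
begin

text \<open>
  Let \<open>S = k[[t]]\<close>; the conductor is \<open>\<cc> = t\<^sup>e S \<cong> S\<close>. Only two facts about \<open>H\<close> matter: it is a numerical
  semigroup, and \<open>e \<ge> 1\<close>.

  Torsionfree modules. If \<open>I \<subseteq> S\<close> is an \<open>R\<close>-submodule with an element of least order \<open>d\<close>, then
  \<open>0 \<rightarrow> I \<inter> t\<^sup>d\<^sup>+\<^sup>1 S \<rightarrow> I \<oplus> t\<^sup>d\<^sup>+\<^sup>1 S \<rightarrow> t\<^sup>d S \<rightarrow> 0\<close> is exact, so descending induction on \<open>d\<close> puts every
  ideal into \<open>ext S\<close>. A torsionfree module has a filtration with subquotients isomorphic to ideals.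

  Modules of finite length. Writing \<open>R\<^sub>\<ge>\<^sub>s\<close> for the elements of \<open>R\<close> of order at least \<open>s\<close>, the module
  \<open>R/R\<^sub>\<ge>\<^sub>s\<^sub>-\<^sub>a\<close> is a direct summand of a self-extension of \<open>R/R\<^sub>\<ge>\<^sub>s\<close>. Starting from \<open>\<cc> = R\<^sub>\<ge>\<^sub>e\<close> one
  reaches the residue field, which generates all modules of finite length.

  IKE-closed subcategories. Such a subcategory is closed under direct summands. If it contains a
  module with nonzero torsion, then it contains that torsion submodule (the kernel of a scalar), a
  nonzero multiple of it killed by the maximal ideal, and hence the residue field. If it contains a
  nontorsion module, then it contains a nonzero ideal \<open>I\<close> (the image of an endomorphism) and
  \<open>\<cc> I \<cong> S\<close>, which is a sum of finitely many copies of \<open>I\<close> inside \<open>I\<close>.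
\<close>

section \<open>Homomorphisms and submodules\<close>

text \<open>Every nonzero ideal of \<open>R\<close> contains some t^s S: if u has order d, then u
  t^e S = t^(d+e) S, and t^e S lies in \<open>R\<close>. Hence a finitely generated module has
  finite length exactly when it is torsion, and an IKE-closed subcategory is determined by two
  questions: whether one of its modules has nonzero torsion, and whether one of them is not torsion.
  If both happen, every module belongs to it, because M is an extension of the torsionfree module
  M/T by its torsion submodule T. The condition e >= 1 excludes R = S, where R/c would be zero and
  could generate nothing. The formal obstacle is that ideals, quotients and direct sums live in
  other types than the objects of a subcategory. Membership is therefore replaced by membership up
  to isomorphism. This loses nothing: one power series can code a pair of power series, so every
  finitely generated module is enumerated by k[[t]], and an injection of k[[t]] into the universe
  makes the universe large enough.\<close>

lemma mod_homI:
  assumes "\<And>x. x \<in> carrier M \<Longrightarrow> f x \<in> carrier N"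
    and "\<And>x y. x \<in> carrier M \<Longrightarrow> y \<in> carrier M \<Longrightarrow> f (x \<oplus>\<^bsub>M\<^esub> y) = f x \<oplus>\<^bsub>N\<^esub> f y"
    and "\<And>r x. r \<in> carrier R \<Longrightarrow> x \<in> carrier M \<Longrightarrow> f (r \<odot>\<^bsub>M\<^esub> x) = r \<odot>\<^bsub>N\<^esub> f x"
  shows "f \<in> mod_hom R M N"
  using assms by (auto simp: mod_hom_def)

lemma mod_homD:
  assumes "f \<in> mod_hom R M N"
  shows "\<And>x. x \<in> carrier M \<Longrightarrow> f x \<in> carrier N"
    and "\<And>x y. x \<in> carrier M \<Longrightarrow> y \<in> carrier M \<Longrightarrow> f (x \<oplus>\<^bsub>M\<^esub> y) = f x \<oplus>\<^bsub>N\<^esub> f y"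
    and "\<And>r x. r \<in> carrier R \<Longrightarrow> x \<in> carrier M \<Longrightarrow> f (r \<odot>\<^bsub>M\<^esub> x) = r \<odot>\<^bsub>N\<^esub> f x"
  using assms by (auto simp: mod_hom_def)

lemma mod_hom_zero:
  assumes "module R M" "module R N" "f \<in> mod_hom R M N"
  shows "f \<zero>\<^bsub>M\<^esub> = \<zero>\<^bsub>N\<^esub>"
proof -
  interpret M: module R M by fact
  interpret N: module R N by fact
  have "f (\<zero>\<^bsub>R\<^esub> \<odot>\<^bsub>M\<^esub> \<zero>\<^bsub>M\<^esub>) = \<zero>\<^bsub>R\<^esub> \<odot>\<^bsub>N\<^esub> f \<zero>\<^bsub>M\<^esub>"
    using mod_homD(3)[OF assms(3)] by blast
  then show ?thesis using mod_homD(1)[OF assms(3)] by simp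
qed

lemma module_minus_eq:
  assumes "module R M" "x \<in> carrier M"
  shows "\<ominus>\<^bsub>M\<^esub> x = (\<ominus>\<^bsub>R\<^esub> \<one>\<^bsub>R\<^esub>) \<odot>\<^bsub>M\<^esub> x"
proof -
  interpret M: module R M by fact
  show ?thesis using M.smult_l_minus[of "\<one>\<^bsub>R\<^esub>" x] assms by simp
qed

lemma mod_hom_minus:
  assumes "module R M" "module R N" "f \<in> mod_hom R M N" "x \<in> carrier M" "y \<in> carrier M"
  shows "f (x \<ominus>\<^bsub>M\<^esub> y) = f x \<ominus>\<^bsub>N\<^esub> f y"
proof -
  interpret M: module R M by fact
  interpret N: module R N by fact
  show ?thesis
    using assms mod_homD[OF assms(3)]
    by (simp add: a_minus_def module_minus_eq[OF assms(1)] module_minus_eq[OF assms(2)])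
qed

text \<open>Negation is multiplication by the scalar -1, so closure under inverses comes with
  closure under scalars.\<close>

lemma submodule_iff:
  assumes "module R M"
  shows "submodule N R M \<longleftrightarrow> N \<subseteq> carrier M \<and> \<zero>\<^bsub>M\<^esub> \<in> N \<and>
    (\<forall>x\<in>N. \<forall>y\<in>N. x \<oplus>\<^bsub>M\<^esub> y \<in> N) \<and> (\<forall>r\<in>carrier R. \<forall>x\<in>N. r \<odot>\<^bsub>M\<^esub> x \<in> N)"
proof -
  interpret M: module R M by fact
  show ?thesis
  proof
    assume N: "submodule N R M"
    then have "\<zero>\<^bsub>M\<^esub> \<in> N"
      using subgroup.one_closed[OF submodule.axioms(1)] by fastforce
    with M.submoduleE[OF N] show "N \<subseteq> carrier M \<and> \<zero>\<^bsub>M\<^esub> \<in> N \<and>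
      (\<forall>x\<in>N. \<forall>y\<in>N. x \<oplus>\<^bsub>M\<^esub> y \<in> N) \<and> (\<forall>r\<in>carrier R. \<forall>x\<in>N. r \<odot>\<^bsub>M\<^esub> x \<in> N)" by blast
  next
    assume N: "N \<subseteq> carrier M \<and> \<zero>\<^bsub>M\<^esub> \<in> N \<and>
      (\<forall>x\<in>N. \<forall>y\<in>N. x \<oplus>\<^bsub>M\<^esub> y \<in> N) \<and> (\<forall>r\<in>carrier R. \<forall>x\<in>N. r \<odot>\<^bsub>M\<^esub> x \<in> N)"
    show "submodule N R M"
    proof (rule M.submoduleI)
      fix x assume "x \<in> N"
      with N have "x \<in> carrier M" by blast
      then show "\<ominus>\<^bsub>M\<^esub> x \<in> N"
        using N \<open>x \<in> N\<close> by (simp add: module_minus_eq[OF assms])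
    qed (use N in auto)
  qed
qed

lemma submoduleD:
  assumes "module R M" "submodule N R M"
  shows "\<And>x. x \<in> N \<Longrightarrow> x \<in> carrier M" "\<zero>\<^bsub>M\<^esub> \<in> N"
    "\<And>x y. x \<in> N \<Longrightarrow> y \<in> N \<Longrightarrow> x \<oplus>\<^bsub>M\<^esub> y \<in> N"
    "\<And>r x. r \<in> carrier R \<Longrightarrow> x \<in> N \<Longrightarrow> r \<odot>\<^bsub>M\<^esub> x \<in> N"
    "\<And>x y. x \<in> N \<Longrightarrow> y \<in> N \<Longrightarrow> x \<ominus>\<^bsub>M\<^esub> y \<in> N"
proof -
  interpret M: module R M by fact
  note N = assms(2)[unfolded submodule_iff[OF assms(1)]]
  show "\<And>x. x \<in> N \<Longrightarrow> x \<in> carrier M" "\<zero>\<^bsub>M\<^esub> \<in> N"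
    "\<And>x y. x \<in> N \<Longrightarrow> y \<in> N \<Longrightarrow> x \<oplus>\<^bsub>M\<^esub> y \<in> N"
    "\<And>r x. r \<in> carrier R \<Longrightarrow> x \<in> N \<Longrightarrow> r \<odot>\<^bsub>M\<^esub> x \<in> N"
    using N by auto
  show "\<And>x y. x \<in> N \<Longrightarrow> y \<in> N \<Longrightarrow> x \<ominus>\<^bsub>M\<^esub> y \<in> N"
    using N M.submoduleE(3)[OF assms(2)] by (auto simp: a_minus_def)
qed

lemma module_submodule:
  "module R M \<Longrightarrow> submodule N R M \<Longrightarrow> module R (M\<lparr>carrier := N\<rparr>)"
  by (rule submodule.submodule_is_module)

lemma submodule_carrier: "module R M \<Longrightarrow> submodule (carrier M) R M"
  by (rule module.carrier_is_submodule)

lemma submodule_zero: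
  assumes "module R M" shows "submodule {\<zero>\<^bsub>M\<^esub>} R M"
proof -
  interpret M: module R M by fact
  show ?thesis by (simp add: submodule_iff[OF assms])
qed

lemma submodule_submodule_iff:
  assumes "module R M" "submodule N R M"
  shows "submodule K R (M\<lparr>carrier := N\<rparr>) \<longleftrightarrow> submodule K R M \<and> K \<subseteq> N"
  using submoduleD(1)[OF assms]
  by (auto simp: submodule_iff[OF assms(1)] submodule_iff[OF module_submodule[OF assms]])

lemma submodule_Int:
  assumes "module R M" "submodule A R M" "submodule B R M"
  shows "submodule (A \<inter> B) R M"
  using assms(2,3) by (auto simp: submodule_iff[OF assms(1)])

lemma submodule_kernel:
  assumes "module R M" "module R N" "f \<in> mod_hom R M N"
  shows "submodule (a_kernel M N f) R M"
proof -
  interpret M: module R M by fact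
  interpret N: module R N by fact
  show ?thesis
    using mod_homD[OF assms(3)] mod_hom_zero[OF assms]
    by (auto simp: submodule_iff[OF assms(1)] a_kernel_def')
qed

lemma submodule_image:
  assumes "module R M" "module R N" "f \<in> mod_hom R M N" "submodule A R M"
  shows "submodule (f ` A) R N"
proof -
  note A = submoduleD[OF assms(1,4)] and f = mod_homD[OF assms(3)]
  show ?thesis unfolding submodule_iff[OF assms(2)]
  proof (intro conjI ballI)
    show "f ` A \<subseteq> carrier N" using A f by auto
    show "\<zero>\<^bsub>N\<^esub> \<in> f ` A" using mod_hom_zero[OF assms(1-3)] A(2) by (metis imageI)
    fix x y assume "x \<in> f ` A" "y \<in> f ` A"
    then obtain u v where "x = f u" "y = f v" "u \<in> A" "v \<in> A" by auto
    then show "x \<oplus>\<^bsub>N\<^esub> y \<in> f ` A" using f(2)[of u v] A by (metis imageI)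
  next
    fix r x assume "r \<in> carrier R" "x \<in> f ` A"
    then obtain u where "x = f u" "u \<in> A" by auto
    then show "r \<odot>\<^bsub>N\<^esub> x \<in> f ` A" using f(3)[of r u] A \<open>r \<in> carrier R\<close> by (metis imageI)
  qed
qed

lemma submodule_vimage:
  assumes "module R M" "module R N" "f \<in> mod_hom R M N" "submodule B R N"
  shows "submodule {x \<in> carrier M. f x \<in> B} R M"
proof -
  interpret M: module R M by fact
  show ?thesis
    using submoduleD[OF assms(2,4)] mod_homD[OF assms(3)] mod_hom_zero[OF assms(1-3)]
    by (auto simp: submodule_iff[OF assms(1)])
qed

lemma mod_hom_inj_iff:
  assumes "module R M" "module R N" "f \<in> mod_hom R M N"
  shows "inj_on f (carrier M) \<longleftrightarrow> (\<forall>x\<in>carrier M. f x = \<zero>\<^bsub>N\<^esub> \<longrightarrow> x = \<zero>\<^bsub>M\<^esub>)"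
proof -
  interpret M: module R M by fact
  interpret N: module R N by fact
  note f = mod_homD[OF assms(3)] and f0 = mod_hom_zero[OF assms] and fm = mod_hom_minus[OF assms]
  show ?thesis
  proof
    assume "inj_on f (carrier M)"
    then show "\<forall>x\<in>carrier M. f x = \<zero>\<^bsub>N\<^esub> \<longrightarrow> x = \<zero>\<^bsub>M\<^esub>" using f0 by (metis M.zero_closed inj_onD)
  next
    assume *: "\<forall>x\<in>carrier M. f x = \<zero>\<^bsub>N\<^esub> \<longrightarrow> x = \<zero>\<^bsub>M\<^esub>"
    show "inj_on f (carrier M)"
    proof (rule inj_onI)
      fix x y assume xy: "x \<in> carrier M" "y \<in> carrier M" "f x = f y"
      then have "f (x \<ominus>\<^bsub>M\<^esub> y) = \<zero>\<^bsub>N\<^esub>" using fm f(1) by (simp add: N.r_neg a_minus_def)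
      then have "x \<ominus>\<^bsub>M\<^esub> y = \<zero>\<^bsub>M\<^esub>" using * xy by simp
      then show "x = y" using xy by (metis M.add.inv_closed M.minus_equality M.minus_minus a_minus_def)
    qed
  qed
qed

lemma mod_hom_comp:
  "f \<in> mod_hom R M N \<Longrightarrow> g \<in> mod_hom R N P \<Longrightarrow> g \<circ> f \<in> mod_hom R M P"
  by (auto simp: mod_hom_def Pi_iff)

lemma mod_hom_id: "id \<in> mod_hom R M M"
  by (auto simp: mod_hom_def)

lemma mod_hom_incl: "N \<subseteq> carrier M \<Longrightarrow> (\<lambda>x. x) \<in> mod_hom R (M\<lparr>carrier := N\<rparr>) M"
  by (auto simp: mod_hom_def)

lemma mod_hom_dom: "f \<in> mod_hom R M N \<Longrightarrow> K \<subseteq> carrier M \<Longrightarrow> f \<in> mod_hom R (M\<lparr>carrier := K\<rparr>) N"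
  by (auto simp: mod_hom_def Pi_iff subset_iff)

lemma mod_hom_cod:
  "f \<in> mod_hom R M N \<Longrightarrow> f ` carrier M \<subseteq> K \<Longrightarrow> f \<in> mod_hom R M (N\<lparr>carrier := K\<rparr>)"
  by (auto simp: mod_hom_def)

text \<open>The module axioms pass along surjections that respect the operations. This gives
  \<open>quot\<close>, \<open>transport\<close> and \<open>quotient_module\<close> their module
  structure. As \<open>N\<close> is not yet known to be a module, the image of zero has to be
  prescribed.\<close>

lemma module_hom_image:
  assumes "module R M" "f \<in> mod_hom R M N" "f ` carrier M = carrier N" "f \<zero>\<^bsub>M\<^esub> = \<zero>\<^bsub>N\<^esub>"
  shows "module R N"
proof -
  interpret M: module R M by fact
  note f = mod_homD[OF assms(2)]
  have ex: "\<exists>u\<in>carrier M. x = f u" if "x \<in> carrier N" for x using that assms(3) by auto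
  show ?thesis
  proof (rule moduleI)
    show "cring R" by (rule M.R.is_cring)
    show "abelian_group N"
    proof (rule abelian_groupI)
      show "\<zero>\<^bsub>N\<^esub> \<in> carrier N" using assms(3,4) by (metis M.zero_closed imageI)
    next
      fix x y assume "x \<in> carrier N" "y \<in> carrier N"
      then obtain u v where [simp]: "x = f u" "y = f v" "u \<in> carrier M" "v \<in> carrier M" using ex by metis
      have *: "x \<oplus>\<^bsub>N\<^esub> y = f (u \<oplus>\<^bsub>M\<^esub> v)" by (simp add: f)
      then show "x \<oplus>\<^bsub>N\<^esub> y \<in> carrier N" by (simp add: f(1))
      have "y \<oplus>\<^bsub>N\<^esub> x = f (v \<oplus>\<^bsub>M\<^esub> u)" by (simp add: f)
      then show "x \<oplus>\<^bsub>N\<^esub> y = y \<oplus>\<^bsub>N\<^esub> x" using * by (simp add: M.M.a_comm)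
      fix z assume "z \<in> carrier N"
      then obtain w where [simp]: "z = f w" "w \<in> carrier M" using ex by metis
      have "x \<oplus>\<^bsub>N\<^esub> y \<oplus>\<^bsub>N\<^esub> z = f (u \<oplus>\<^bsub>M\<^esub> v \<oplus>\<^bsub>M\<^esub> w)" by (simp add: f)
      also have "\<dots> = f (u \<oplus>\<^bsub>M\<^esub> (v \<oplus>\<^bsub>M\<^esub> w))" by (simp add: M.M.a_assoc)
      also have "\<dots> = x \<oplus>\<^bsub>N\<^esub> (y \<oplus>\<^bsub>N\<^esub> z)" by (simp add: f)
      finally show "x \<oplus>\<^bsub>N\<^esub> y \<oplus>\<^bsub>N\<^esub> z = x \<oplus>\<^bsub>N\<^esub> (y \<oplus>\<^bsub>N\<^esub> z)" .
    next
      fix x assume "x \<in> carrier N"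
      then obtain u where [simp]: "x = f u" "u \<in> carrier M" using ex by metis
      have "f (\<zero>\<^bsub>M\<^esub> \<oplus>\<^bsub>M\<^esub> u) = \<zero>\<^bsub>N\<^esub> \<oplus>\<^bsub>N\<^esub> x"
        using f(2)[of "\<zero>\<^bsub>M\<^esub>" u] assms(4) by simp
      then show "\<zero>\<^bsub>N\<^esub> \<oplus>\<^bsub>N\<^esub> x = x" by simp
      have "f (\<ominus>\<^bsub>M\<^esub> u \<oplus>\<^bsub>M\<^esub> u) = f (\<ominus>\<^bsub>M\<^esub> u) \<oplus>\<^bsub>N\<^esub> x" using f(2) by simp
      then show "\<exists>y\<in>carrier N. y \<oplus>\<^bsub>N\<^esub> x = \<zero>\<^bsub>N\<^esub>"
        using f(1)[of "\<ominus>\<^bsub>M\<^esub> u"] assms(4) by (auto simp: M.l_neg)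
    qed
  next
    fix a x assume a: "a \<in> carrier R" and "x \<in> carrier N"
    then obtain u where u [simp]: "x = f u" "u \<in> carrier M" using ex by metis
    show "a \<odot>\<^bsub>N\<^esub> x \<in> carrier N" using f(1)[of "a \<odot>\<^bsub>M\<^esub> u"] f(3)[OF a u(2)] a by simp
    fix y assume "y \<in> carrier N"
    then obtain v where v [simp]: "y = f v" "v \<in> carrier M" using ex by metis
    have "a \<odot>\<^bsub>N\<^esub> (x \<oplus>\<^bsub>N\<^esub> y) = f (a \<odot>\<^bsub>M\<^esub> (u \<oplus>\<^bsub>M\<^esub> v))" using a by (simp add: f)
    also have "\<dots> = a \<odot>\<^bsub>N\<^esub> x \<oplus>\<^bsub>N\<^esub> a \<odot>\<^bsub>N\<^esub> y" using a by (simp add: f M.smult_r_distr)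
    finally show "a \<odot>\<^bsub>N\<^esub> (x \<oplus>\<^bsub>N\<^esub> y) = a \<odot>\<^bsub>N\<^esub> x \<oplus>\<^bsub>N\<^esub> a \<odot>\<^bsub>N\<^esub> y" .
  next
    fix a b x assume ab: "a \<in> carrier R" "b \<in> carrier R" and "x \<in> carrier N"
    then obtain u where u [simp]: "x = f u" "u \<in> carrier M" using ex by metis
    show "(a \<oplus>\<^bsub>R\<^esub> b) \<odot>\<^bsub>N\<^esub> x = a \<odot>\<^bsub>N\<^esub> x \<oplus>\<^bsub>N\<^esub> b \<odot>\<^bsub>N\<^esub> x"
      using ab by (simp flip: f add: M.smult_l_distr)
    show "a \<otimes>\<^bsub>R\<^esub> b \<odot>\<^bsub>N\<^esub> x = a \<odot>\<^bsub>N\<^esub> (b \<odot>\<^bsub>N\<^esub> x)"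
      using ab by (simp flip: f add: M.smult_assoc1)
  next
    fix x assume "x \<in> carrier N"
    then obtain u where u [simp]: "x = f u" "u \<in> carrier M" using ex by metis
    show "\<one>\<^bsub>R\<^esub> \<odot>\<^bsub>N\<^esub> x = x" using f(3)[of "\<one>\<^bsub>R\<^esub>" u] by simp
  qed
qed

lemma mod_hom_inv_into:
  assumes "module R M" "f \<in> mod_hom R M N" "bij_betw f (carrier M) (carrier N)"
  shows "inv_into (carrier M) f \<in> mod_hom R N M"
proof -
  interpret M: module R M by fact
  let ?g = "inv_into (carrier M) f"
  note f = mod_homD[OF assms(2)]
  have gf: "?g (f x) = x" if "x \<in> carrier M" for x
    using assms(3) that by (simp add: bij_betw_def)
  have ex: "\<exists>u\<in>carrier M. x = f u" if "x \<in> carrier N" for x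
    using that assms(3) by (auto simp: bij_betw_def)
  show ?thesis
  proof (rule mod_homI)
    fix x assume "x \<in> carrier N"
    then obtain u where u [simp]: "x = f u" "u \<in> carrier M" using ex by metis
    show "?g x \<in> carrier M" by (simp add: gf)
    { fix y assume "y \<in> carrier N"
      then obtain v where v [simp]: "y = f v" "v \<in> carrier M" using ex by metis
      show "?g (x \<oplus>\<^bsub>N\<^esub> y) = ?g x \<oplus>\<^bsub>M\<^esub> ?g y" using gf[of "u \<oplus>\<^bsub>M\<^esub> v"] by (simp add: gf f(2)) }
    fix r assume "r \<in> carrier R"
    then show "?g (r \<odot>\<^bsub>N\<^esub> x) = r \<odot>\<^bsub>M\<^esub> ?g x" using gf[of "r \<odot>\<^bsub>M\<^esub> u"] by (simp add: gf f(3))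
  qed
qed

lemma mod_iso_refl: "mod_iso R M M"
  unfolding mod_iso_def using mod_hom_id[of R M] by (metis bij_betw_id)

lemma mod_iso_sym: "module R M \<Longrightarrow> mod_iso R M N \<Longrightarrow> mod_iso R N M"
  unfolding mod_iso_def using mod_hom_inv_into bij_betw_inv_into by blast

lemma mod_iso_trans: "mod_iso R M N \<Longrightarrow> mod_iso R N P \<Longrightarrow> mod_iso R M P"
  unfolding mod_iso_def using mod_hom_comp bij_betw_trans by blast

text \<open>The isomorphism is \<open>g\<close> after an arbitrary section of \<open>f\<close>.
  Equal kernels mean that \<open>f\<close> and \<open>g\<close> identify the same pairs, so the
  choice of the section is invisible after applying \<open>g\<close>.\<close>

lemma first_iso:
  assumes "module R M" "module R N" "module R N'"
    and f: "f \<in> mod_hom R M N" "f ` carrier M = carrier N"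
    and g: "g \<in> mod_hom R M N'" "g ` carrier M = carrier N'"
    and ker: "\<And>x. x \<in> carrier M \<Longrightarrow> f x = \<zero>\<^bsub>N\<^esub> \<longleftrightarrow> g x = \<zero>\<^bsub>N'\<^esub>"
  shows "mod_iso R N N'"
proof -
  interpret M: module R M by fact
  interpret N: module R N by fact
  interpret N': module R N' by fact
  define s where "s = inv_into (carrier M) f"
  note fh = mod_homD[OF f(1)] and gh = mod_homD[OF g(1)]
  have s: "s x \<in> carrier M" "f (s x) = x" if "x \<in> carrier N" for x
    using that f(2) by (auto simp: s_def inv_into_into f_inv_into_f)
  have eq: "f x = f y \<longleftrightarrow> g x = g y" if "x \<in> carrier M" "y \<in> carrier M" for x y
  proof -
    have "f x = f y \<longleftrightarrow> f (x \<ominus>\<^bsub>M\<^esub> y) = \<zero>\<^bsub>N\<^esub>"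
      using that fh(1) mod_hom_minus[OF assms(1,2) f(1)]
      by (metis N.add.inv_closed N.add.inv_equality N.add.inv_inv N.r_neg a_minus_def)
    also have "\<dots> \<longleftrightarrow> g (x \<ominus>\<^bsub>M\<^esub> y) = \<zero>\<^bsub>N'\<^esub>" using ker that by simp
    also have "\<dots> \<longleftrightarrow> g x = g y"
      using that gh(1) mod_hom_minus[OF assms(1,3) g(1)]
      by (metis N'.add.inv_closed N'.add.inv_equality N'.add.inv_inv N'.r_neg a_minus_def)
    finally show ?thesis .
  qed
  have "g \<circ> s \<in> mod_hom R N N'"
  proof (rule mod_homI)
    fix x assume x: "x \<in> carrier N"
    then show "(g \<circ> s) x \<in> carrier N'" using s gh by simp
    { fix y assume y: "y \<in> carrier N"
      have "g (s (x \<oplus>\<^bsub>N\<^esub> y)) = g (s x \<oplus>\<^bsub>M\<^esub> s y)"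
        using x y s by (subst eq[symmetric]) (simp_all add: fh)
      then show "(g \<circ> s) (x \<oplus>\<^bsub>N\<^esub> y) = (g \<circ> s) x \<oplus>\<^bsub>N'\<^esub> (g \<circ> s) y" using x y s gh by simp }
    fix r assume r: "r \<in> carrier R"
    have "g (s (r \<odot>\<^bsub>N\<^esub> x)) = g (r \<odot>\<^bsub>M\<^esub> s x)"
      using x r s by (subst eq[symmetric]) (simp_all add: fh)
    then show "(g \<circ> s) (r \<odot>\<^bsub>N\<^esub> x) = r \<odot>\<^bsub>N'\<^esub> (g \<circ> s) x" using x r s gh by simp
  qed
  moreover have "bij_betw (g \<circ> s) (carrier N) (carrier N')"
    unfolding bij_betw_def
  proof
    show "inj_on (g \<circ> s) (carrier N)"
    proof (rule inj_onI)
      fix x y assume "x \<in> carrier N" "y \<in> carrier N" "(g \<circ> s) x = (g \<circ> s) y"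
      then show "x = y" using eq[of "s x" "s y"] s by simp
    qed
    have "g u \<in> (g \<circ> s) ` carrier N" if "u \<in> carrier M" for u
    proof
      show "g u = (g \<circ> s) (f u)" using eq[of u "s (f u)"] s[of "f u"] fh(1) that by simp
    qed (use fh that in auto)
    then have "carrier N' \<subseteq> (g \<circ> s) ` carrier N" unfolding g(2)[symmetric] by blast
    moreover have "(g \<circ> s) ` carrier N \<subseteq> carrier N'" using s(1) gh(1) by auto
    ultimately show "(g \<circ> s) ` carrier N = carrier N'" by blast
  qed
  ultimately show ?thesis unfolding mod_iso_def by blast
qed

lemma mod_iso_image:
  assumes "module R M" "module R N" "f \<in> mod_hom R M N" "inj_on f (carrier M)"
  shows "mod_iso R M (N\<lparr>carrier := f ` carrier M\<rparr>)"
  unfolding mod_iso_def using assms(3,4)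
  by (intro bexI[of _ f]) (auto simp: bij_betw_def intro!: mod_hom_cod)

section \<open>Quotients, copies and direct sums\<close>

text \<open>The condition under \<open>SOME\<close> is the same for all \<open>x\<close> in one
  coset of the submodule \<open>K\<close>, so each coset receives a single representative.\<close>

definition coset_rep :: "('r, 'm, 'd) module_scheme \<Rightarrow> 'm set \<Rightarrow> 'm \<Rightarrow> 'm"
  where "coset_rep M K x = (SOME y. y \<in> carrier M \<and> y \<ominus>\<^bsub>M\<^esub> x \<in> K)"

text \<open>The quotient is built on chosen representatives, so that it lives in the same type.\<close>

definition quot :: "('r, 'm) module \<Rightarrow> 'm set \<Rightarrow> ('r, 'm) module"
  where "quot M K =
    \<lparr>carrier = coset_rep M K ` carrier M,
     monoid.mult = undefined, one = undefined,
     zero = coset_rep M K \<zero>\<^bsub>M\<^esub>,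
     add = (\<lambda>x y. coset_rep M K (x \<oplus>\<^bsub>M\<^esub> y)),
     module.smult = (\<lambda>r x. coset_rep M K (r \<odot>\<^bsub>M\<^esub> x))\<rparr>"

lemma coset_rep:
  assumes "module R M" "submodule K R M" "x \<in> carrier M"
  shows "coset_rep M K x \<in> carrier M" "coset_rep M K x \<ominus>\<^bsub>M\<^esub> x \<in> K"
proof -
  interpret M: module R M by fact
  have "x \<in> carrier M \<and> x \<ominus>\<^bsub>M\<^esub> x \<in> K"
    using assms submoduleD(2)[OF assms(1,2)] by (simp add: a_minus_def M.r_neg)
  then have "coset_rep M K x \<in> carrier M \<and> coset_rep M K x \<ominus>\<^bsub>M\<^esub> x \<in> K"
    unfolding coset_rep_def by (rule someI)
  then show "coset_rep M K x \<in> carrier M" "coset_rep M K x \<ominus>\<^bsub>M\<^esub> x \<in> K" by auto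
qed

lemma (in abelian_group) minus_telescope:
  "x \<in> carrier G \<Longrightarrow> y \<in> carrier G \<Longrightarrow> z \<in> carrier G \<Longrightarrow> (x \<ominus> y) \<oplus> (y \<ominus> z) = x \<ominus> z"
  by (simp add: a_minus_def a_assoc) (simp add: a_assoc[symmetric] l_neg)

lemma coset_rep_eq_iff:
  assumes "module R M" "submodule K R M" "x \<in> carrier M" "y \<in> carrier M"
  shows "coset_rep M K x = coset_rep M K y \<longleftrightarrow> x \<ominus>\<^bsub>M\<^esub> y \<in> K"
proof -
  interpret M: module R M by fact
  note K = submoduleD[OF assms(1,2)]
  have neg: "u \<ominus>\<^bsub>M\<^esub> v \<in> K" if "v \<ominus>\<^bsub>M\<^esub> u \<in> K" "u \<in> carrier M" "v \<in> carrier M" for u v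
  proof -
    have "\<zero>\<^bsub>M\<^esub> \<ominus>\<^bsub>M\<^esub> (v \<ominus>\<^bsub>M\<^esub> u) \<in> K" using K that by blast
    moreover have "\<zero>\<^bsub>M\<^esub> \<ominus>\<^bsub>M\<^esub> (v \<ominus>\<^bsub>M\<^esub> u) = u \<ominus>\<^bsub>M\<^esub> v"
      using that by (simp add: a_minus_def M.minus_add M.M.a_comm)
    ultimately show ?thesis by simp
  qed
  show ?thesis
  proof
    assume eq: "coset_rep M K x = coset_rep M K y"
    have "x \<ominus>\<^bsub>M\<^esub> coset_rep M K x \<in> K" "coset_rep M K x \<ominus>\<^bsub>M\<^esub> y \<in> K"
      using coset_rep[OF assms(1,2,3)] coset_rep(2)[OF assms(1,2,4)] assms(3) eq neg by auto
    then have "(x \<ominus>\<^bsub>M\<^esub> coset_rep M K x) \<oplus>\<^bsub>M\<^esub> (coset_rep M K x \<ominus>\<^bsub>M\<^esub> y) \<in> K" using K by blast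
    then show "x \<ominus>\<^bsub>M\<^esub> y \<in> K" using M.minus_telescope coset_rep(1)[OF assms(1,2)] assms by simp
  next
    assume xy: "x \<ominus>\<^bsub>M\<^esub> y \<in> K"
    have "z \<ominus>\<^bsub>M\<^esub> x \<in> K \<longleftrightarrow> z \<ominus>\<^bsub>M\<^esub> y \<in> K" if "z \<in> carrier M" for z
      using K(3)[OF _ xy, of "z \<ominus>\<^bsub>M\<^esub> x"] K(3)[OF _ neg[OF xy], of "z \<ominus>\<^bsub>M\<^esub> y"] that assms
      by (auto simp: M.minus_telescope)
    then show "coset_rep M K x = coset_rep M K y"
      unfolding coset_rep_def by (metis (no_types, lifting))
  qed
qed

lemma coset_rep_cong:
  assumes "module R M" "submodule K R M" "x \<in> carrier M" "y \<in> carrier M" "x \<ominus>\<^bsub>M\<^esub> y \<in> K"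
  shows "coset_rep M K x = coset_rep M K y"
  using coset_rep_eq_iff[OF assms(1-4)] assms(5) by simp

lemma coset_rep_hom:
  assumes "module R M" "submodule K R M"
  shows "coset_rep M K \<in> mod_hom R M (quot M K)"
proof -
  interpret M: module R M by fact
  let ?c = "coset_rep M K"
  note K = submoduleD[OF assms] and c = coset_rep[OF assms]
  have minus_c: "x \<ominus>\<^bsub>M\<^esub> ?c x \<in> K" if "x \<in> carrier M" for x
  proof -
    have "?c x = ?c (?c x)"
      using c that by (intro coset_rep_cong[OF assms, symmetric]) auto
    then show ?thesis using coset_rep_eq_iff[OF assms that c(1)[OF that]] by simp
  qed
  show ?thesis
  proof (rule mod_homI)
    fix x y assume xy: "x \<in> carrier M" "y \<in> carrier M"
    have "(x \<oplus>\<^bsub>M\<^esub> y) \<ominus>\<^bsub>M\<^esub> (?c x \<oplus>\<^bsub>M\<^esub> ?c y) = (x \<ominus>\<^bsub>M\<^esub> ?c x) \<oplus>\<^bsub>M\<^esub> (y \<ominus>\<^bsub>M\<^esub> ?c y)"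
      using xy c by (simp add: a_minus_def M.minus_add M.M.a_ac)
    then have "?c (x \<oplus>\<^bsub>M\<^esub> y) = ?c (?c x \<oplus>\<^bsub>M\<^esub> ?c y)"
      using xy c minus_c K(3) by (intro coset_rep_cong[OF assms]) auto
    then show "?c (x \<oplus>\<^bsub>M\<^esub> y) = ?c x \<oplus>\<^bsub>quot M K\<^esub> ?c y" by (simp add: quot_def)
  next
    fix r x assume rx: "r \<in> carrier R" "x \<in> carrier M"
    have "(r \<odot>\<^bsub>M\<^esub> x) \<ominus>\<^bsub>M\<^esub> (r \<odot>\<^bsub>M\<^esub> ?c x) = r \<odot>\<^bsub>M\<^esub> (x \<ominus>\<^bsub>M\<^esub> ?c x)"
      using rx c by (simp add: a_minus_def M.smult_r_distr M.smult_r_minus)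
    then have "?c (r \<odot>\<^bsub>M\<^esub> x) = ?c (r \<odot>\<^bsub>M\<^esub> ?c x)"
      using rx c minus_c K(4) by (intro coset_rep_cong[OF assms]) auto
    then show "?c (r \<odot>\<^bsub>M\<^esub> x) = r \<odot>\<^bsub>quot M K\<^esub> ?c x" by (simp add: quot_def)
  qed (simp add: quot_def)
qed

lemma quot_surj: "coset_rep M K ` carrier M = carrier (quot M K)"
  by (simp add: quot_def)

lemma module_quot:
  "module R M \<Longrightarrow> submodule K R M \<Longrightarrow> module R (quot M K)"
  by (rule module_hom_image[OF _ coset_rep_hom]) (auto simp: quot_def)

lemma coset_rep_zero_iff:
  assumes "module R M" "submodule K R M" "x \<in> carrier M"
  shows "coset_rep M K x = \<zero>\<^bsub>quot M K\<^esub> \<longleftrightarrow> x \<in> K"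
proof -
  interpret M: module R M by fact
  have "\<ominus>\<^bsub>M\<^esub> \<zero>\<^bsub>M\<^esub> = \<zero>\<^bsub>M\<^esub>" by (rule M.M.minus_equality) simp_all
  then have "x \<ominus>\<^bsub>M\<^esub> \<zero>\<^bsub>M\<^esub> = x" using assms(3) unfolding a_minus_def by (metis M.M.r_zero)
  then show ?thesis
    using coset_rep_eq_iff[OF assms(1-3) M.M.zero_closed] by (simp add: quot_def)
qed

text \<open>Since the elements of \<open>quot M K\<close> are elements of \<open>M\<close>, a map on
  \<open>M\<close> that kills \<open>K\<close> serves unchanged as the induced map on the
  quotient.\<close>

lemma quot_hom:
  assumes "module R M" "submodule K R M" "module R N" "f \<in> mod_hom R M N"
    and "\<And>x. x \<in> K \<Longrightarrow> f x = \<zero>\<^bsub>N\<^esub>"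
  shows "f \<in> mod_hom R (quot M K) N" "\<And>x. x \<in> carrier M \<Longrightarrow> f (coset_rep M K x) = f x"
proof -
  interpret M: module R M by fact
  interpret N: module R N by fact
  note f = mod_homD[OF assms(4)] and c = coset_rep[OF assms(1,2)]
  show fc: "f (coset_rep M K x) = f x" if x: "x \<in> carrier M" for x
  proof -
    have "f (coset_rep M K x) \<ominus>\<^bsub>N\<^esub> f x = \<zero>\<^bsub>N\<^esub>"
      using assms(5)[OF c(2)[OF x]] mod_hom_minus[OF assms(1,3,4)] x c by simp
    then show ?thesis using f(1) x c
      by (metis N.add.inv_closed N.minus_equality N.minus_minus a_minus_def)
  qed
  show "f \<in> mod_hom R (quot M K) N"
    by (rule mod_homI) (auto simp: quot_def fc f c)
qed

definition transport :: "('m \<Rightarrow> 'n) \<Rightarrow> ('r, 'm, 'd) module_scheme \<Rightarrow> ('r, 'n) module"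
  where "transport h M =
    \<lparr>carrier = h ` carrier M,
     monoid.mult = undefined, one = undefined,
     zero = h \<zero>\<^bsub>M\<^esub>,
     add = (\<lambda>x y. h (inv_into (carrier M) h x \<oplus>\<^bsub>M\<^esub> inv_into (carrier M) h y)),
     module.smult = (\<lambda>r x. h (r \<odot>\<^bsub>M\<^esub> inv_into (carrier M) h x))\<rparr>"

lemma transport:
  assumes "module R M" "inj_on h (carrier M)"
  shows "module R (transport h M)" "mod_iso R M (transport h M)"
proof -
  have h: "h \<in> mod_hom R M (transport h M)"
    using assms(2) by (auto intro!: mod_homI simp: transport_def)
  then show "module R (transport h M)"
    by (rule module_hom_image[OF assms(1)]) (auto simp: transport_def)
  show "mod_iso R M (transport h M)"
    unfolding mod_iso_def using h assms(2)
    by (intro bexI[of _ h]) (auto simp: bij_betw_def transport_def)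
qed

lemma direct_sum_simps [simp]:
  "carrier (direct_sum M N) = carrier M \<times> carrier N"
  "\<zero>\<^bsub>direct_sum M N\<^esub> = (\<zero>\<^bsub>M\<^esub>, \<zero>\<^bsub>N\<^esub>)"
  "(x, y) \<oplus>\<^bsub>direct_sum M N\<^esub> (x', y') = (x \<oplus>\<^bsub>M\<^esub> x', y \<oplus>\<^bsub>N\<^esub> y')"
  "r \<odot>\<^bsub>direct_sum M N\<^esub> (x, y) = (r \<odot>\<^bsub>M\<^esub> x, r \<odot>\<^bsub>N\<^esub> y)"
  by (auto simp: direct_sum_def)

lemma module_direct_sum:
  assumes "module R M" "module R N"
  shows "module R (direct_sum M N)"
proof -
  interpret M: module R M by fact
  interpret N: module R N by fact
  have *: "\<exists>u\<in>carrier M. \<exists>v\<in>carrier N. u \<oplus>\<^bsub>M\<^esub> x = \<zero>\<^bsub>M\<^esub> \<and> v \<oplus>\<^bsub>N\<^esub> y = \<zero>\<^bsub>N\<^esub>"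
    if "x \<in> carrier M" "y \<in> carrier N" for x y
    using that M.l_neg N.l_neg by blast
  show ?thesis
    by (rule moduleI)
      (auto intro!: abelian_groupI simp: M.M.a_ac N.M.a_ac M.smult_l_distr N.smult_l_distr
        M.smult_r_distr N.smult_r_distr M.smult_assoc1 N.smult_assoc1 M.R.is_cring *)
qed

lemma direct_sum_homs:
  assumes "module R M" "module R N"
  shows "fst \<in> mod_hom R (direct_sum M N) M" "snd \<in> mod_hom R (direct_sum M N) N"
    "(\<lambda>x. (x, \<zero>\<^bsub>N\<^esub>)) \<in> mod_hom R M (direct_sum M N)"
    "(\<lambda>y. (\<zero>\<^bsub>M\<^esub>, y)) \<in> mod_hom R N (direct_sum M N)"
proof -
  interpret M: module R M by fact
  interpret N: module R N by fact
  show "fst \<in> mod_hom R (direct_sum M N) M" "snd \<in> mod_hom R (direct_sum M N) N"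
    "(\<lambda>x. (x, \<zero>\<^bsub>N\<^esub>)) \<in> mod_hom R M (direct_sum M N)"
    "(\<lambda>y. (\<zero>\<^bsub>M\<^esub>, y)) \<in> mod_hom R N (direct_sum M N)"
    by (auto intro!: mod_homI)
qed

section \<open>Finitely generated modules\<close>

definition adjoin :: "('r, 'c) ring_scheme \<Rightarrow> ('r, 'm, 'd) module_scheme \<Rightarrow> 'm set \<Rightarrow> 'm \<Rightarrow> 'm set"
  where "adjoin R M N g = {y \<oplus>\<^bsub>M\<^esub> r \<odot>\<^bsub>M\<^esub> g | y r. y \<in> N \<and> r \<in> carrier R}"

lemma adjoin:
  assumes "module R M" "submodule N R M" "g \<in> carrier M"
  shows "submodule (adjoin R M N g) R M" "N \<subseteq> adjoin R M N g" "g \<in> adjoin R M N g"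
proof -
  interpret M: module R M by fact
  note N = submoduleD[OF assms(1,2)]
  show "N \<subseteq> adjoin R M N g"
  proof
    fix y assume "y \<in> N"
    then show "y \<in> adjoin R M N g"
      unfolding adjoin_def using N(1) assms(3)
      by (intro CollectI exI[of _ y] exI[of _ "\<zero>\<^bsub>R\<^esub>"]) simp
  qed
  then have z: "\<zero>\<^bsub>M\<^esub> \<in> adjoin R M N g" using N(2) by blast
  show "g \<in> adjoin R M N g"
    unfolding adjoin_def using N(2) assms(3)
    by (intro CollectI exI[of _ "\<zero>\<^bsub>M\<^esub>"] exI[of _ "\<one>\<^bsub>R\<^esub>"]) simp
  show "submodule (adjoin R M N g) R M"
    unfolding submodule_iff[OF assms(1)]
  proof (intro conjI ballI)
    show "adjoin R M N g \<subseteq> carrier M" using N(1) assms(3) by (auto simp: adjoin_def)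
    fix x y assume "x \<in> adjoin R M N g" "y \<in> adjoin R M N g"
    then obtain u v r s where *: "x = u \<oplus>\<^bsub>M\<^esub> r \<odot>\<^bsub>M\<^esub> g" "y = v \<oplus>\<^bsub>M\<^esub> s \<odot>\<^bsub>M\<^esub> g"
      "u \<in> N" "v \<in> N" "r \<in> carrier R" "s \<in> carrier R" by (auto simp: adjoin_def)
    have "x \<oplus>\<^bsub>M\<^esub> y = (u \<oplus>\<^bsub>M\<^esub> v) \<oplus>\<^bsub>M\<^esub> (r \<oplus>\<^bsub>R\<^esub> s) \<odot>\<^bsub>M\<^esub> g"
      using * N(1) assms(3) by (simp add: M.smult_l_distr M.M.a_ac)
    then show "x \<oplus>\<^bsub>M\<^esub> y \<in> adjoin R M N g" unfolding adjoin_def using * N(3) by blast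
  next
    fix t x assume t: "t \<in> carrier R" and "x \<in> adjoin R M N g"
    then obtain u r where *: "x = u \<oplus>\<^bsub>M\<^esub> r \<odot>\<^bsub>M\<^esub> g" "u \<in> N" "r \<in> carrier R" by (auto simp: adjoin_def)
    have "t \<odot>\<^bsub>M\<^esub> x = t \<odot>\<^bsub>M\<^esub> u \<oplus>\<^bsub>M\<^esub> (t \<otimes>\<^bsub>R\<^esub> r) \<odot>\<^bsub>M\<^esub> g"
      using * N(1) assms(3) t by (simp add: M.smult_r_distr M.smult_assoc1)
    then show "t \<odot>\<^bsub>M\<^esub> x \<in> adjoin R M N g" unfolding adjoin_def using * N(4) t by blast
  qed (rule z)
qed

lemma adjoin_least:
  assumes "module R M" "submodule L R M" "N \<subseteq> L" "g \<in> L"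
  shows "adjoin R M N g \<subseteq> L"
  using submoduleD[OF assms(1,2)] assms(3,4) by (auto simp: adjoin_def)

lemma fgE:
  assumes "finitely_generated R M"
  obtains G where "finite G" "G \<subseteq> carrier M"
    "\<And>N. submodule N R M \<Longrightarrow> G \<subseteq> N \<Longrightarrow> N = carrier M"
  using assms unfolding finitely_generated_def by metis

text \<open>Adjoining the generators one after the other, starting from zero, ends with a submodule
  that contains all of them and hence is \<open>M\<close>.\<close>

lemma fg_induct:
  assumes M: "module R M" and fg: "finitely_generated R M"
    and zero: "P {\<zero>\<^bsub>M\<^esub>}"
    and step: "\<And>N g. submodule N R M \<Longrightarrow> g \<in> carrier M \<Longrightarrow> P N \<Longrightarrow> P (adjoin R M N g)"
  shows "P (carrier M)"
proof -
  obtain G where G: "finite G" "G \<subseteq> carrier M"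
    and gen: "\<And>N. submodule N R M \<Longrightarrow> G \<subseteq> N \<Longrightarrow> N = carrier M"
    using fg by (rule fgE) blast
  have "\<exists>N. submodule N R M \<and> G \<subseteq> N \<and> P N"
    using G
  proof (induction G rule: finite_induct)
    case empty
    show ?case using submodule_zero[OF M] zero by blast
  next
    case (insert g G)
    then obtain N where "submodule N R M" "G \<subseteq> N" "P N" by auto
    then show ?case using adjoin[OF M, of N g] step[of N g] insert.prems
      by (intro exI[of _ "adjoin R M N g"]) auto
  qed
  then show ?thesis using gen by blast
qed

lemma fg_image:
  assumes "module R M" "module R N" "f \<in> mod_hom R M N" "f ` carrier M = carrier N"
    "finitely_generated R M"
  shows "finitely_generated R N"
proof -
  obtain G where G: "finite G" "G \<subseteq> carrier M"
    and gen: "\<And>K. submodule K R M \<Longrightarrow> G \<subseteq> K \<Longrightarrow> K = carrier M"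
    using assms(5) by (rule fgE) blast
  have "K = carrier N" if K: "submodule K R N" "f ` G \<subseteq> K" for K
  proof -
    have "{x \<in> carrier M. f x \<in> K} = carrier M"
    proof (rule gen[OF submodule_vimage[OF assms(1-3) K(1)]])
      show "G \<subseteq> {x \<in> carrier M. f x \<in> K}" using K(2) G(2) by blast
    qed
    then have "f ` carrier M \<subseteq> K" by (metis (lifting) image_subsetI mem_Collect_eq)
    moreover have "K \<subseteq> carrier N" using submoduleD(1)[OF assms(2) K(1)] by (rule subsetI)
    ultimately show ?thesis using assms(4) by simp
  qed
  then show ?thesis
    unfolding finitely_generated_def using G mod_homD(1)[OF assms(3)]
    by (intro exI[of _ "f ` G"]) auto
qed

lemma fg_iso:
  assumes "module R M" "module R N" "mod_iso R M N" "finitely_generated R M"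
  shows "finitely_generated R N"
  using assms fg_image unfolding mod_iso_def bij_betw_def by metis

text \<open>Generators of the kernel together with lifts of generators of \<open>N\<close> generate
  \<open>M\<close>: they hit all of \<open>N\<close>, and two preimages of the same element differ
  by an element of the kernel.\<close>

lemma fg_ext:
  assumes "module R M" "module R N" "f \<in> mod_hom R M N" "f ` carrier M = carrier N"
    "finitely_generated R N" "finitely_generated R (M\<lparr>carrier := a_kernel M N f\<rparr>)"
  shows "finitely_generated R M"
proof -
  interpret M: module R M by fact
  interpret N: module R N by fact
  let ?K = "a_kernel M N f"
  have subK: "submodule ?K R M" by (rule submodule_kernel[OF assms(1-3)])
  obtain G where G: "finite G" "G \<subseteq> carrier N"
    and genG: "\<And>K. submodule K R N \<Longrightarrow> G \<subseteq> K \<Longrightarrow> K = carrier N"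
    using assms(5) by (rule fgE) blast
  obtain F where F: "finite F" "F \<subseteq> carrier (M\<lparr>carrier := ?K\<rparr>)"
    and genF: "\<And>K. submodule K R (M\<lparr>carrier := ?K\<rparr>) \<Longrightarrow> F \<subseteq> K \<Longrightarrow> K = carrier (M\<lparr>carrier := ?K\<rparr>)"
    using assms(6) by (rule fgE) (rule that)
  note F = F[simplified] and genF = genF[simplified]
  let ?s = "inv_into (carrier M) f"
  have s: "?s x \<in> carrier M" "f (?s x) = x" if "x \<in> carrier N" for x
    using that assms(4) by (auto simp: inv_into_into f_inv_into_f)
  have "L = carrier M" if L: "submodule L R M" "F \<union> ?s ` G \<subseteq> L" for L
  proof -
    note LD = submoduleD[OF assms(1) L(1)]
    have "L \<inter> ?K = ?K"
      using L F submodule_Int[OF assms(1) L(1) subK]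
      by (intro genF) (auto simp: submodule_submodule_iff[OF assms(1) subK])
    then have KL: "?K \<subseteq> L" by blast
    have "f ` L = carrier N"
    proof (rule genG[OF submodule_image[OF assms(1-3) L(1)]])
      show "G \<subseteq> f ` L"
      proof
        fix x assume "x \<in> G"
        then have "?s x \<in> L" "f (?s x) = x" using L(2) s G(2) by auto
        then show "x \<in> f ` L" by (metis imageI)
      qed
    qed
    have "x \<in> L" if x: "x \<in> carrier M" for x
    proof -
      obtain y where y: "y \<in> L" "f x = f y"
        using \<open>f ` L = carrier N\<close> mod_homD(1)[OF assms(3) x] by (metis imageE)
      then have "f (x \<ominus>\<^bsub>M\<^esub> y) = \<zero>\<^bsub>N\<^esub>"
        using mod_hom_minus[OF assms(1-3) x LD(1)] mod_homD(1)[OF assms(3) x]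
        by (simp add: a_minus_def N.r_neg)
      then have "x \<ominus>\<^bsub>M\<^esub> y \<in> L" using KL x LD(1)[OF y(1)] by (auto simp: a_kernel_def')
      then have "(x \<ominus>\<^bsub>M\<^esub> y) \<oplus>\<^bsub>M\<^esub> y \<in> L" using LD y by blast
      then show ?thesis using x LD(1)[OF y(1)] by (simp add: a_minus_def M.M.a_assoc M.l_neg)
    qed
    then show ?thesis using LD(1) by blast
  qed
  moreover have "F \<union> ?s ` G \<subseteq> carrier M"
    using F s G submoduleD(1)[OF assms(1) subK] by blast
  ultimately show ?thesis
    unfolding finitely_generated_def using F(1) G(1) by (intro exI[of _ "F \<union> ?s ` G"]) simp
qed

section \<open>Noetherian modules\<close>

definition noetherian :: "('r, 'c) ring_scheme \<Rightarrow> ('r, 'm) module \<Rightarrow> bool"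
  where "noetherian R M \<longleftrightarrow> (\<forall>N. submodule N R M \<longrightarrow> finitely_generated R (M\<lparr>carrier := N\<rparr>))"

lemma noetherian_image:
  assumes "module R M" "module R N" "f \<in> mod_hom R M N" "f ` carrier M = carrier N"
    "noetherian R M"
  shows "noetherian R N"
  unfolding noetherian_def
proof (intro allI impI)
  fix K assume K: "submodule K R N"
  let ?P = "{x \<in> carrier M. f x \<in> K}"
  have P: "submodule ?P R M" by (rule submodule_vimage[OF assms(1-3) K])
  have "f \<in> mod_hom R (M\<lparr>carrier := ?P\<rparr>) (N\<lparr>carrier := K\<rparr>)"
    by (rule mod_hom_cod[OF mod_hom_dom[OF assms(3)]]) auto
  moreover have "K \<subseteq> f ` carrier M" unfolding assms(4) using submoduleD(1)[OF assms(2) K] by (rule subsetI)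
  then have "f ` ?P = K" by auto
  ultimately show "finitely_generated R (N\<lparr>carrier := K\<rparr>)"
    using fg_image[OF module_submodule[OF assms(1) P] module_submodule[OF assms(2) K]] assms(5) P
    by (simp add: noetherian_def)
qed

text \<open>A submodule \<open>L\<close> of the sum is an extension of its projection to
  \<open>N\<close> by its slice in \<open>M\<close>, and both are finitely generated.\<close>

lemma noetherian_direct_sum:
  assumes "module R M" "module R N" "noetherian R M" "noetherian R N"
  shows "noetherian R (direct_sum M N)"
  unfolding noetherian_def
proof (intro allI impI)
  interpret M: module R M by fact
  interpret N: module R N by fact
  let ?D = "direct_sum M N"
  have D: "module R ?D" by (rule module_direct_sum[OF assms(1,2)])
  fix L assume L: "submodule L R ?D"
  note LD = submoduleD[OF D L]
  let ?L = "?D\<lparr>carrier := L\<rparr>"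
  have Lm: "module R ?L" by (rule module_submodule[OF D L])
  have snd: "snd \<in> mod_hom R ?D N" by (rule direct_sum_homs[OF assms(1,2)])
  have im: "submodule (snd ` L) R N" by (rule submodule_image[OF D assms(2) snd L])
  let ?N = "N\<lparr>carrier := snd ` L\<rparr>"
  have snd': "snd \<in> mod_hom R ?L ?N"
    using snd LD(1) by (intro mod_hom_cod mod_hom_dom) auto
  define A where "A = {x \<in> carrier M. (x, \<zero>\<^bsub>N\<^esub>) \<in> L}"
  have A: "submodule A R M"
    unfolding A_def using submodule_vimage[OF assms(1) D direct_sum_homs(3)[OF assms(1,2)] L] by simp
  have ker: "a_kernel ?L ?N snd = (\<lambda>x. (x, \<zero>\<^bsub>N\<^esub>)) ` A"
    using LD(1) by (force simp: a_kernel_def' A_def)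
  have "(\<lambda>x. (x, \<zero>\<^bsub>N\<^esub>)) \<in> mod_hom R (M\<lparr>carrier := A\<rparr>) (?L\<lparr>carrier := a_kernel ?L ?N snd\<rparr>)"
    unfolding ker by (auto intro!: mod_homI)
  then have "finitely_generated R (?L\<lparr>carrier := a_kernel ?L ?N snd\<rparr>)"
    by (rule fg_image[OF module_submodule[OF assms(1) A] module_submodule[OF Lm
          submodule_kernel[OF Lm module_submodule[OF assms(2) im] snd']]])
      (use A assms(3) in \<open>auto simp: ker noetherian_def\<close>)
  then show "finitely_generated R ?L"
    using assms(4) im by (intro fg_ext[OF Lm module_submodule[OF assms(2) im] snd'])
      (auto simp: noetherian_def)
qed

lemma ideal_module_simps [simp]:
  "carrier (ideal_module R I) = I" "\<zero>\<^bsub>ideal_module R I\<^esub> = \<zero>\<^bsub>R\<^esub>"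
  "x \<oplus>\<^bsub>ideal_module R I\<^esub> y = x \<oplus>\<^bsub>R\<^esub> y" "r \<odot>\<^bsub>ideal_module R I\<^esub> x = r \<otimes>\<^bsub>R\<^esub> x"
  "(ideal_module R I)\<lparr>carrier := J\<rparr> = ideal_module R J"
  by (auto simp: ideal_module_def module_via_def)

lemma module_self:
  assumes "cring R" shows "module R (ideal_module R (carrier R))"
proof -
  interpret cring R by fact
  show ?thesis
    by (rule moduleI) (auto intro!: abelian_groupI simp: assms a_ac l_distr r_distr m_assoc l_neg
        intro: bexI[of _ "\<ominus>\<^bsub>R\<^esub> _"])
qed

lemma smult_hom:
  assumes "module R M" "g \<in> carrier M"
  shows "(\<lambda>r. r \<odot>\<^bsub>M\<^esub> g) \<in> mod_hom R (ideal_module R (carrier R)) M"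
proof -
  interpret M: module R M by fact
  show ?thesis using assms(2) by (auto intro!: mod_homI simp: M.smult_l_distr M.smult_assoc1)
qed

text \<open>Adjoining one generator stays noetherian because N + R g is an image of the direct sum
  of N and \<open>R\<close>.\<close>

lemma noetherian_fg:
  assumes R: "noetherian R (ideal_module R (carrier R))"
    and M: "module R M" and fg: "finitely_generated R M"
  shows "noetherian R M"
proof -
  interpret M: module R M by fact
  have Rm: "module R (ideal_module R (carrier R))" by (rule module_self[OF M.R.is_cring])
  have "submodule (carrier M) R M \<and> noetherian R (M\<lparr>carrier := carrier M\<rparr>)"
  proof (rule fg_induct[OF M fg])
    have "N = {\<zero>\<^bsub>M\<^esub>}" if "submodule N R (M\<lparr>carrier := {\<zero>\<^bsub>M\<^esub>}\<rparr>)" for N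
      using that submoduleD(2)[OF M] by (auto simp: submodule_submodule_iff[OF M submodule_zero[OF M]])
    then show "submodule {\<zero>\<^bsub>M\<^esub>} R M \<and> noetherian R (M\<lparr>carrier := {\<zero>\<^bsub>M\<^esub>}\<rparr>)"
      using submodule_zero[OF M] submoduleD(2)[OF M]
      by (auto simp: noetherian_def finitely_generated_def intro!: exI[of _ "{}"])
  next
    fix N g
    assume N: "submodule N R M" and g: "g \<in> carrier M"
      and IH: "submodule N R M \<and> noetherian R (M\<lparr>carrier := N\<rparr>)"
    let ?D = "direct_sum (M\<lparr>carrier := N\<rparr>) (ideal_module R (carrier R))"
    have D: "module R ?D" "noetherian R ?D"
      using module_submodule[OF M N] Rm R IH
      by (auto intro: module_direct_sum noetherian_direct_sum)
    note A = adjoin[OF M N g]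
    have im: "(\<lambda>(y, r). y \<oplus>\<^bsub>M\<^esub> r \<odot>\<^bsub>M\<^esub> g) ` carrier ?D = adjoin R M N g"
      by (auto simp: adjoin_def image_iff)
    have "(\<lambda>(y, r). y \<oplus>\<^bsub>M\<^esub> r \<odot>\<^bsub>M\<^esub> g) \<in> mod_hom R ?D M"
      using submoduleD(1)[OF M N] g
      by (auto intro!: mod_homI simp: M.smult_r_distr M.smult_l_distr M.smult_assoc1 M.M.a_ac)
    then have "(\<lambda>(y, r). y \<oplus>\<^bsub>M\<^esub> r \<odot>\<^bsub>M\<^esub> g) \<in> mod_hom R ?D (M\<lparr>carrier := adjoin R M N g\<rparr>)"
      by (rule mod_hom_cod) (simp only: im order_refl)
    then have "noetherian R (M\<lparr>carrier := adjoin R M N g\<rparr>)"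
      using noetherian_image[OF D(1) module_submodule[OF M A(1)]] D(2) im by simp
    then show "submodule (adjoin R M N g) R M \<and> noetherian R (M\<lparr>carrier := adjoin R M N g\<rparr>)"
      using A by blast
  qed
  then show ?thesis by simp
qed

section \<open>Subcategories and modules over other types\<close>

text \<open>Membership up to isomorphism. It makes sense for modules over any carrier type, so that
  ideals, quotients and direct sums can be said to belong to \<open>X\<close>.\<close>

definition has_copy :: "('r, 'c) ring_scheme \<Rightarrow> ('r, 'm) module set \<Rightarrow> ('r, 'n, 'd) module_scheme \<Rightarrow> bool"
  where "has_copy R X M \<longleftrightarrow> (\<exists>N\<in>X. mod_iso R N M)"

lemma has_copyI: "M \<in> X \<Longrightarrow> has_copy R X M"
  unfolding has_copy_def using mod_iso_refl by blast

lemma has_copy_iso: "has_copy R X M \<Longrightarrow> mod_iso R M N \<Longrightarrow> has_copy R X N"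
  unfolding has_copy_def using mod_iso_trans by blast

lemma fg_modules_iff: "M \<in> fg_modules R \<longleftrightarrow> module R M \<and> finitely_generated R M"
  by (simp add: fg_modules_def)

lemma subcategoryD:
  assumes "subcategory R X"
  shows "M \<in> X \<Longrightarrow> module R M" "M \<in> X \<Longrightarrow> finitely_generated R M" "M \<in> X \<Longrightarrow> M \<in> fg_modules R"
    "X \<noteq> {}" "M \<in> X \<Longrightarrow> N \<in> fg_modules R \<Longrightarrow> mod_iso R M N \<Longrightarrow> N \<in> X"
  using assms unfolding subcategory_def fg_modules_def by auto

lemma has_copyD:
  assumes "subcategory R X" "has_copy R X M" "M \<in> fg_modules R"
  shows "M \<in> X"
  using assms unfolding subcategory_def has_copy_def by blast

lemma has_copy_fg:
  assumes "subcategory R X" "has_copy R X M" "module R M"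
  shows "finitely_generated R M"
  using assms fg_iso subcategoryD(1,2)[OF assms(1)] unfolding has_copy_def by blast

lemma mod_iso_direct_sum:
  assumes "mod_iso R A B" "mod_iso R C D"
  shows "mod_iso R (direct_sum A C) (direct_sum B D)"
proof -
  obtain f g where f: "f \<in> mod_hom R A B" "bij_betw f (carrier A) (carrier B)"
    and g: "g \<in> mod_hom R C D" "bij_betw g (carrier C) (carrier D)"
    using assms unfolding mod_iso_def by blast
  have "map_prod f g \<in> mod_hom R (direct_sum A C) (direct_sum B D)"
    using mod_homD[OF f(1)] mod_homD[OF g(1)] by (auto intro!: mod_homI)
  moreover have "bij_betw (map_prod f g) (carrier A \<times> carrier C) (carrier B \<times> carrier D)"
    using f(2) g(2) by (auto simp: bij_betw_def map_prod_surj_on intro: map_prod_inj_on)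
  ultimately show ?thesis unfolding mod_iso_def by auto
qed

text \<open>The two maps express that the type of the objects is large. With \<open>unpair\<close>,
  one ring element codes two, so finitely generated modules have at most as many elements as
  \<open>'r\<close>; with \<open>embed\<close>, a set of that size fits into
  \<open>'m\<close>.\<close>

locale big_universe =
  fixes R :: "('r, 'c) ring_scheme" and embed :: "'r \<Rightarrow> 'm" and unpair :: "'r \<Rightarrow> 'r \<times> 'r"
  assumes domain: "domain R"
    and noetherian: "noetherian R (ideal_module R (carrier R))"
    and inj_embed: "inj embed"
    and surj_unpair: "surj unpair"
begin

sublocale R: "domain" R by (rule domain)

lemma module_R: "module R (ideal_module R (carrier R))"
  by (rule module_self[OF R.is_cring])

lemma fg_submodule:
  fixes M :: "('r, 'n) module"
  shows "module R M \<Longrightarrow> finitely_generated R M \<Longrightarrow> submodule N R M \<Longrightarrow> finitely_generated R (M\<lparr>carrier := N\<rparr>)"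
  using noetherian_fg[OF noetherian, of M] unfolding noetherian_def by blast

lemma fg_modules_submodule:
  "M \<in> fg_modules R \<Longrightarrow> submodule N R M \<Longrightarrow> M\<lparr>carrier := N\<rparr> \<in> fg_modules R"
  unfolding fg_modules_iff using fg_submodule module_submodule by blast

text \<open>An element y + r g of N + R g is given by a code of y and the scalar r, and
  \<open>unpair\<close> merges the two into one code.\<close>

lemma fg_enumerable:
  fixes M :: "('r, 'n, 'd) module_scheme"
  assumes M: "module R M" and fg: "finitely_generated R M"
  shows "\<exists>\<phi> :: 'r \<Rightarrow> 'n. carrier M \<subseteq> range \<phi>"
proof (rule fg_induct[OF M fg])
  show "\<exists>\<phi> :: 'r \<Rightarrow> 'n. {\<zero>\<^bsub>M\<^esub>} \<subseteq> range \<phi>" by (rule exI[of _ "\<lambda>_. \<zero>\<^bsub>M\<^esub>"]) auto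
  fix N g assume "\<exists>\<phi> :: 'r \<Rightarrow> 'n. N \<subseteq> range \<phi>"
  then obtain \<phi> :: "'r \<Rightarrow> 'n" where \<phi>: "N \<subseteq> range \<phi>" by blast
  have "x \<in> range (\<lambda>f. \<phi> (fst (unpair f)) \<oplus>\<^bsub>M\<^esub> snd (unpair f) \<odot>\<^bsub>M\<^esub> g)" if "x \<in> adjoin R M N g" for x
  proof -
    obtain y r where yr: "x = y \<oplus>\<^bsub>M\<^esub> r \<odot>\<^bsub>M\<^esub> g" "y \<in> N" using \<open>x \<in> _\<close> by (auto simp: adjoin_def)
    obtain u where u: "y = \<phi> u" using \<phi> yr by blast
    obtain f where "unpair f = (u, r)" using surj_unpair by (metis surjD)
    then show ?thesis using yr u by (intro image_eqI[of _ _ f]) auto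
  qed
  then show "\<exists>\<phi> :: 'r \<Rightarrow> 'n. adjoin R M N g \<subseteq> range \<phi>" by blast
qed

text \<open>Choosing a code for each element maps the carrier injectively into \<open>'r\<close>;
  \<open>embed\<close> then carries it into \<open>'m\<close>, and the module structure is
  transported along.\<close>

lemma ex_copy:
  fixes M :: "('r, 'n, 'd) module_scheme"
  assumes M: "module R M" and fg: "finitely_generated R M"
  shows "\<exists>M' :: ('r, 'm) module. M' \<in> fg_modules R \<and> mod_iso R M' M"
proof -
  obtain \<phi> :: "'r \<Rightarrow> 'n" where \<phi>: "carrier M \<subseteq> range \<phi>" using fg_enumerable[OF assms] by blast
  have "inj_on (embed \<circ> inv_into UNIV \<phi>) (carrier M)"
    using inj_on_inv_into[OF \<phi>] inj_embed by (auto intro: comp_inj_on inj_on_subset)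
  note t = transport[OF M this]
  then show ?thesis
    using fg_iso[OF M t(1,2) fg] mod_iso_sym[OF M] unfolding fg_modules_iff by blast
qed

text \<open>The property \<open>extension_closed\<close> speaks only of modules inside the universe.
  The middle term is finitely generated as an extension, so it has a copy there, and the sequence is
  conjugated by the three isomorphisms.\<close>

lemma has_copy_short_exact:
  fixes X :: "('r, 'm) module set"
  assumes X: "subcategory R X" "extension_closed R X"
    and mods: "module R L" "module R M" "module R N"
    and ex: "short_exact R L M N f g"
    and LN: "has_copy R X L" "has_copy R X N"
  shows "has_copy R X M"
proof -
  interpret L: module R L by fact
  interpret N: module R N by fact
  have f: "f \<in> mod_hom R L M" "inj_on f (carrier L)" and g: "g \<in> mod_hom R M N" "g ` carrier M = carrier N"
    and ker: "f ` carrier L = a_kernel M N g" using ex by (auto simp: short_exact_def)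
  have subK: "submodule (a_kernel M N g) R M" by (rule submodule_kernel[OF mods(2,3) g(1)])
  have "finitely_generated R (M\<lparr>carrier := a_kernel M N g\<rparr>)"
    using fg_iso[OF mods(1) module_submodule[OF mods(2) subK]] mod_iso_image[OF mods(1,2) f]
      has_copy_fg[OF X(1) LN(1) mods(1)] by (simp add: ker)
  then have "finitely_generated R M"
    using fg_ext[OF mods(2,3) g has_copy_fg[OF X(1) LN(2) mods(3)]] by blast
  then obtain M' :: "('r, 'm) module" where M': "M' \<in> fg_modules R" "mod_iso R M' M"
    using ex_copy[OF mods(2)] by blast
  have M'm: "module R M'" using M'(1) by (simp add: fg_modules_iff)
  obtain L' N' where L': "L' \<in> X" "mod_iso R L' L" and N': "N' \<in> X" "mod_iso R N' N"
    using LN unfolding has_copy_def by blast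
  have N'm: "module R N'" using subcategoryD(1)[OF X(1) N'(1)] .
  obtain \<alpha> where \<alpha>: "\<alpha> \<in> mod_hom R L' L" "bij_betw \<alpha> (carrier L') (carrier L)"
    using L'(2) unfolding mod_iso_def by blast
  obtain \<beta> where \<beta>: "\<beta> \<in> mod_hom R M M'" "bij_betw \<beta> (carrier M) (carrier M')"
    using mod_iso_sym[OF M'm M'(2)] unfolding mod_iso_def by blast
  obtain \<beta>' where \<beta>': "\<beta>' \<in> mod_hom R M' M" "bij_betw \<beta>' (carrier M') (carrier M)"
    and inv: "\<And>x. x \<in> carrier M \<Longrightarrow> \<beta>' (\<beta> x) = x" "\<And>x. x \<in> carrier M' \<Longrightarrow> \<beta> (\<beta>' x) = x"
    using mod_hom_inv_into[OF mods(2) \<beta>] bij_betw_inv_into[OF \<beta>(2)]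
      bij_betw_inv_into_left[OF \<beta>(2)] bij_betw_inv_into_right[OF \<beta>(2)] by blast
  obtain \<gamma> where \<gamma>: "\<gamma> \<in> mod_hom R N N'" "bij_betw \<gamma> (carrier N) (carrier N')"
    using mod_iso_sym[OF N'm N'(2)] unfolding mod_iso_def by blast
  have \<gamma>0: "\<gamma> x = \<zero>\<^bsub>N'\<^esub> \<longleftrightarrow> x = \<zero>\<^bsub>N\<^esub>" if "x \<in> carrier N" for x
    using mod_hom_zero[OF mods(3) N'm \<gamma>(1)] \<gamma>(2) that
    by (metis N.M.zero_closed bij_betw_imp_inj_on inj_onD)
  have "short_exact R L' M' N' (\<beta> \<circ> f \<circ> \<alpha>) (\<gamma> \<circ> g \<circ> \<beta>')"
    unfolding short_exact_def
  proof (intro conjI)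
    show "\<beta> \<circ> f \<circ> \<alpha> \<in> mod_hom R L' M'" "\<gamma> \<circ> g \<circ> \<beta>' \<in> mod_hom R M' N'"
      by (rule mod_hom_comp[OF \<alpha>(1) mod_hom_comp[OF f(1) \<beta>(1)]],
          rule mod_hom_comp[OF \<beta>'(1) mod_hom_comp[OF g(1) \<gamma>(1)]])
    have fimg: "f ` carrier L \<subseteq> carrier M" using mod_homD(1)[OF f(1)] by blast
    show "inj_on (\<beta> \<circ> f \<circ> \<alpha>) (carrier L')"
      using \<alpha>(2) f(2) \<beta>(2) fimg
      by (intro comp_inj_on) (auto simp: bij_betw_def intro: inj_on_subset)
    have "(\<beta> \<circ> f \<circ> \<alpha>) ` carrier L' = \<beta> ` (f ` carrier L)"
      by (simp only: image_comp[symmetric] bij_betw_imp_surj_on[OF \<alpha>(2)])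
    also have "\<dots> = \<beta> ` a_kernel M N g" using ker by simp
    also have "\<dots> = a_kernel M' N' (\<gamma> \<circ> g \<circ> \<beta>')"
    proof (intro equalityI subsetI)
      fix y assume "y \<in> \<beta> ` a_kernel M N g"
      then obtain x where "y = \<beta> x" "x \<in> carrier M" "g x = \<zero>\<^bsub>N\<^esub>" by (auto simp: a_kernel_def')
      then show "y \<in> a_kernel M' N' (\<gamma> \<circ> g \<circ> \<beta>')"
        using inv(1) \<gamma>0 mod_homD(1)[OF \<beta>(1)] by (simp add: a_kernel_def')
    next
      fix y assume "y \<in> a_kernel M' N' (\<gamma> \<circ> g \<circ> \<beta>')"
      then have y: "y \<in> carrier M'" "\<gamma> (g (\<beta>' y)) = \<zero>\<^bsub>N'\<^esub>" by (auto simp: a_kernel_def')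
      then have "\<beta>' y \<in> a_kernel M N g"
        using \<gamma>0 mod_homD(1)[OF g(1)] mod_homD(1)[OF \<beta>'(1)] by (simp add: a_kernel_def')
      then show "y \<in> \<beta> ` a_kernel M N g" using inv(2)[OF y(1)] by (metis imageI)
    qed
    finally show "(\<beta> \<circ> f \<circ> \<alpha>) ` carrier L' = a_kernel M' N' (\<gamma> \<circ> g \<circ> \<beta>')" .
    show "(\<gamma> \<circ> g \<circ> \<beta>') ` carrier M' = carrier N'"
      by (simp only: image_comp[symmetric] bij_betw_imp_surj_on[OF \<beta>'(2)] g(2)
          bij_betw_imp_surj_on[OF \<gamma>(2)])
  qed
  then have "M' \<in> X" using X(2) L'(1) N'(1) M'(1) unfolding extension_closed_def by blast
  then show ?thesis using M'(2) unfolding has_copy_def by blast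
qed

lemma has_copy_extension:
  fixes X :: "('r, 'm) module set"
  assumes X: "subcategory R X" "extension_closed R X"
    and "module R M" "module R N" "submodule K R M" "g \<in> mod_hom R M N" "g ` carrier M = carrier N"
    and ker: "\<And>x. x \<in> carrier M \<Longrightarrow> g x = \<zero>\<^bsub>N\<^esub> \<longleftrightarrow> x \<in> K"
    and copies: "has_copy R X (M\<lparr>carrier := K\<rparr>)" "has_copy R X N"
  shows "has_copy R X M"
proof (rule has_copy_short_exact[OF X module_submodule[OF assms(3,5)] assms(3,4) _ copies])
  show "short_exact R (M\<lparr>carrier := K\<rparr>) M N (\<lambda>x. x) g"
    unfolding short_exact_def
    using assms(5-8) submoduleD(1)[OF assms(3,5)] by (auto simp: a_kernel_def' intro!: mod_hom_incl)
qed

lemma has_copy_direct_sum: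
  fixes X :: "('r, 'm) module set"
  assumes X: "subcategory R X" "extension_closed R X"
    and M: "module R M" and N: "module R N" and copies: "has_copy R X M" "has_copy R X N"
  shows "has_copy R X (direct_sum M N)"
proof (rule has_copy_short_exact[OF X M module_direct_sum[OF M N] N _ copies])
  interpret M: module R M by fact
  interpret N: module R N by fact
  show "short_exact R M (direct_sum M N) N (\<lambda>x. (x, \<zero>\<^bsub>N\<^esub>)) snd"
    unfolding short_exact_def using direct_sum_homs[OF M N]
    by (auto simp: a_kernel_def' inj_on_def image_iff)
qed

text \<open>A direct summand is the image of the idempotent endomorphism that projects onto
  it.\<close>

lemma IKE_summand_closed:
  fixes X :: "('r, 'm) module set"
  assumes X: "IKE_closed R X"
  shows "summand_closed R X"
  unfolding summand_closed_def
proof (intro ballI impI)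
  fix M :: "('r, 'm) module" and N L :: "('r, 'm) module"
  assume M: "M \<in> X" and N: "N \<in> fg_modules R" and L: "L \<in> fg_modules R"
    and iso: "mod_iso R M (direct_sum N L)"
  have sub: "subcategory R X" using X by (simp add: IKE_closed_def)
  have mods: "module R M" "module R N" "module R L"
    using subcategoryD(1)[OF sub M] N L by (auto simp: fg_modules_iff)
  interpret L: module R L by fact
  obtain \<phi> where \<phi>: "\<phi> \<in> mod_hom R M (direct_sum N L)" "bij_betw \<phi> (carrier M) (carrier (direct_sum N L))"
    using iso unfolding mod_iso_def by blast
  define \<psi> where "\<psi> = inv_into (carrier M) \<phi>"
  have \<psi>: "\<psi> \<in> mod_hom R (direct_sum N L) M" "inj_on \<psi> (carrier (direct_sum N L))"
    unfolding \<psi>_def using mod_hom_inv_into[OF mods(1) \<phi>] bij_betw_inv_into[OF \<phi>(2)]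
    by (auto simp: bij_betw_def)
  let ?i = "\<psi> \<circ> (\<lambda>x. (x, \<zero>\<^bsub>L\<^esub>))"
  have i: "?i \<in> mod_hom R N M" using mod_hom_comp[OF direct_sum_homs(3)[OF mods(2,3)] \<psi>(1)] .
  have inj: "inj_on ?i (carrier N)"
  proof (rule inj_onI)
    fix x y assume "x \<in> carrier N" "y \<in> carrier N" "?i x = ?i y"
    then have "(x, \<zero>\<^bsub>L\<^esub>) = (y, \<zero>\<^bsub>L\<^esub>)" by (intro inj_onD[OF \<psi>(2)]) simp_all
    then show "x = y" by simp
  qed
  have e: "?i \<circ> (fst \<circ> \<phi>) \<in> mod_hom R M M"
    using mod_hom_comp[OF mod_hom_comp[OF \<phi>(1) direct_sum_homs(1)[OF mods(2,3)]] i] .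
  have "(fst \<circ> \<phi>) ` carrier M = fst ` (carrier N \<times> carrier L)"
    by (simp only: image_comp[symmetric] bij_betw_imp_surj_on[OF \<phi>(2)] direct_sum_simps)
  also have "\<dots> = carrier N" using L.M.zero_closed by force
  finally have "(?i \<circ> (fst \<circ> \<phi>)) ` carrier M = ?i ` carrier N" by (simp only: image_comp[symmetric])
  then have "M\<lparr>carrier := ?i ` carrier N\<rparr> \<in> X"
    using X M e unfolding IKE_closed_def image_closed_def by metis
  moreover have "mod_iso R (M\<lparr>carrier := ?i ` carrier N\<rparr>) N"
    using mod_iso_sym[OF mods(2) mod_iso_image[OF mods(2,1) i inj]] .
  ultimately show "N \<in> X" using subcategoryD(5)[OF sub] N by blast
qed

lemma has_copy_image:
  fixes X :: "('r, 'm) module set"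
  assumes X: "IKE_closed R X" and mods: "module R M" "module R N"
    and copies: "has_copy R X M" "has_copy R X N" and f: "f \<in> mod_hom R M N"
  shows "has_copy R X (N\<lparr>carrier := f ` carrier M\<rparr>)"
proof -
  have sub: "subcategory R X" using X by (simp add: IKE_closed_def)
  obtain M' N' where M': "M' \<in> X" "mod_iso R M' M" and N': "N' \<in> X" "mod_iso R N' N"
    using copies unfolding has_copy_def by blast
  have N'm: "module R N'" using subcategoryD(1)[OF sub N'(1)] .
  obtain \<alpha> where \<alpha>: "\<alpha> \<in> mod_hom R M' M" "bij_betw \<alpha> (carrier M') (carrier M)"
    using M'(2) unfolding mod_iso_def by blast
  obtain \<gamma> where \<gamma>: "\<gamma> \<in> mod_hom R N N'" "bij_betw \<gamma> (carrier N) (carrier N')"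
    using mod_iso_sym[OF N'm N'(2)] unfolding mod_iso_def by blast
  let ?I = "f ` carrier M"
  have subI: "submodule ?I R N"
    by (rule submodule_image[OF mods f submodule_carrier[OF mods(1)]])
  have I: "?I \<subseteq> carrier N" using mod_homD(1)[OF f] by blast
  have "\<gamma> \<circ> f \<circ> \<alpha> \<in> mod_hom R M' N'"
    by (rule mod_hom_comp[OF \<alpha>(1) mod_hom_comp[OF f \<gamma>(1)]])
  moreover have "(\<gamma> \<circ> f \<circ> \<alpha>) ` carrier M' = \<gamma> ` ?I"
    by (simp only: image_comp[symmetric] bij_betw_imp_surj_on[OF \<alpha>(2)])
  ultimately have "N'\<lparr>carrier := \<gamma> ` ?I\<rparr> \<in> X"
    using X M'(1) N'(1) unfolding IKE_closed_def image_closed_def by metis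
  moreover have "mod_iso R (N\<lparr>carrier := ?I\<rparr>) (N'\<lparr>carrier := \<gamma> ` ?I\<rparr>)"
    using mod_iso_image[OF module_submodule[OF mods(2) subI] N'm mod_hom_dom[OF \<gamma>(1) I]]
      \<gamma>(2) I by (auto simp: bij_betw_def intro: inj_on_subset)
  ultimately show ?thesis
    using mod_iso_sym[OF module_submodule[OF mods(2) subI]] unfolding has_copy_def by blast
qed

end

text \<open>These are the closure properties from the intersection that defines
  \<open>ext_closure\<close>. IKE-closed subcategories have them too, so the generation results
  below serve both parts of the theorem.\<close>

locale thick_subcategory = big_universe R embed unpair
  for R :: "('r, 'c) ring_scheme" and embed :: "'r \<Rightarrow> 'm" and unpair +
  fixes X :: "('r, 'm) module set"
  assumes sub: "subcategory R X" and ext: "extension_closed R X" and summand: "summand_closed R X"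
begin

text \<open>A retract splits off, with the kernel of the retraction as complement. Both summands are
  first replaced by copies inside the universe, where \<open>summand_closed\<close> can be
  applied.\<close>

lemma has_copy_retract:
  fixes M :: "('r, 'n) module"
  assumes M: "module R M" and N: "module R N" and copy: "has_copy R X M"
    and i: "i \<in> mod_hom R N M" and p: "p \<in> mod_hom R M N"
    and pi: "\<And>x. x \<in> carrier N \<Longrightarrow> p (i x) = x"
  shows "has_copy R X N"
proof -
  interpret M: module R M by fact
  interpret N: module R N by fact
  have fgM: "finitely_generated R M" by (rule has_copy_fg[OF sub copy M])
  have "p ` carrier M = carrier N"
    using mod_homD(1)[OF p] mod_homD(1)[OF i] pi by (force simp: image_iff)
  then have fgN: "finitely_generated R N" by (rule fg_image[OF M N p _ fgM])
  let ?K = "a_kernel M N p"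
  let ?L = "M\<lparr>carrier := ?K\<rparr>"
  have subK: "submodule ?K R M" by (rule submodule_kernel[OF M N p])
  have L: "module R ?L" by (rule module_submodule[OF M subK])
  note im = mod_homD[OF i] and pm = mod_homD[OF p]
  let ?f = "\<lambda>(n, k). i n \<oplus>\<^bsub>M\<^esub> k"
  have fh: "?f \<in> mod_hom R (direct_sum N ?L) M"
    using im submoduleD(1)[OF M subK]
    by (auto intro!: mod_homI simp: M.smult_r_distr M.M.a_ac)
  have "inj_on ?f (carrier (direct_sum N ?L))"
  proof (subst mod_hom_inj_iff[OF module_direct_sum[OF N L] M fh], clarsimp)
    fix n k assume *: "n \<in> carrier N" "k \<in> ?K" "i n \<oplus>\<^bsub>M\<^esub> k = \<zero>\<^bsub>M\<^esub>"
    then have k: "k \<in> carrier M" "p k = \<zero>\<^bsub>N\<^esub>" by (auto simp: a_kernel_def')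
    have "p (i n \<oplus>\<^bsub>M\<^esub> k) = n" using *(1) k pi im pm by simp
    then have "n = \<zero>\<^bsub>N\<^esub>" using *(3) mod_hom_zero[OF M N p] by simp
    then show "n = \<zero>\<^bsub>N\<^esub> \<and> k = \<zero>\<^bsub>M\<^esub>" using *(3) mod_hom_zero[OF N M i] k by simp
  qed
  moreover have "carrier M \<subseteq> ?f ` carrier (direct_sum N ?L)"
  proof
    fix x assume x: "x \<in> carrier M"
    have ipx: "i (p x) \<in> carrier M" using x im pm by simp
    have "p (x \<ominus>\<^bsub>M\<^esub> i (p x)) = \<zero>\<^bsub>N\<^esub>"
      using mod_hom_minus[OF M N p x ipx] pi pm x by (simp add: a_minus_def N.r_neg)
    then have "x \<ominus>\<^bsub>M\<^esub> i (p x) \<in> ?K" using x ipx by (simp add: a_kernel_def')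
    moreover have "x = i (p x) \<oplus>\<^bsub>M\<^esub> (x \<ominus>\<^bsub>M\<^esub> i (p x))"
      using x ipx by (simp add: a_minus_def M.M.a_lcomm M.r_neg)
    ultimately show "x \<in> ?f ` carrier (direct_sum N ?L)"
      using pm(1)[OF x] by (intro image_eqI[of _ _ "(p x, x \<ominus>\<^bsub>M\<^esub> i (p x))"]) auto
  qed
  ultimately have "bij_betw ?f (carrier (direct_sum N ?L)) (carrier M)"
    using mod_homD(1)[OF fh] unfolding bij_betw_def by blast
  then have iso: "mod_iso R (direct_sum N ?L) M" unfolding mod_iso_def using fh by blast
  obtain N' :: "('r, 'm) module" where N': "N' \<in> fg_modules R" "mod_iso R N' N"
    using ex_copy[OF N fgN] by blast
  obtain L' :: "('r, 'm) module" where L': "L' \<in> fg_modules R" "mod_iso R L' ?L"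
    using ex_copy[OF L fg_submodule[OF M fgM subK]] by blast
  have mods: "module R N'" "module R L'" using N'(1) L'(1) by (auto simp: fg_modules_iff)
  obtain P where P: "P \<in> X" "mod_iso R P M" using copy unfolding has_copy_def by blast
  have "mod_iso R M (direct_sum N' L')"
    using mod_iso_sym[OF module_direct_sum[OF mods]]
      mod_iso_trans[OF mod_iso_direct_sum[OF N'(2) L'(2)] iso] by blast
  then have "N' \<in> X"
    using summand P N'(1) L'(1) mod_iso_trans[OF P(2)] unfolding summand_closed_def by blast
  then show ?thesis using N'(2) unfolding has_copy_def by blast
qed

text \<open>A subcategory is nonempty, and zero is a retract of every module.\<close>

lemma has_copy_zero:
  assumes "module R M" "carrier M = {\<zero>\<^bsub>M\<^esub>}"
  shows "has_copy R X M"
proof -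
  interpret M: module R M by fact
  obtain P where P: "P \<in> X" using subcategoryD(4)[OF sub] by blast
  have Pm: "module R P" using subcategoryD(1)[OF sub P] .
  interpret P: module R P by fact
  show ?thesis
    by (rule has_copy_retract[OF Pm assms(1) has_copyI[OF P], where i = "\<lambda>_. \<zero>\<^bsub>P\<^esub>" and p = "\<lambda>_. \<zero>\<^bsub>M\<^esub>"])
      (use assms(2) in \<open>auto intro!: mod_homI\<close>)
qed

end

context big_universe
begin

lemma IKE_thick: "IKE_closed R X \<Longrightarrow> thick_subcategory R embed unpair X"
  using IKE_summand_closed big_universe_axioms
  by (auto simp: thick_subcategory_def thick_subcategory_axioms_def IKE_closed_def)

end

section \<open>Torsion\<close>

text \<open>The preimage in \<open>M\<close> of the torsion submodule of M/N. For the zero submodule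
  it is the torsion submodule of \<open>M\<close>.\<close>

definition pure_closure :: "('r, 'c) ring_scheme \<Rightarrow> ('r, 'm, 'd) module_scheme \<Rightarrow> 'm set \<Rightarrow> 'm set"
  where "pure_closure R M N =
    {x \<in> carrier M. \<exists>r\<in>carrier R. r \<noteq> \<zero>\<^bsub>R\<^esub> \<and> r \<odot>\<^bsub>M\<^esub> x \<in> N}"

definition torsion :: "('r, 'c) ring_scheme \<Rightarrow> ('r, 'm, 'd) module_scheme \<Rightarrow> bool"
  where "torsion R M \<longleftrightarrow> pure_closure R M {\<zero>\<^bsub>M\<^esub>} = carrier M"

lemma torsion_iff:
  "torsion R M \<longleftrightarrow> (\<forall>x\<in>carrier M. \<exists>r\<in>carrier R. r \<noteq> \<zero>\<^bsub>R\<^esub> \<and> r \<odot>\<^bsub>M\<^esub> x = \<zero>\<^bsub>M\<^esub>)"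
  by (auto simp: torsion_def pure_closure_def)

lemma torsion_iso:
  assumes "module R M" "module R N" "torsion R M" "mod_iso R M N"
  shows "torsion R N"
  unfolding torsion_iff
proof
  obtain f where f: "f \<in> mod_hom R M N" "f ` carrier M = carrier N"
    using assms(4) by (auto simp: mod_iso_def bij_betw_def)
  fix y assume "y \<in> carrier N"
  then obtain x where x: "x \<in> carrier M" "y = f x" using f(2) by blast
  then obtain r where "r \<in> carrier R" "r \<noteq> \<zero>\<^bsub>R\<^esub>" "r \<odot>\<^bsub>M\<^esub> x = \<zero>\<^bsub>M\<^esub>"
    using assms(3) by (auto simp: torsion_iff)
  then show "\<exists>r\<in>carrier R. r \<noteq> \<zero>\<^bsub>R\<^esub> \<and> r \<odot>\<^bsub>N\<^esub> y = \<zero>\<^bsub>N\<^esub>"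
    using mod_homD(3)[OF f(1), of r x] mod_hom_zero[OF assms(1,2) f(1)] x by auto
qed

lemma torsionfree_iso:
  assumes "module R M" "module R N" "torsionfree R M" "mod_iso R M N"
  shows "torsionfree R N"
  unfolding torsionfree_def
proof (intro ballI impI)
  obtain f where f: "f \<in> mod_hom R N M" "inj_on f (carrier N)"
    using mod_iso_sym[OF assms(1,4)] by (auto simp: mod_iso_def bij_betw_def)
  fix r y assume *: "r \<in> carrier R" "y \<in> carrier N" "r \<noteq> \<zero>\<^bsub>R\<^esub> \<and> r \<odot>\<^bsub>N\<^esub> y = \<zero>\<^bsub>N\<^esub>"
  then have "r \<odot>\<^bsub>M\<^esub> f y = \<zero>\<^bsub>M\<^esub>"
    using mod_homD(3)[OF f(1) *(1,2)] mod_hom_zero[OF assms(2,1) f(1)] by simp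
  then have "f y = \<zero>\<^bsub>M\<^esub>" using assms(3) * mod_homD(1)[OF f(1)] by (auto simp: torsionfree_def)
  then show "y = \<zero>\<^bsub>N\<^esub>" using mod_hom_inj_iff[OF assms(2,1) f(1)] f(2) *(2) by blast
qed

lemma torsionfree_iff:
  assumes "domain R" "module R M"
  shows "torsionfree R M \<longleftrightarrow> pure_closure R M {\<zero>\<^bsub>M\<^esub>} = {\<zero>\<^bsub>M\<^esub>}"
proof -
  interpret R: "domain" R by fact
  interpret M: module R M by fact
  have "\<zero>\<^bsub>M\<^esub> \<in> pure_closure R M {\<zero>\<^bsub>M\<^esub>}"
    unfolding pure_closure_def by (auto intro!: bexI[of _ "\<one>\<^bsub>R\<^esub>"])
  then show ?thesis by (auto simp: torsionfree_def pure_closure_def)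
qed

lemma pure_closure:
  assumes "domain R" "module R M" "submodule N R M"
  shows "submodule (pure_closure R M N) R M" "N \<subseteq> pure_closure R M N"
    "pure_closure R M (pure_closure R M N) = pure_closure R M N"
proof -
  interpret R: "domain" R by fact
  interpret M: module R M by fact
  note N = submoduleD[OF assms(2,3)]
  show NP: "N \<subseteq> pure_closure R M N"
    using N(1) by (auto simp: pure_closure_def intro!: bexI[of _ "\<one>\<^bsub>R\<^esub>"])
  show sub: "submodule (pure_closure R M N) R M"
    unfolding submodule_iff[OF assms(2)]
  proof (intro conjI ballI)
    show "\<zero>\<^bsub>M\<^esub> \<in> pure_closure R M N" using NP N(2) by blast
    fix x y assume "x \<in> pure_closure R M N" "y \<in> pure_closure R M N"
    then obtain r s where *: "x \<in> carrier M" "y \<in> carrier M" "r \<in> carrier R" "r \<noteq> \<zero>\<^bsub>R\<^esub>"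
      "s \<in> carrier R" "s \<noteq> \<zero>\<^bsub>R\<^esub>" "r \<odot>\<^bsub>M\<^esub> x \<in> N" "s \<odot>\<^bsub>M\<^esub> y \<in> N" by (auto simp: pure_closure_def)
    have "(s \<otimes>\<^bsub>R\<^esub> r) \<odot>\<^bsub>M\<^esub> x = s \<odot>\<^bsub>M\<^esub> (r \<odot>\<^bsub>M\<^esub> x)" using * by (simp add: M.smult_assoc1)
    moreover have "(s \<otimes>\<^bsub>R\<^esub> r) \<odot>\<^bsub>M\<^esub> y = r \<odot>\<^bsub>M\<^esub> (s \<odot>\<^bsub>M\<^esub> y)"
      using * M.smult_assoc1[of r s y] R.m_comm[of s r] by simp
    ultimately have "(s \<otimes>\<^bsub>R\<^esub> r) \<odot>\<^bsub>M\<^esub> (x \<oplus>\<^bsub>M\<^esub> y) = s \<odot>\<^bsub>M\<^esub> (r \<odot>\<^bsub>M\<^esub> x) \<oplus>\<^bsub>M\<^esub> r \<odot>\<^bsub>M\<^esub> (s \<odot>\<^bsub>M\<^esub> y)"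
      using * by (simp add: M.smult_r_distr)
    then have "(s \<otimes>\<^bsub>R\<^esub> r) \<odot>\<^bsub>M\<^esub> (x \<oplus>\<^bsub>M\<^esub> y) \<in> N" using * N by simp
    moreover have "s \<otimes>\<^bsub>R\<^esub> r \<noteq> \<zero>\<^bsub>R\<^esub>" using * R.integral by blast
    ultimately show "x \<oplus>\<^bsub>M\<^esub> y \<in> pure_closure R M N" using * by (auto simp: pure_closure_def)
  next
    fix r x assume r: "r \<in> carrier R" and "x \<in> pure_closure R M N"
    then obtain s where *: "x \<in> carrier M" "s \<in> carrier R" "s \<noteq> \<zero>\<^bsub>R\<^esub>" "s \<odot>\<^bsub>M\<^esub> x \<in> N"
      by (auto simp: pure_closure_def)
    have "s \<odot>\<^bsub>M\<^esub> (r \<odot>\<^bsub>M\<^esub> x) = r \<odot>\<^bsub>M\<^esub> (s \<odot>\<^bsub>M\<^esub> x)"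
      using * r by (simp flip: M.smult_assoc1 add: R.m_comm)
    then show "r \<odot>\<^bsub>M\<^esub> x \<in> pure_closure R M N" using * r N by (auto simp: pure_closure_def)
  qed (auto simp: pure_closure_def)
  show "pure_closure R M (pure_closure R M N) = pure_closure R M N" (is "?A = ?B")
  proof
    show "?A \<subseteq> ?B"
    proof
      fix x assume "x \<in> ?A"
      then obtain r s where *: "x \<in> carrier M" "r \<in> carrier R" "r \<noteq> \<zero>\<^bsub>R\<^esub>"
        "s \<in> carrier R" "s \<noteq> \<zero>\<^bsub>R\<^esub>" "s \<odot>\<^bsub>M\<^esub> (r \<odot>\<^bsub>M\<^esub> x) \<in> N" by (auto simp: pure_closure_def)
      then have "(s \<otimes>\<^bsub>R\<^esub> r) \<odot>\<^bsub>M\<^esub> x \<in> N" "s \<otimes>\<^bsub>R\<^esub> r \<noteq> \<zero>\<^bsub>R\<^esub>"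
        using R.integral by (auto simp: M.smult_assoc1)
      then show "x \<in> ?B" using * by (auto simp: pure_closure_def)
    qed
    show "?B \<subseteq> ?A"
      using submoduleD(1)[OF assms(2) sub]
      by (auto simp: pure_closure_def[of _ _ "pure_closure R M N"] intro!: bexI[of _ "\<one>\<^bsub>R\<^esub>"])
  qed
qed

text \<open>Multiply one denominator for each generator. With \<open>K\<close> zero, the result is a
  nonzero scalar that annihilates a finitely generated torsion module.\<close>

lemma common_denominator:
  assumes "domain R" and M: "module R M" and fg: "finitely_generated R M" and K: "submodule K R M"
    and "pure_closure R M K = carrier M"
  shows "\<exists>r\<in>carrier R. r \<noteq> \<zero>\<^bsub>R\<^esub> \<and> (\<forall>x\<in>carrier M. r \<odot>\<^bsub>M\<^esub> x \<in> K)"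
proof (rule fg_induct[OF M fg])
  interpret R: "domain" R by fact
  interpret M: module R M by fact
  note KD = submoduleD[OF M K]
  show "\<exists>r\<in>carrier R. r \<noteq> \<zero>\<^bsub>R\<^esub> \<and> (\<forall>x\<in>{\<zero>\<^bsub>M\<^esub>}. r \<odot>\<^bsub>M\<^esub> x \<in> K)"
    using KD(2) by (intro bexI[of _ "\<one>\<^bsub>R\<^esub>"]) auto
  fix N g assume N: "submodule N R M" and g: "g \<in> carrier M"
    and "\<exists>r\<in>carrier R. r \<noteq> \<zero>\<^bsub>R\<^esub> \<and> (\<forall>x\<in>N. r \<odot>\<^bsub>M\<^esub> x \<in> K)"
  then obtain r where r: "r \<in> carrier R" "r \<noteq> \<zero>\<^bsub>R\<^esub>" "\<And>x. x \<in> N \<Longrightarrow> r \<odot>\<^bsub>M\<^esub> x \<in> K" by blast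
  have "g \<in> pure_closure R M K" using assms(5) g by simp
  then obtain s where s: "s \<in> carrier R" "s \<noteq> \<zero>\<^bsub>R\<^esub>" "s \<odot>\<^bsub>M\<^esub> g \<in> K" by (auto simp: pure_closure_def)
  have "(s \<otimes>\<^bsub>R\<^esub> r) \<odot>\<^bsub>M\<^esub> x \<in> K" if x: "x \<in> adjoin R M N g" for x
  proof -
    obtain y t where yt: "x = y \<oplus>\<^bsub>M\<^esub> t \<odot>\<^bsub>M\<^esub> g" "y \<in> N" "t \<in> carrier R" using x by (auto simp: adjoin_def)
    have yM: "y \<in> carrier M" using submoduleD(1)[OF M N yt(2)] .
    have "(s \<otimes>\<^bsub>R\<^esub> r) \<odot>\<^bsub>M\<^esub> x = s \<odot>\<^bsub>M\<^esub> (r \<odot>\<^bsub>M\<^esub> y) \<oplus>\<^bsub>M\<^esub> (r \<otimes>\<^bsub>R\<^esub> t \<otimes>\<^bsub>R\<^esub> s) \<odot>\<^bsub>M\<^esub> g"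
      using yt r s g yM
      by (simp add: M.smult_r_distr M.smult_assoc1[symmetric] R.m_ac)
    also have "\<dots> = s \<odot>\<^bsub>M\<^esub> (r \<odot>\<^bsub>M\<^esub> y) \<oplus>\<^bsub>M\<^esub> (r \<otimes>\<^bsub>R\<^esub> t) \<odot>\<^bsub>M\<^esub> (s \<odot>\<^bsub>M\<^esub> g)"
      using yt r s g by (simp add: M.smult_assoc1)
    finally show ?thesis using yt r s KD by simp
  qed
  moreover have "s \<otimes>\<^bsub>R\<^esub> r \<noteq> \<zero>\<^bsub>R\<^esub>" using r s R.integral by blast
  ultimately show "\<exists>r\<in>carrier R. r \<noteq> \<zero>\<^bsub>R\<^esub> \<and> (\<forall>x\<in>adjoin R M N g. r \<odot>\<^bsub>M\<^esub> x \<in> K)"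
    using r s by (intro bexI[of _ "s \<otimes>\<^bsub>R\<^esub> r"]) auto
qed

text \<open>Over a common denominator \<open>r\<close>, an element \<open>x\<close> of the pure closure of \<open>N + R g\<close> satisfies
  \<open>r x = n + s g\<close> with \<open>n\<close> in the pure submodule \<open>N\<close>, and \<open>s\<close> is unique.\<close>

lemma rank_one_quotient:
  assumes dom: "domain R" and M: "module R M" and N: "submodule N R M"
    and pure: "pure_closure R M N = N" and g: "g \<in> carrier M" "g \<notin> N"
    and fg: "finitely_generated R (M\<lparr>carrier := pure_closure R M (adjoin R M N g)\<rparr>)"
  defines "P \<equiv> pure_closure R M (adjoin R M N g)"
  shows "\<exists>h\<in>mod_hom R (M\<lparr>carrier := P\<rparr>) (ideal_module R (carrier R)).
    (\<forall>x\<in>P. h x = \<zero>\<^bsub>R\<^esub> \<longleftrightarrow> x \<in> N) \<and> g \<in> P"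
proof -
  interpret R: "domain" R by fact
  interpret M: module R M by fact
  note ND = submoduleD[OF M N]
  let ?A = "adjoin R M N g"
  note A = adjoin[OF M N g(1)]
  note PA = pure_closure[OF dom M A(1)]
  have P: "submodule P R M" unfolding P_def by (rule PA(1))
  have AP: "?A \<subseteq> P" unfolding P_def by (rule PA(2))
  have PM: "module R (M\<lparr>carrier := P\<rparr>)" by (rule module_submodule[OF M P])
  have A1: "submodule ?A R (M\<lparr>carrier := P\<rparr>)" using A(1) AP by (simp add: submodule_submodule_iff[OF M P])
  have A2: "pure_closure R (M\<lparr>carrier := P\<rparr>) ?A = carrier (M\<lparr>carrier := P\<rparr>)"
    using submoduleD(1)[OF M P] by (auto simp: pure_closure_def P_def)
  obtain r where r: "r \<in> carrier R" "r \<noteq> \<zero>\<^bsub>R\<^esub>" "\<And>x. x \<in> P \<Longrightarrow> r \<odot>\<^bsub>M\<^esub> x \<in> ?A"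
    using common_denominator[OF dom PM fg[folded P_def] A1 A2] by auto
  define good where "good x s \<longleftrightarrow> s \<in> carrier R \<and> (\<exists>n\<in>N. r \<odot>\<^bsub>M\<^esub> x = n \<oplus>\<^bsub>M\<^esub> s \<odot>\<^bsub>M\<^esub> g)" for x s
  have ex: "\<exists>s. good x s" if "x \<in> P" for x
    using r(3)[OF that] by (auto simp: good_def adjoin_def)
  \<comment> \<open>Purity enters here: a nonzero multiple of \<open>g\<close> inside
    \<open>N\<close> would force \<open>g\<close> itself into \<open>N\<close>. This is what makes
    the coefficient of \<open>g\<close> unique.\<close>
  have zero: "s = \<zero>\<^bsub>R\<^esub>" if "s \<in> carrier R" "s \<odot>\<^bsub>M\<^esub> g \<in> N" for s
  proof (rule ccontr)
    assume "s \<noteq> \<zero>\<^bsub>R\<^esub>"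
    then have "g \<in> pure_closure R M N" using that g(1) by (auto simp: pure_closure_def)
    then show False using pure g(2) by simp
  qed
  have unique: "s = s'" if s: "good x s" "good x s'" for x s s'
  proof -
    obtain n n' where *: "s \<in> carrier R" "s' \<in> carrier R" "n \<in> N" "n' \<in> N"
      "n \<oplus>\<^bsub>M\<^esub> s \<odot>\<^bsub>M\<^esub> g = n' \<oplus>\<^bsub>M\<^esub> s' \<odot>\<^bsub>M\<^esub> g" using s by (auto simp: good_def)
    have c: "n \<in> carrier M" "n' \<in> carrier M" using * ND by auto
    have "(s \<ominus>\<^bsub>R\<^esub> s') \<odot>\<^bsub>M\<^esub> g = s \<odot>\<^bsub>M\<^esub> g \<ominus>\<^bsub>M\<^esub> s' \<odot>\<^bsub>M\<^esub> g"
      using * g(1) by (simp add: a_minus_def M.smult_l_distr M.smult_l_minus)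
    also have "s \<odot>\<^bsub>M\<^esub> g = \<ominus>\<^bsub>M\<^esub> n \<oplus>\<^bsub>M\<^esub> (n \<oplus>\<^bsub>M\<^esub> s \<odot>\<^bsub>M\<^esub> g)"
      using c(1) *(1) g(1) by (simp add: M.M.a_assoc[symmetric] M.l_neg)
    also have "\<dots> \<ominus>\<^bsub>M\<^esub> s' \<odot>\<^bsub>M\<^esub> g = n' \<ominus>\<^bsub>M\<^esub> n"
      using c * g(1) by (simp add: a_minus_def M.M.a_ac M.r_neg)
    finally have "(s \<ominus>\<^bsub>R\<^esub> s') \<odot>\<^bsub>M\<^esub> g \<in> N" using * ND by simp
    then have "s \<ominus>\<^bsub>R\<^esub> s' = \<zero>\<^bsub>R\<^esub>" using zero * by simp
    then show ?thesis using * by (metis R.add.inv_closed R.minus_equality R.minus_minus a_minus_def)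
  qed
  define h where "h x = (SOME s. good x s)" for x
  have h: "good x (h x)" if "x \<in> P" for x unfolding h_def using ex[OF that] by (rule someI_ex)
  have heq: "h x = s" if "x \<in> P" "good x s" for x s using unique h[OF that(1)] that(2) by blast
  note PD = submoduleD[OF M P]
  have "h \<in> mod_hom R (M\<lparr>carrier := P\<rparr>) (ideal_module R (carrier R))"
  proof (rule mod_homI; simp)
    fix x assume x: "x \<in> P"
    then show "h x \<in> carrier R" using h by (simp add: good_def)
    { fix y assume y: "y \<in> P"
      obtain n n' where *: "n \<in> N" "n' \<in> N" "r \<odot>\<^bsub>M\<^esub> x = n \<oplus>\<^bsub>M\<^esub> h x \<odot>\<^bsub>M\<^esub> g"
        "r \<odot>\<^bsub>M\<^esub> y = n' \<oplus>\<^bsub>M\<^esub> h y \<odot>\<^bsub>M\<^esub> g" "h x \<in> carrier R" "h y \<in> carrier R"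
        using h[OF x] h[OF y] by (auto simp: good_def)
      have c: "n \<in> carrier M" "n' \<in> carrier M" using * ND by auto
      have "r \<odot>\<^bsub>M\<^esub> (x \<oplus>\<^bsub>M\<^esub> y) = (n \<oplus>\<^bsub>M\<^esub> n') \<oplus>\<^bsub>M\<^esub> (h x \<oplus>\<^bsub>R\<^esub> h y) \<odot>\<^bsub>M\<^esub> g"
        using x y PD r g(1) c * by (simp add: M.smult_r_distr M.smult_l_distr M.M.a_ac)
      then have "good (x \<oplus>\<^bsub>M\<^esub> y) (h x \<oplus>\<^bsub>R\<^esub> h y)" using * ND(3) by (auto simp: good_def)
      then show "h (x \<oplus>\<^bsub>M\<^esub> y) = h x \<oplus>\<^bsub>R\<^esub> h y" using heq PD(3)[OF x y] by blast }
    fix t assume t: "t \<in> carrier R"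
    obtain n where *: "n \<in> N" "r \<odot>\<^bsub>M\<^esub> x = n \<oplus>\<^bsub>M\<^esub> h x \<odot>\<^bsub>M\<^esub> g" "h x \<in> carrier R"
      using h[OF x] by (auto simp: good_def)
    have c: "n \<in> carrier M" using * ND by auto
    have "r \<odot>\<^bsub>M\<^esub> (t \<odot>\<^bsub>M\<^esub> x) = t \<odot>\<^bsub>M\<^esub> (r \<odot>\<^bsub>M\<^esub> x)"
      using x PD t r by (simp flip: M.smult_assoc1 add: R.m_comm)
    also have "\<dots> = t \<odot>\<^bsub>M\<^esub> n \<oplus>\<^bsub>M\<^esub> (t \<otimes>\<^bsub>R\<^esub> h x) \<odot>\<^bsub>M\<^esub> g"
      using * c t g(1) by (simp add: M.smult_r_distr M.smult_assoc1)
    finally have "good (t \<odot>\<^bsub>M\<^esub> x) (t \<otimes>\<^bsub>R\<^esub> h x)" using * ND(4)[OF t] t by (auto simp: good_def)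
    then show "h (t \<odot>\<^bsub>M\<^esub> x) = t \<otimes>\<^bsub>R\<^esub> h x" using heq PD(4)[OF t x] by blast
  qed
  moreover have "h x = \<zero>\<^bsub>R\<^esub> \<longleftrightarrow> x \<in> N" if x: "x \<in> P" for x
  proof
    assume "h x = \<zero>\<^bsub>R\<^esub>"
    then obtain n where "n \<in> N" "r \<odot>\<^bsub>M\<^esub> x = n \<oplus>\<^bsub>M\<^esub> \<zero>\<^bsub>R\<^esub> \<odot>\<^bsub>M\<^esub> g" using h[OF x] by (auto simp: good_def)
    then have "r \<odot>\<^bsub>M\<^esub> x \<in> N" using ND(1) g(1) by simp
    then have "x \<in> pure_closure R M N" using r PD(1)[OF x] by (auto simp: pure_closure_def)
    then show "x \<in> N" using pure by simp
  next
    assume "x \<in> N"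
    then have "good x \<zero>\<^bsub>R\<^esub>"
      unfolding good_def using ND(4)[OF r(1)] ND(1) g(1) by (auto intro!: bexI[of _ "r \<odot>\<^bsub>M\<^esub> x"] simp: r(1))
    then show "h x = \<zero>\<^bsub>R\<^esub>" using heq x by blast
  qed
  ultimately show ?thesis using A(3) AP by blast
qed

section \<open>Numerical semigroup rings\<close>

text \<open>The ideal t^d S of S, described by coefficients.\<close>

definition fil :: "nat \<Rightarrow> 'k::field fps set"
  where "fil d = {f. \<forall>n<d. fps_nth f n = 0}"

lemma filD: "f \<in> fil d \<Longrightarrow> n < d \<Longrightarrow> fps_nth f n = 0"
  by (simp add: fil_def)

lemma fil_mult:
  assumes "f \<in> fil c" "g \<in> fil d"
  shows "f * g \<in> fil (c + d)"
proof -
  have "fps_nth (f * g) n = 0" if "n < c + d" for n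
    unfolding fps_mult_nth
  proof (intro sum.neutral ballI)
    fix i assume "i \<in> {0..n}"
    then have "i < c \<or> n - i < d" using that by auto
    then show "fps_nth f i * fps_nth g (n - i) = 0" using filD[OF assms(1)] filD[OF assms(2)] by auto
  qed
  then show ?thesis by (simp add: fil_def)
qed

lemma fil_0 [simp]: "fil 0 = UNIV"
  by (simp add: fil_def)

lemma fil_mult_left: "g \<in> fil d \<Longrightarrow> f * g \<in> fil d"
  using fil_mult[of f 0 g d] by simp

lemma fil_antimono: "c \<le> d \<Longrightarrow> fil d \<subseteq> fil c"
  by (auto simp: fil_def)

lemma fil_closed:
  "0 \<in> fil d" "f \<in> fil d \<Longrightarrow> g \<in> fil d \<Longrightarrow> f + g \<in> fil d"
  "f \<in> fil d \<Longrightarrow> g \<in> fil d \<Longrightarrow> f - g \<in> fil d" "f \<in> fil d \<Longrightarrow> - f \<in> fil d"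
  by (auto simp: fil_def)

lemma fps_X_power_fil: "fps_X ^ d \<in> fil d"
  by (auto simp: fil_def fps_X_power_nth)

lemma fil_Suc_iff: "f \<in> fil (Suc d) \<longleftrightarrow> f \<in> fil d \<and> fps_nth f d = 0"
  by (auto simp: fil_def less_Suc_eq)

lemma fil_shift:
  assumes "f \<in> fil d" shows "f = fps_X ^ d * fps_shift d f"
  using assms by (intro fps_ext) (auto simp: fil_def fps_X_power_mult_nth)

lemma fil_eq_image: "fil d = (*) (fps_X ^ d) ` UNIV"
  using fil_shift fil_mult[OF fps_X_power_fil, of _ 0 d] by auto

text \<open>A series of order d is t^d times a unit of S, so it divides everything of order at least
  d, and the order of the quotient is controlled.\<close>

lemma fil_divide:
  assumes u: "u \<in> fil d" "fps_nth u d \<noteq> 0" and f: "f \<in> fil (d + n)"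
  shows "\<exists>w\<in>fil n. f = u * w"
proof -
  define v where "v = fps_shift d u"
  have v: "u = fps_X ^ d * v" "fps_nth v 0 \<noteq> 0" using fil_shift[OF u(1)] u(2) by (auto simp: v_def)
  define w where "w = fps_X ^ n * (inverse v * fps_shift (d + n) f)"
  have "u * w = (v * inverse v) * (fps_X ^ (d + n) * fps_shift (d + n) f)"
    by (simp add: v(1) w_def power_add ac_simps)
  also have "v * inverse v = 1" using inverse_mult_eq_1[OF v(2)] by (simp add: mult.commute)
  finally have "f = u * w" using fil_shift[OF f] by simp
  moreover have "w \<in> fil n" unfolding w_def using fil_mult[OF fps_X_power_fil, of _ 0 n] by simp
  ultimately show ?thesis by blast
qed

lemma ex_order:
  assumes "(0 :: 'k::field fps) \<in> I" "I \<noteq> {0}"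
  obtains d u where "I \<subseteq> fil d" "u \<in> I" "fps_nth u d \<noteq> 0"
proof -
  obtain f where "f \<in> I" "f \<noteq> 0" using assms by blast
  then obtain n where "fps_nth f n \<noteq> 0" by (auto simp: fps_eq_iff)
  define d where "d = (LEAST n. \<exists>f\<in>I. fps_nth f n \<noteq> 0)"
  have "\<exists>f\<in>I. fps_nth f d \<noteq> 0" unfolding d_def by (rule LeastI[of _ n]) (use \<open>f \<in> I\<close> \<open>fps_nth f n \<noteq> 0\<close> in blast)
  have "fps_nth f m = 0" if "f \<in> I" "m < d" for f m
    using not_less_Least[of m "\<lambda>n. \<exists>f\<in>I. fps_nth f n \<noteq> 0"] that unfolding d_def by blast
  then have "I \<subseteq> fil d" unfolding fil_def by blast
  with \<open>\<exists>f\<in>I. fps_nth f d \<noteq> 0\<close> show ?thesis using that by blast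
qed

text \<open>Separating even from odd exponents gives the surjection of k[[t]] onto pairs that
  \<open>big_universe\<close> asks for.\<close>

definition fps_unpair :: "'k::field fps \<Rightarrow> 'k fps \<times> 'k fps"
  where "fps_unpair f = (Abs_fps (\<lambda>n. fps_nth f (2 * n)), Abs_fps (\<lambda>n. fps_nth f (2 * n + 1)))"

lemma surj_fps_unpair: "surj fps_unpair"
proof (rule surjI)
  fix p :: "'k::field fps \<times> 'k fps"
  show "fps_unpair (Abs_fps (\<lambda>n. if even n then fps_nth (fst p) (n div 2) else fps_nth (snd p) (n div 2))) = p"
    by (simp add: fps_unpair_def prod_eq_iff fps_eq_iff)
qed

text \<open>Here \<open>a\<close> is the multiplicity of \<open>H\<close>, and \<open>e\<close>
  bounds the gaps of \<open>H\<close>. That \<open>e\<close> is the least such bound is assumed only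
  in \<open>conductor_eq\<close>.\<close>

locale numerical_ring =
  fixes H :: "nat set" and a e :: nat and R :: "'k::field fps ring" and embed :: "'k fps \<Rightarrow> 'm"
  assumes H_zero: "0 \<in> H" and H_add: "\<And>x y. x \<in> H \<Longrightarrow> y \<in> H \<Longrightarrow> x + y \<in> H"
    and a_in_H: "a \<in> H" and a_pos: "0 < a" and H_min: "\<And>h. h \<in> H \<Longrightarrow> h \<noteq> 0 \<Longrightarrow> a \<le> h"
    and H_conductor: "\<And>n. e \<le> n \<Longrightarrow> n \<in> H"
    and R_eq: "R = semigroup_ring H" and inj_embed: "inj embed"
begin

lemma R_simps [simp]:
  "\<zero>\<^bsub>R\<^esub> = 0" "\<one>\<^bsub>R\<^esub> = 1" "x \<oplus>\<^bsub>R\<^esub> y = x + y" "x \<otimes>\<^bsub>R\<^esub> y = x * y"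
  by (simp_all add: R_eq semigroup_ring_def)

lemma carrier_R: "f \<in> carrier R \<longleftrightarrow> (\<forall>n. fps_nth f n \<noteq> 0 \<longrightarrow> n \<in> H)"
  by (simp add: R_eq semigroup_ring_def)

lemma R_closed:
  "0 \<in> carrier R" "1 \<in> carrier R"
  "f \<in> carrier R \<Longrightarrow> g \<in> carrier R \<Longrightarrow> f + g \<in> carrier R"
  "f \<in> carrier R \<Longrightarrow> g \<in> carrier R \<Longrightarrow> f - g \<in> carrier R"
  "f \<in> carrier R \<Longrightarrow> - f \<in> carrier R"
  "fps_const c \<in> carrier R" "h \<in> H \<Longrightarrow> fps_X ^ h \<in> carrier R"
proof -
  show "f + g \<in> carrier R" if "f \<in> carrier R" "g \<in> carrier R" for f g
    using that unfolding carrier_R by (metis add.right_neutral fps_add_nth)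
  show "f - g \<in> carrier R" if "f \<in> carrier R" "g \<in> carrier R" for f g
    using that unfolding carrier_R by (metis diff_zero fps_sub_nth)
qed (auto simp: carrier_R H_zero fps_X_power_nth split: if_splits)

lemma R_mult_closed:
  assumes "f \<in> carrier R" "g \<in> carrier R" shows "f * g \<in> carrier R"
  unfolding carrier_R
proof (intro allI impI)
  fix n assume "fps_nth (f * g) n \<noteq> 0"
  then obtain i where i: "i \<in> {0..n}" "fps_nth f i * fps_nth g (n - i) \<noteq> 0"
    unfolding fps_mult_nth by (rule sum.not_neutral_contains_not_neutral)
  then have "i \<in> H" "n - i \<in> H" using assms by (auto simp: carrier_R)
  then have "i + (n - i) \<in> H" by (rule H_add)
  then show "n \<in> H" using i by simp
qed

lemma fil_subset_R: "e \<le> d \<Longrightarrow> fil d \<subseteq> carrier R"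
proof
  fix f :: "'k fps" assume d: "e \<le> d" and f: "f \<in> fil d"
  show "f \<in> carrier R"
    unfolding carrier_R
  proof (intro allI impI)
    fix n assume "fps_nth f n \<noteq> 0"
    then have "\<not> n < d" using filD[OF f] by blast
    then show "n \<in> H" using H_conductor[of n] d by simp
  qed
qed

lemma cring_R: "cring R"
proof (rule cringI)
  show "abelian_group R"
    by (rule abelian_groupI) (auto intro: R_closed bexI[of _ "- _"])
  show "comm_monoid R"
    by (rule comm_monoidI) (auto intro: R_closed R_mult_closed)
qed (simp add: distrib_right)

lemma domain_R: "domain R"
  using cring_R by (auto simp: domain_def domain_axioms_def)

lemma module_S: "module R (ideal_module R UNIV)"
  by (rule moduleI[OF cring_R])
    (auto intro!: abelian_groupI exI[of _ "- _"] simp: distrib_left distrib_right)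

text \<open>The ideals of \<open>R\<close> and the ideals t^d S are both \<open>R\<close>-submodules
  of S. Treating them together allows sums and intersections of the two kinds.\<close>

abbreviation rsub :: "'k fps set \<Rightarrow> bool"
  where "rsub I \<equiv> submodule I R (ideal_module R UNIV)"

lemma rsub_iff:
  "rsub I \<longleftrightarrow> 0 \<in> I \<and> (\<forall>x\<in>I. \<forall>y\<in>I. x + y \<in> I) \<and> (\<forall>r\<in>carrier R. \<forall>x\<in>I. r * x \<in> I)"
  by (simp add: submodule_iff[OF module_S])

lemma rsubD:
  assumes "rsub I"
  shows "0 \<in> I" "x \<in> I \<Longrightarrow> y \<in> I \<Longrightarrow> x + y \<in> I" "r \<in> carrier R \<Longrightarrow> x \<in> I \<Longrightarrow> r * x \<in> I"
    "x \<in> I \<Longrightarrow> - x \<in> I" "x \<in> I \<Longrightarrow> y \<in> I \<Longrightarrow> x - y \<in> I"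
proof -
  note I = assms[unfolded rsub_iff]
  show "0 \<in> I" "x \<in> I \<Longrightarrow> y \<in> I \<Longrightarrow> x + y \<in> I" "r \<in> carrier R \<Longrightarrow> x \<in> I \<Longrightarrow> r * x \<in> I"
    using I by auto
  show n: "- y \<in> I" if "y \<in> I" for y using I R_closed(5)[OF R_closed(2)] that by (metis mult_minus1)
  show "x \<in> I \<Longrightarrow> y \<in> I \<Longrightarrow> x - y \<in> I" using I n by (metis add_uminus_conv_diff)
qed

lemma module_ideal: "rsub I \<Longrightarrow> module R (ideal_module R I)"
  using module_submodule[OF module_S] by simp

lemma rsub_R: "rsub (carrier R)"
  by (simp add: rsub_iff R_closed R_mult_closed)

lemma rsub_fil: "rsub (fil d)"
  by (auto simp: rsub_iff fil_closed fil_mult_left)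

lemma rsub_Int: "rsub I \<Longrightarrow> rsub J \<Longrightarrow> rsub (I \<inter> J)"
  by (rule submodule_Int[OF module_S])

lemma submodule_ideal_iff: "rsub I \<Longrightarrow> submodule J R (ideal_module R I) \<longleftrightarrow> rsub J \<and> J \<subseteq> I"
  using submodule_submodule_iff[OF module_S] by simp

lemma ideal_minus:
  assumes "rsub I" "x \<in> I" "y \<in> I"
  shows "x \<ominus>\<^bsub>ideal_module R I\<^esub> y = x - y"
proof -
  interpret I: module R "ideal_module R I" by (rule module_ideal[OF assms(1)])
  have "\<ominus>\<^bsub>ideal_module R I\<^esub> y = - y"
    by (rule I.M.minus_equality) (use assms rsubD[OF assms(1)] in auto)
  then show ?thesis by (simp add: a_minus_def)
qed

text \<open>Gaussian elimination on leading terms.\<close>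

lemma rsub_subset_by_orders:
  assumes I: "rsub I" and N: "rsub N" and NI: "N \<subseteq> I" and B: "I \<inter> fil B \<subseteq> N"
    and orders: "\<And>j f. j < B \<Longrightarrow> f \<in> I \<Longrightarrow> f \<in> fil j \<Longrightarrow> fps_nth f j \<noteq> 0 \<Longrightarrow> \<exists>g\<in>N. g \<in> fil j \<and> fps_nth g j \<noteq> 0"
  shows "I \<subseteq> N"
proof -
  \<comment> \<open>Descending induction on j: subtracting a scalar multiple of an element of
    \<open>N\<close> with the same order raises the order, until \<open>B\<close> applies. The
    scalars are constants and so belong to \<open>R\<close>.\<close>
  have "f \<in> N" if "f \<in> I" "f \<in> fil j" "j \<le> B" for f j
    using that(3,1,2)
  proof (induction j arbitrary: f rule: inc_induct)
    case base then show ?case using B by blast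
  next
    case (step j)
    show ?case
    proof (cases "fps_nth f j = 0")
      case True
      then show ?thesis using step by (simp add: fil_Suc_iff)
    next
      case False
      then obtain g where g: "g \<in> N" "g \<in> fil j" "fps_nth g j \<noteq> 0" using orders step by blast
      define g' where "g' = fps_const (fps_nth f j / fps_nth g j) * g"
      have g': "g' \<in> N" "g' \<in> fil j" "fps_nth g' j = fps_nth f j"
        using g rsubD(3)[OF N] R_closed(6) fil_mult_left by (auto simp: g'_def)
      have "f - g' \<in> I" "f - g' \<in> fil (Suc j)"
        using step g' NI rsubD(5)[OF I] fil_closed(3) by (auto simp: fil_Suc_iff)
      then have "f - g' + g' \<in> N" using step.IH g'(1) rsubD(2)[OF N] by blast
      then show ?thesis by simp
    qed
  qed
  from this[of _ 0] show ?thesis by auto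
qed

text \<open>Each element of t^(d+e) S is u w with w in t^e S, and t^e S lies in
  \<open>R\<close>.\<close>

lemma fil_subset_rsub:
  assumes "rsub I" "u \<in> I" "u \<in> fil d" "fps_nth u d \<noteq> 0"
  shows "fil (d + e) \<subseteq> I"
proof
  fix f :: "'k fps" assume "f \<in> fil (d + e)"
  then obtain w where "w \<in> fil e" "f = u * w" using fil_divide assms by blast
  then show "f \<in> I" using fil_subset_R[of e] rsubD(3)[OF assms(1), of w u] assms(2)
    by (auto simp: mult.commute)
qed

text \<open>One element for each order up to d + e that occurs in \<open>I\<close> is enough: the
  one of least order d generates t^(d+e) S, and elimination handles the orders below d + e.\<close>

lemma fg_rsub:
  assumes I: "rsub I" shows "finitely_generated R (ideal_module R I)"
proof (cases "I = {0}")
  case True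
  then have "N = I" if "rsub N" "N \<subseteq> I" for N using that rsubD(1) by blast
  then show ?thesis unfolding finitely_generated_def
    by (intro exI[of _ "{}"]) (auto simp: submodule_ideal_iff[OF I])
next
  case False
  then obtain d u where du: "I \<subseteq> fil d" "u \<in> I" "fps_nth u d \<noteq> 0"
    using ex_order rsubD(1)[OF I] by metis
  define P where "P j f \<longleftrightarrow> f \<in> I \<and> f \<in> fil j \<and> fps_nth f j \<noteq> 0" for j and f :: "'k fps"
  \<comment> \<open>The default \<open>u\<close> keeps \<open>s j\<close> inside \<open>I\<close>
    when no element of \<open>I\<close> has order \<open>j\<close>.\<close>
  define s where "s j = (if Ex (P j) then (SOME f. P j f) else u)" for j
  have s: "P j (s j)" if "P j f" for j f
    using someI[of "P j" f, OF that] that by (auto simp: s_def)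
  have sI: "s j \<in> I" for j 
  proof (cases "Ex (P j)")
    case True
    then show ?thesis using s by (auto simp: P_def)
  next
    case False
    then have "s j = u" unfolding s_def by argo
    then show ?thesis using du(2) by simp
  qed
  have "P d u" using du by (auto simp: P_def)
  note sd = s[OF this]
  have "N = I" if N: "rsub N" "N \<subseteq> I" "s ` {..d + e} \<subseteq> N" for N
  proof
    have "s d \<in> N" using N(3) by auto
    then have "fil (d + e) \<subseteq> N" using fil_subset_rsub[OF N(1), of "s d" d] sd by (simp add: P_def)
    then show "I \<subseteq> N"
    proof (intro rsub_subset_by_orders[OF I N(1,2), of "d + e"])
      fix j f assume "j < d + e" "f \<in> I" "f \<in> fil j" "fps_nth f j \<noteq> 0"
      then show "\<exists>g\<in>N. g \<in> fil j \<and> fps_nth g j \<noteq> 0"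
        using s[of j f] N(3) by (intro bexI[of _ "s j"]) (auto simp: P_def)
    qed auto
  qed (rule N(2))
  then show ?thesis unfolding finitely_generated_def
    using sI by (intro exI[of _ "s ` {..d + e}"]) (auto simp: submodule_ideal_iff[OF I])
qed

lemma noetherian_R: "noetherian R (ideal_module R (carrier R))"
  unfolding noetherian_def using fg_rsub by (auto simp: submodule_ideal_iff[OF rsub_R])

sublocale big_universe R embed fps_unpair
  by (rule big_universe.intro[OF domain_R noetherian_R inj_embed surj_fps_unpair])

lemma mod_iso_scale:
  assumes "rsub I" "u \<noteq> 0"
  shows "mod_iso R (ideal_module R I) (ideal_module R ((*) u ` I))"
proof -
  have "(*) u \<in> mod_hom R (ideal_module R I) (ideal_module R UNIV)"
    by (auto intro!: mod_homI simp: distrib_left ac_simps)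
  moreover have "inj_on ((*) u) I" using assms(2) by (auto simp: inj_on_def)
  ultimately show ?thesis using mod_iso_image[OF module_ideal[OF assms(1)] module_S] by simp
qed

lemma mod_iso_fil: "mod_iso R (ideal_module R UNIV) (ideal_module R (fil d))"
proof -
  have "rsub UNIV" using rsub_fil[of 0] by simp
  then show ?thesis using mod_iso_scale[of UNIV "fps_X ^ d"] by (simp add: fil_eq_image)
qed

text \<open>Multiplication by t^d identifies S with t^d S, so the exponent may be changed at will;
  containing some t^c S means containing S.\<close>

lemma has_copy_fil:
  fixes X :: "('k fps, 'm) module set"
  assumes "has_copy R X (ideal_module R (fil c))"
  shows "has_copy R X (ideal_module R (fil d))"
  using has_copy_iso[OF has_copy_iso[OF assms mod_iso_sym[OF module_S mod_iso_fil]] mod_iso_fil] .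

lemma add_hom:
  assumes "I \<subseteq> K" "J \<subseteq> K" "rsub K"
  shows "(\<lambda>(x, y). x + y) \<in> mod_hom R (direct_sum (ideal_module R I) (ideal_module R J)) (ideal_module R K)"
  using subsetD[OF assms(1)] subsetD[OF assms(2)] rsubD(2)[OF assms(3)]
  by (auto intro!: mod_homI simp: distrib_left)

end

section \<open>Ideals obtained from S\<close>

locale thick_numerical = numerical_ring H a e R embed + thick_subcategory R embed fps_unpair X
  for H a e and R :: "'k::field fps ring" and embed :: "'k fps \<Rightarrow> 'm" and X
begin

text \<open>If \<open>I\<close> has an element of order \<open>d\<close>, then \<open>I + t\<^sup>d\<^sup>+\<^sup>1 S = t\<^sup>d S\<close>, so that \<open>I\<close> is a direct summand
  of an extension of \<open>t\<^sup>d S\<close> by \<open>I \<inter> t\<^sup>d\<^sup>+\<^sup>1 S\<close>.\<close>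

lemma has_copy_fractional_ideal:
  assumes S: "has_copy R X (ideal_module R (fil c))" and I: "rsub I" and B: "fil B \<subseteq> I" "I \<subseteq> fil d"
  shows "has_copy R X (ideal_module R I)"
  using I B
proof (induction "B - d" arbitrary: I d)
  case 0
  \<comment> \<open>Here B <= d, so t^d S lies in t^B S and \<open>I\<close> is squeezed between
    them.\<close>
  then have "I = fil B" using fil_antimono[of B d] by auto
  then show ?case using has_copy_fil[OF S] by simp
next
  case (Suc n)
  note I = \<open>rsub I\<close>
  let ?J = "fil (Suc d) :: 'k fps set"
  have n: "n = B - Suc d" using Suc.hyps(2) by simp
  show ?case
  proof (cases "I \<subseteq> ?J")
    case True
    then show ?thesis using Suc.hyps(1)[OF n I Suc.prems(2)] by blast
  next
    case False
    then obtain u where "u \<in> I" "u \<notin> ?J" by blast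
    then have u: "u \<in> I" "fps_nth u d \<noteq> 0" using Suc.prems(3) by (auto simp: fil_Suc_iff)
    have IJ: "rsub (I \<inter> ?J)" by (rule rsub_Int[OF I rsub_fil])
    have "fil B \<subseteq> I \<inter> ?J" 
    proof -
      have "Suc d \<le> B" using Suc.hyps(2) by simp
      then show ?thesis using Suc.prems(2) fil_antimono by blast
    qed
    then have copy: "has_copy R X (ideal_module R (I \<inter> ?J))" using Suc.hyps(1)[OF n IJ] by blast
    let ?D = "direct_sum (ideal_module R I) (ideal_module R ?J)"
    have D: "module R ?D" by (rule module_direct_sum[OF module_ideal[OF I] module_ideal[OF rsub_fil]])
    have "short_exact R (ideal_module R (I \<inter> ?J)) ?D (ideal_module R (fil d)) (\<lambda>x. (x, - x)) (\<lambda>(x, y). x + y)"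
      unfolding short_exact_def
    proof (intro conjI)
      show "(\<lambda>x. (x, - x)) \<in> mod_hom R (ideal_module R (I \<inter> ?J)) ?D"
        by (auto intro!: mod_homI fil_closed)
      show gh: "(\<lambda>(x, y). x + y) \<in> mod_hom R ?D (ideal_module R (fil d))"
        by (rule add_hom[OF Suc.prems(3) fil_antimono rsub_fil]) simp
      show "(\<lambda>x. (x, - x)) ` carrier (ideal_module R (I \<inter> ?J)) = a_kernel ?D (ideal_module R (fil d)) (\<lambda>(x, y). x + y)"
      proof (intro equalityI subsetI)
        fix p assume "p \<in> a_kernel ?D (ideal_module R (fil d)) (\<lambda>(x, y). x + y)"
        then obtain x y where p: "p = (x, y)" "x \<in> I" "y \<in> ?J" "x + y = 0" by (auto simp: a_kernel_def')
        then have "x = - y" by (simp add: eq_neg_iff_add_eq_0)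
        then have "x \<in> ?J" "y = - x" using p(3) by (auto intro: fil_closed)
        then show "p \<in> (\<lambda>x. (x, - x)) ` carrier (ideal_module R (I \<inter> ?J))" using p by auto
      qed (auto simp: a_kernel_def' fil_closed)
      have "x \<in> (\<lambda>(x, y). x + y) ` carrier ?D" if x: "x \<in> fil d" for x
      proof -
        \<comment> \<open>A multiple of \<open>u\<close> inside \<open>I\<close> with the same
          coefficient at t^d as \<open>x\<close>; the difference then lies in
          \<open>?J\<close>.\<close>
        define u' where "u' = fps_const (fps_nth x d / fps_nth u d) * u"
        have "u' \<in> I" "u' \<in> fil d" "fps_nth u' d = fps_nth x d"
          using u rsubD(3)[OF I] R_closed(6) Suc.prems(3) fil_mult_left by (auto simp: u'_def)
        then have "x = u' + (x - u')" "u' \<in> I" "x - u' \<in> ?J"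
          using x fil_closed(3) by (auto simp: fil_Suc_iff)
        then show ?thesis by (intro image_eqI[of _ _ "(u', x - u')"]) auto
      qed
      then show "(\<lambda>(x, y). x + y) ` carrier ?D = carrier (ideal_module R (fil d))"
        using mod_homD(1)[OF gh] by (intro equalityI subsetI) auto
    qed (auto simp: inj_on_def)
    then have "has_copy R X ?D"
      by (rule has_copy_short_exact[OF sub ext module_ideal[OF IJ] D module_ideal[OF rsub_fil] _ copy
            has_copy_fil[OF S]])
    then show ?thesis
      by (rule has_copy_retract[OF D module_ideal[OF I] _
            direct_sum_homs(3,1)[OF module_ideal[OF I] module_ideal[OF rsub_fil]]]) simp
  qed
qed

lemma has_copy_ideal:
  assumes S: "has_copy R X (ideal_module R (fil c))" and I: "rsub I"
  shows "has_copy R X (ideal_module R I)"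
proof (cases "I = {0}")
  case True
  then show ?thesis using has_copy_zero[OF module_ideal[OF I]] by simp
next
  case False
  then obtain d u where "I \<subseteq> fil d" "u \<in> I" "fps_nth u d \<noteq> 0"
    using ex_order rsubD(1)[OF I] by metis
  then show ?thesis using has_copy_fractional_ideal[OF S I] fil_subset_rsub[OF I] by blast
qed

end

section \<open>Cyclic modules and the descent to the residue field\<close>

context numerical_ring
begin

text \<open>R/A with power series as elements, so that \<open>quot_hom\<close> supplies the maps
  between such quotients. The coset version of the theorem is compared with it in
  \<open>quotient_module_copy\<close>.\<close>

abbreviation rquot :: "'k fps set \<Rightarrow> ('k fps, 'k fps) module"
  where "rquot A \<equiv> quot (ideal_module R (carrier R)) A"

abbreviation rep :: "'k fps set \<Rightarrow> 'k fps \<Rightarrow> 'k fps"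
  where "rep A \<equiv> coset_rep (ideal_module R (carrier R)) A"

definition ideal_in :: "'k fps set \<Rightarrow> bool"
  where "ideal_in A \<longleftrightarrow> rsub A \<and> A \<subseteq> carrier R"

lemma ideal_inD: "ideal_in A \<Longrightarrow> rsub A" "ideal_in A \<Longrightarrow> submodule A R (ideal_module R (carrier R))"
  "ideal_in A \<Longrightarrow> f \<in> A \<Longrightarrow> f \<in> carrier R"
  by (auto simp: ideal_in_def submodule_ideal_iff[OF rsub_R])

lemma module_rquot: "ideal_in A \<Longrightarrow> module R (rquot A)"
  by (rule module_quot[OF module_R ideal_inD(2)])

lemma rep_hom: "ideal_in A \<Longrightarrow> rep A \<in> mod_hom R (ideal_module R (carrier R)) (rquot A)"
  by (rule coset_rep_hom[OF module_R ideal_inD(2)])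

lemma rep_zero_iff: "ideal_in A \<Longrightarrow> r \<in> carrier R \<Longrightarrow> rep A r = \<zero>\<^bsub>rquot A\<^esub> \<longleftrightarrow> r \<in> A"
  using coset_rep_zero_iff[OF module_R ideal_inD(2)] by simp

lemma rep_eq_iff: "ideal_in A \<Longrightarrow> r \<in> carrier R \<Longrightarrow> s \<in> carrier R \<Longrightarrow> rep A r = rep A s \<longleftrightarrow> r - s \<in> A"
  using coset_rep_eq_iff[OF module_R ideal_inD(2)] ideal_minus[OF rsub_R] by simp

lemma rquot_carrier: "carrier (rquot A) = rep A ` carrier R"
  using quot_surj[of "ideal_module R (carrier R)" A] by simp

text \<open>The ideal \<open>R\<^sub>\<ge>\<^sub>s\<close> of the overview. In particular
  \<open>tail 1\<close> is the maximal ideal and \<open>rquot (tail 1)\<close> the residue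
  field.\<close>

definition tail :: "nat \<Rightarrow> 'k fps set"
  where "tail s = carrier R \<inter> fil s"

lemma ideal_in_tail: "ideal_in (tail s)"
  unfolding ideal_in_def tail_def using rsub_Int[OF rsub_R rsub_fil] by blast

text \<open>No exponent of \<open>H\<close> lies strictly between 0 and \<open>a\<close>. This is
  where the descent in steps of \<open>a\<close> can stop.\<close>

lemma tail_1:
  assumes "1 \<le> s" "s \<le> a"
  shows "tail s = tail 1"
proof -
  have "f \<in> fil s" if f: "f \<in> carrier R" "f \<in> fil 1" for f
  proof -
    have "fps_nth f n = 0" if "n < s" for n
    proof (cases "n = 0")
      case True
      then show ?thesis using filD[OF f(2), of 0] by simp
    next
      case False
      then have "n \<notin> H" using H_min[of n] \<open>n < s\<close> assms(2) by auto
      then show ?thesis using f(1) by (auto simp: carrier_R)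
    qed
    then show ?thesis by (simp add: fil_def)
  qed
  then show ?thesis using fil_antimono[OF assms(1)] by (auto simp: tail_def)
qed

end

lemma mod_hom_pair:
  "f \<in> mod_hom R P M \<Longrightarrow> g \<in> mod_hom R P N \<Longrightarrow> (\<lambda>x. (f x, g x)) \<in> mod_hom R P (direct_sum M N)"
  by (auto simp: mod_hom_def)

lemma mod_hom_sum:
  assumes "module R P" "f \<in> mod_hom R M P" "g \<in> mod_hom R N P"
  shows "(\<lambda>(x, y). f x \<oplus>\<^bsub>P\<^esub> g y) \<in> mod_hom R (direct_sum M N) P"
proof -
  interpret P: module R P by fact
  show ?thesis using mod_homD[OF assms(2)] mod_homD[OF assms(3)]
    by (auto intro!: mod_homI simp: P.smult_r_distr P.M.a_ac)
qed

context thick_numerical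
begin

text \<open>Put \<open>A = R\<^sub>\<ge>\<^sub>s\<close>, \<open>B = R\<^sub>\<ge>\<^sub>s\<^sub>-\<^sub>a\<close> and \<open>x = t\<^sup>a\<close>. Removing from \<open>A\<close> the exponents of \<open>x B\<close>
  that are not exponents of \<open>x A\<close> leaves an ideal \<open>C\<close>, because multiplying by a nonunit of \<open>R\<close>
  raises the exponents by at least \<open>a\<close>. The sequence
  \<open>0 \<rightarrow> R/A \<rightarrow> R/B \<oplus> R/C \<rightarrow> R/A \<rightarrow> 0\<close> with maps \<open>(1, x)\<close> and \<open>(u, v) \<mapsto> v - x u\<close> is exact.\<close>

lemma has_copy_rquot_step:
  assumes copy: "has_copy R X (rquot (tail s))" and "a < s"
  shows "has_copy R X (rquot (tail (s - a)))"
proof -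
  define A where "A = tail s"
  define B where "B = tail (s - a)"
  define C where "C = {f \<in> A. \<forall>h\<in>H. s - a \<le> h \<and> h < s \<longrightarrow> fps_nth f (h + a) = 0}"
  let ?x = "fps_X ^ a :: 'k fps"
  let ?R = "ideal_module R (carrier R)"
  have x: "?x \<in> carrier R" by (rule R_closed(7)[OF a_in_H])
  have xn: "fps_nth (?x * f) (n + a) = fps_nth f n" for f n by (simp add: fps_X_power_mult_nth)
  have iA: "ideal_in A" and iB: "ideal_in B" by (simp_all add: A_def B_def ideal_in_tail)
  have CA: "C \<subseteq> A" by (auto simp: C_def)
  have iC: "ideal_in C"
    unfolding ideal_in_def rsub_iff
  proof (intro conjI ballI)
    show "0 \<in> C" using rsubD(1)[OF ideal_inD(1)[OF iA]] by (simp add: C_def)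
    show "f + g \<in> C" if "f \<in> C" "g \<in> C" for f g
      using rsubD(2)[OF ideal_inD(1)[OF iA]] that by (auto simp: C_def)
    show "C \<subseteq> carrier R" using CA ideal_inD(3)[OF iA] by blast
    fix r f assume r: "r \<in> carrier R" and f: "f \<in> C"
    have "fps_nth (r * f) (h + a) = 0" if h: "h \<in> H" "s - a \<le> h" "h < s" for h
      unfolding fps_mult_nth
    proof (intro sum.neutral ballI)
      fix i assume "i \<in> {0..h + a}"
      \<comment> \<open>The constant term of \<open>r\<close> meets a coefficient of
        \<open>f\<close> that is zero by the definition of \<open>C\<close>. Any other exponent i of
        \<open>r\<close> is at least \<open>a\<close>, so h + a - i <= h < s lies below the order of
        \<open>f\<close>.\<close>
      consider "i = 0" | "i \<notin> H" | "i \<in> H" "i \<noteq> 0" by blast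
      then show "fps_nth r i * fps_nth f (h + a - i) = 0"
      proof cases
        case 1 then show ?thesis using f h by (auto simp: C_def)
      next
        case 2 then show ?thesis using r by (auto simp: carrier_R)
      next
        case 3
        then have "h + a - i < s" using H_min[of i] h(3) by linarith
        moreover have "f \<in> fil s" using f by (auto simp: C_def A_def tail_def)
        ultimately show ?thesis using filD by auto
      qed
    qed
    then show "r * f \<in> C" using f rsubD(3)[OF ideal_inD(1)[OF iA] r] by (auto simp: C_def)
  qed
  have AB: "A \<subseteq> B" using fil_antimono[of "s - a" s] by (auto simp: A_def B_def tail_def)
  have xB: "?x * b \<in> A" if "b \<in> B" for b
    using that fil_mult[OF fps_X_power_fil[of a], of b "s - a"] R_mult_closed[OF x] \<open>a < s\<close>
    by (auto simp: A_def B_def tail_def)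
  have xA: "?x * b \<in> C" if "b \<in> A" for b
    using xB[of b] AB that by (auto simp: C_def xn A_def tail_def dest: filD)
  \<comment> \<open>This is the injectivity of (1, x): if the image of \<open>b\<close> vanishes in
    R/B and in R/C, then \<open>b\<close> vanishes in R/A.\<close>
  have BC: "b \<in> A" if "b \<in> B" "?x * b \<in> C" for b
  proof -
    have "fps_nth b n = 0" if "n < s" for n
    proof -
      consider "n \<notin> H" | "n < s - a" | "n \<in> H" "s - a \<le> n" by linarith
      then show ?thesis
      proof cases
        case 1 then show ?thesis using \<open>b \<in> B\<close> by (auto simp: B_def tail_def carrier_R)
      next
        case 2 then show ?thesis using \<open>b \<in> B\<close> filD[of b "s - a" n] by (auto simp: B_def tail_def)
      next
        case 3 then show ?thesis using \<open>?x * b \<in> C\<close> xn[of b n] \<open>n < s\<close> by (auto simp: C_def)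
      qed
    qed
    then show ?thesis using that by (auto simp: A_def B_def tail_def fil_def)
  qed
  \<comment> \<open>A = x B + C, which gives exactness in the middle. The witness \<open>b\<close>
    collects the coefficients of \<open>v\<close> that \<open>C\<close> forbids, shifted down by
    \<open>a\<close>.\<close>
  have split: "\<exists>b\<in>B. v - ?x * b \<in> C" if v: "v \<in> A" for v
  proof -
    define b where "b = Abs_fps (\<lambda>n. if n \<in> H \<and> s - a \<le> n \<and> n < s then fps_nth v (n + a) else 0)"
    have b: "b \<in> B" by (auto simp: b_def B_def tail_def carrier_R fil_def)
    then have "v - ?x * b \<in> A" using xB rsubD(5)[OF ideal_inD(1)[OF iA] v] by blast
    then have "v - ?x * b \<in> C" by (auto simp: C_def xn b_def)
    then show ?thesis using b by blast
  qed
  interpret QA: module R "rquot A" by (rule module_rquot[OF iA])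
  interpret QB: module R "rquot B" by (rule module_rquot[OF iB])
  interpret QC: module R "rquot C" by (rule module_rquot[OF iC])
  note mA = QA.module_axioms and mB = QB.module_axioms and mC = QC.module_axioms
  have mult_hom: "(*) u \<in> mod_hom R ?R ?R" if "u \<in> carrier R" for u
    using that by (auto intro!: mod_homI R_mult_closed simp: distrib_left ac_simps)
  have f2': "rep C \<circ> (*) ?x \<in> mod_hom R ?R (rquot C)"
    by (rule mod_hom_comp[OF mult_hom[OF x] rep_hom[OF iC]])
  have f1: "rep B \<in> mod_hom R (rquot A) (rquot B)" "\<And>r. r \<in> carrier R \<Longrightarrow> rep B (rep A r) = rep B r"
    using quot_hom[OF module_R ideal_inD(2)[OF iA] mB rep_hom[OF iB]] rep_zero_iff[OF iB] AB ideal_inD(3)[OF iA]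
    by auto
  have f2: "rep C \<circ> (*) ?x \<in> mod_hom R (rquot A) (rquot C)"
    "\<And>r. r \<in> carrier R \<Longrightarrow> (rep C \<circ> (*) ?x) (rep A r) = rep C (?x * r)"
    using quot_hom[OF module_R ideal_inD(2)[OF iA] mC f2'] rep_zero_iff[OF iC] xA
      R_mult_closed[OF x] ideal_inD(3)[OF iA] by auto
  have g1': "rep A \<circ> (*) (- ?x) \<in> mod_hom R ?R (rquot A)"
    by (rule mod_hom_comp[OF mult_hom[OF R_closed(5)[OF x]] rep_hom[OF iA]])
  have g1: "rep A \<circ> (*) (- ?x) \<in> mod_hom R (rquot B) (rquot A)"
    "\<And>r. r \<in> carrier R \<Longrightarrow> (rep A \<circ> (*) (- ?x)) (rep B r) = rep A (- ?x * r)"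
    using quot_hom[OF module_R ideal_inD(2)[OF iB] mA g1'] rep_zero_iff[OF iA] xB
      R_mult_closed[OF x] ideal_inD(3)[OF iB] ideal_inD(3)[OF iA] rsubD(4)[OF ideal_inD(1)[OF iA]] R_closed(5)
    by auto
  have g2: "rep A \<in> mod_hom R (rquot C) (rquot A)" "\<And>r. r \<in> carrier R \<Longrightarrow> rep A (rep C r) = rep A r"
    using quot_hom[OF module_R ideal_inD(2)[OF iC] mA rep_hom[OF iA]] rep_zero_iff[OF iA] CA ideal_inD(3)[OF iC]
    by auto
  let ?D = "direct_sum (rquot B) (rquot C)"
  have D: "module R ?D" by (rule module_direct_sum[OF mB mC])
  let ?f = "\<lambda>r. (rep B r, (rep C \<circ> (*) ?x) r)"
  let ?g = "\<lambda>(u, v). (rep A \<circ> (*) (- ?x)) u \<oplus>\<^bsub>rquot A\<^esub> rep A v"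
  have f: "?f \<in> mod_hom R (rquot A) ?D" by (rule mod_hom_pair[OF f1(1) f2(1)])
  have g: "?g \<in> mod_hom R ?D (rquot A)" by (rule mod_hom_sum[OF mA g1(1) g2(1)])
  have f_rep: "?f (rep A r) = (rep B r, rep C (?x * r))" if "r \<in> carrier R" for r
    using f1(2) f2(2) that by simp
  have g_rep: "?g (rep B u, rep C v) = rep A (v - ?x * u)" if "u \<in> carrier R" "v \<in> carrier R" for u v
  proof -
    have "?g (rep B u, rep C v) = rep A (- ?x * u) \<oplus>\<^bsub>rquot A\<^esub> rep A v"
      using g1(2)[OF that(1)] g2(2)[OF that(2)] by simp
    also have "\<dots> = rep A (- ?x * u + v)"
      using mod_homD(2)[OF rep_hom[OF iA], of "- ?x * u" v] that R_mult_closed[OF R_closed(5)[OF x]] by simp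
    finally show ?thesis by simp
  qed
  have "short_exact R (rquot A) ?D (rquot A) ?f ?g"
    unfolding short_exact_def
  proof (intro conjI f g)
    show "inj_on ?f (carrier (rquot A))"
      unfolding mod_hom_inj_iff[OF mA D f]
    proof (intro ballI impI)
      fix q assume "q \<in> carrier (rquot A)" "?f q = \<zero>\<^bsub>?D\<^esub>"
      then obtain r where r: "r \<in> carrier R" "q = rep A r" "(rep B r, rep C (?x * r)) = \<zero>\<^bsub>?D\<^esub>"
        using f_rep by (auto simp: rquot_carrier)
      then have "r \<in> B" "?x * r \<in> C"
        using rep_zero_iff[OF iB] rep_zero_iff[OF iC] R_mult_closed[OF x] by auto
      then show "q = \<zero>\<^bsub>rquot A\<^esub>" using BC rep_zero_iff[OF iA] r by auto
    qed
    show "?f ` carrier (rquot A) = a_kernel ?D (rquot A) ?g"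
    proof (intro equalityI subsetI)
      fix p assume "p \<in> ?f ` carrier (rquot A)"
      then obtain r where r: "r \<in> carrier R" "p = (rep B r, rep C (?x * r))"
        using f_rep by (auto simp: rquot_carrier)
      have xr: "?x * r \<in> carrier R" using R_mult_closed[OF x r(1)] .
      have "?g p = rep A (?x * r - ?x * r)" using g_rep[OF r(1) xr] r(2) by (simp only:)
      then have "?g p = \<zero>\<^bsub>rquot A\<^esub>"
        using rep_zero_iff[OF iA R_closed(1)] rsubD(1)[OF ideal_inD(1)[OF iA]] by simp
      moreover have "p \<in> carrier ?D" using r xr by (auto simp: rquot_carrier)
      ultimately show "p \<in> a_kernel ?D (rquot A) ?g" by (simp add: a_kernel_def')
    next
      fix p assume "p \<in> a_kernel ?D (rquot A) ?g"
      then have p: "p \<in> carrier ?D" "?g p = \<zero>\<^bsub>rquot A\<^esub>" by (simp_all add: a_kernel_def')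
      then obtain u v where uv: "u \<in> carrier R" "v \<in> carrier R" "p = (rep B u, rep C v)"
        by (auto simp: rquot_carrier)
      have "rep A (v - ?x * u) = \<zero>\<^bsub>rquot A\<^esub>" using p(2) g_rep[OF uv(1,2)] uv(3) by (simp only:)
      then have "v - ?x * u \<in> A"
        using rep_zero_iff[OF iA R_closed(4)[OF uv(2) R_mult_closed[OF x uv(1)]]] by simp
      then obtain b where b: "b \<in> B" "v - ?x * u - ?x * b \<in> C" using split by blast
      have bR: "b \<in> carrier R" using ideal_inD(3)[OF iB b(1)] .
      have ub: "u + b \<in> carrier R" using R_closed(3)[OF uv(1) bR] .
      \<comment> \<open>Passing from u to u + b does not change the class modulo \<open>B\<close>,
        and it moves v - x u into \<open>C\<close>. Hence u + b is the required preimage.\<close>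
      have "rep B (u + b) = rep B u" using rep_eq_iff[OF iB ub uv(1)] b(1) by simp
      moreover have "rep C v = rep C (?x * (u + b))"
        using rep_eq_iff[OF iC uv(2) R_mult_closed[OF x ub]] b(2) by (simp add: algebra_simps)
      ultimately have "p = ?f (rep A (u + b))" using f_rep[OF ub] uv(3) by (simp only:)
      then show "p \<in> ?f ` carrier (rquot A)" using ub by (intro image_eqI) (auto simp: rquot_carrier)
    qed
    have "rep A v \<in> ?g ` carrier ?D" if "v \<in> carrier R" for v
    proof
      show "rep A v = ?g (rep B 0, rep C v)" using g_rep[OF R_closed(1) that] by simp
      show "(rep B 0, rep C v) \<in> carrier ?D" using that R_closed(1) by (auto simp: rquot_carrier)
    qed
    then have "carrier (rquot A) \<subseteq> ?g ` carrier ?D" unfolding rquot_carrier by blast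
    then show "?g ` carrier ?D = carrier (rquot A)" using mod_homD(1)[OF g] by blast
  qed
  then have "has_copy R X ?D"
    by (rule has_copy_short_exact[OF sub ext mA D mA]) (use copy in \<open>simp_all add: A_def\<close>)
  then have "has_copy R X (rquot B)"
    by (rule has_copy_retract[OF D mB _ direct_sum_homs(3,1)[OF mB mC]]) simp
  then show ?thesis by (simp add: B_def)
qed

text \<open>Subtract \<open>a\<close> as long as s exceeds it; the remainder satisfies 1 <= s <= a,
  where \<open>tail s\<close> is already the maximal ideal. The value s = 0, for which R/R is zero,
  is never reached.\<close>

lemma has_copy_residue_field:
  assumes "has_copy R X (rquot (tail s))" "1 \<le> s"
  shows "has_copy R X (rquot (tail 1))"
  using assms
proof (induction s rule: less_induct)
  case (less s)
  show ?case
  proof (cases "a < s")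
    case True
    then show ?thesis using less.IH[of "s - a"] has_copy_rquot_step[OF less.prems(1)] a_pos by simp
  next
    case False
    then show ?thesis using tail_1[of s] less.prems by simp
  qed
qed

end

section \<open>Modules of finite length\<close>

lemma (in abelian_group) add_minus_add_left:
  assumes "x \<in> carrier G" "y \<in> carrier G" "z \<in> carrier G"
  shows "(x \<oplus> y) \<ominus> (x \<oplus> z) = y \<ominus> z"
proof -
  have "(x \<oplus> y) \<ominus> (x \<oplus> z) = (x \<oplus> \<ominus> x) \<oplus> (y \<ominus> z)"
    using assms by (simp add: a_minus_def minus_add a_ac)
  then show ?thesis using assms by (simp add: r_neg)
qed

text \<open>It lets \<open>fg_induct\<close> run over plain submodules N while the property concerns
  their pure closures, whose steps are those of \<open>rank_one_quotient\<close>.\<close>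

lemma pure_closure_adjoin:
  assumes dom: "domain R" and M: "module R M" and N: "submodule N R M" and g: "g \<in> carrier M"
  shows "pure_closure R M (adjoin R M N g) = pure_closure R M (adjoin R M (pure_closure R M N) g)"
    (is "_ = ?P")
proof
  note pc = pure_closure[OF dom M]
  note A = adjoin[OF M N g] and A' = adjoin[OF M pc(1)[OF N] g]
  have mono: "pure_closure R M C \<subseteq> pure_closure R M D" if "C \<subseteq> D" for C D
    using that by (auto simp: pure_closure_def)
  have "adjoin R M N g \<subseteq> adjoin R M (pure_closure R M N) g"
    using adjoin_least[OF M A'(1) _ A'(3)] pc(2)[OF N] A'(2) by blast
  then show "pure_closure R M (adjoin R M N g) \<subseteq> ?P" by (rule mono)
  have "adjoin R M (pure_closure R M N) g \<subseteq> pure_closure R M (adjoin R M N g)"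
    using adjoin_least[OF M pc(1)[OF A(1)] mono[OF A(2)]] A(3) pc(2)[OF A(1)] by blast
  then show "?P \<subseteq> pure_closure R M (adjoin R M N g)" using mono pc(3)[OF A(1)] by metis
qed

context numerical_ring
begin

text \<open>If \<open>r\<close> had constant term c0 different from 0, then c0 - r would lie in the
  maximal ideal, so c0 z = (c0 - r) z + r z would lie in \<open>N\<close>. The constant c0 is
  invertible, which would put \<open>z\<close> into \<open>N\<close>.\<close>

lemma residue_kernel:
  assumes M: "module R M" and N: "submodule N R M" and z: "z \<in> carrier M" "z \<notin> N"
    and m: "\<And>r. r \<in> tail 1 \<Longrightarrow> r \<odot>\<^bsub>M\<^esub> z \<in> N"
    and r: "r \<in> carrier R" and rz: "r \<odot>\<^bsub>M\<^esub> z \<in> N"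
  shows "r \<in> tail 1"
proof (rule ccontr)
  interpret M: module R M by fact
  note ND = submoduleD[OF M N]
  assume "r \<notin> tail 1"
  then have r0: "fps_nth r 0 \<noteq> 0" using r by (auto simp: tail_def fil_def)
  let ?c0 = "fps_const (fps_nth r 0)" and ?i = "fps_const (inverse (fps_nth r 0))"
  have c0: "?c0 \<in> carrier R" "?i \<in> carrier R" by (rule R_closed)+
  have "?c0 - r \<in> tail 1" using R_closed(4)[OF c0(1) r] by (auto simp: tail_def fil_def)
  then have "(?c0 - r) \<odot>\<^bsub>M\<^esub> z \<oplus>\<^bsub>M\<^esub> r \<odot>\<^bsub>M\<^esub> z \<in> N" using m rz ND(3) by blast
  moreover have "(?c0 - r) \<odot>\<^bsub>M\<^esub> z \<oplus>\<^bsub>M\<^esub> r \<odot>\<^bsub>M\<^esub> z = ?c0 \<odot>\<^bsub>M\<^esub> z"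
    using M.smult_l_distr[OF R_closed(4)[OF c0(1) r] r z(1)] by simp
  ultimately have "?i \<odot>\<^bsub>M\<^esub> (?c0 \<odot>\<^bsub>M\<^esub> z) \<in> N" using ND(4)[OF c0(2)] by simp
  moreover have "?i \<odot>\<^bsub>M\<^esub> (?c0 \<odot>\<^bsub>M\<^esub> z) = z"
    using M.smult_assoc1[OF c0(2,1) z(1)] M.smult_one[OF z(1)] r0 by simp
  ultimately show False using z(2) by simp
qed

text \<open>Both (N + R z)/N and R/m are images of \<open>R\<close>, the first under r |-> r z. By
  \<open>residue_kernel\<close> the kernels agree, so \<open>first_iso\<close> applies.\<close>

lemma residue_field_quotient:
  fixes M :: "('k fps, 'n) module"
  assumes M: "module R M" and N: "submodule N R M" and z: "z \<in> carrier M" "z \<notin> N"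
    and m: "\<And>r. r \<in> tail 1 \<Longrightarrow> r \<odot>\<^bsub>M\<^esub> z \<in> N"
  defines "B \<equiv> adjoin R M N z"
  shows "\<exists>f\<in>mod_hom R (M\<lparr>carrier := B\<rparr>) (rquot (tail 1)).
    f ` B = carrier (rquot (tail 1)) \<and> (\<forall>x\<in>B. f x = \<zero>\<^bsub>rquot (tail 1)\<^esub> \<longleftrightarrow> x \<in> N)"
proof -
  interpret M: module R M by fact
  note ND = submoduleD[OF M N]
  have B: "submodule B R M" "N \<subseteq> B" "z \<in> B" unfolding B_def by (rule adjoin[OF M N z(1)])+
  let ?B = "M\<lparr>carrier := B\<rparr>" and ?K = "rquot (tail 1)" and ?R = "ideal_module R (carrier R)"
  have Bm: "module R ?B" by (rule module_submodule[OF M B(1)])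
  have NB: "submodule N R ?B" using N B(2) by (simp add: submodule_submodule_iff[OF M B(1)])
  let ?c = "coset_rep ?B N"
  let ?Q = "quot ?B N"
  have Q: "module R ?Q" by (rule module_quot[OF Bm NB])
  have K: "module R ?K" by (rule module_rquot[OF ideal_in_tail])
  note c = coset_rep_hom[OF Bm NB]
  have sz: "(\<lambda>r. r \<odot>\<^bsub>M\<^esub> z) \<in> mod_hom R ?R ?B" using smult_hom[OF Bm, of z] B(3) by simp
  have h: "?c \<circ> (\<lambda>r. r \<odot>\<^bsub>M\<^esub> z) \<in> mod_hom R ?R ?Q" by (rule mod_hom_comp[OF sz c])
  have rzB: "r \<odot>\<^bsub>M\<^esub> z \<in> B" if "r \<in> carrier R" for r using submoduleD(4)[OF M B(1) that B(3)] .
  have kernel: "r \<odot>\<^bsub>M\<^esub> z \<in> N \<longleftrightarrow> r \<in> tail 1" if "r \<in> carrier R" for r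
    using residue_kernel[OF M N z m that] m by blast
  have "mod_iso R ?Q ?K"
  proof (rule first_iso[OF module_R Q K h _ rep_hom[OF ideal_in_tail]])
    show "rep (tail 1) ` carrier ?R = carrier ?K" by (simp add: rquot_carrier)
    have "?c x \<in> (?c \<circ> (\<lambda>r. r \<odot>\<^bsub>M\<^esub> z)) ` carrier R" if "x \<in> B" for x
    proof -
      obtain y r where x: "x = y \<oplus>\<^bsub>M\<^esub> r \<odot>\<^bsub>M\<^esub> z" "y \<in> N" "r \<in> carrier R"
        using \<open>x \<in> B\<close> unfolding B_def adjoin_def by blast
      have "?c x = ?c y \<oplus>\<^bsub>?Q\<^esub> ?c (r \<odot>\<^bsub>M\<^esub> z)"
        using mod_homD(2)[OF c, of y "r \<odot>\<^bsub>M\<^esub> z"] x B(2) rzB by auto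
      also have "?c y = \<zero>\<^bsub>?Q\<^esub>" using coset_rep_zero_iff[OF Bm NB] x(2) B(2) by auto
      finally have "?c x = ?c (r \<odot>\<^bsub>M\<^esub> z)"
        using abelian_monoid.l_zero[OF abelian_group.axioms(1)[OF module.axioms(2)[OF Q]]]
          mod_homD(1)[OF c] rzB[OF x(3)] by simp
      then show ?thesis using x(3) by simp
    qed
    then have "?c ` B \<subseteq> (?c \<circ> (\<lambda>r. r \<odot>\<^bsub>M\<^esub> z)) ` carrier R" by blast
    moreover have "(?c \<circ> (\<lambda>r. r \<odot>\<^bsub>M\<^esub> z)) ` carrier R \<subseteq> ?c ` B" using rzB by auto
    moreover have "?c ` B = carrier ?Q" using quot_surj[of ?B N] by simp
    ultimately show "(?c \<circ> (\<lambda>r. r \<odot>\<^bsub>M\<^esub> z)) ` carrier ?R = carrier ?Q" by simp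
    show "(?c \<circ> (\<lambda>r. r \<odot>\<^bsub>M\<^esub> z)) x = \<zero>\<^bsub>?Q\<^esub> \<longleftrightarrow> rep (tail 1) x = \<zero>\<^bsub>?K\<^esub>" if "x \<in> carrier ?R" for x
      using that kernel[of x] rzB[of x] coset_rep_zero_iff[OF Bm NB] rep_zero_iff[OF ideal_in_tail] by simp
  qed
  then obtain \<phi> where \<phi>: "\<phi> \<in> mod_hom R ?Q ?K" "bij_betw \<phi> (carrier ?Q) (carrier ?K)"
    unfolding mod_iso_def by blast
  have "\<phi> \<circ> ?c \<in> mod_hom R ?B ?K" by (rule mod_hom_comp[OF c \<phi>(1)])
  moreover have "(\<phi> \<circ> ?c) ` B = carrier ?K"
  proof -
    have "?c ` B = carrier ?Q" using quot_surj[of ?B N] by simp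
    then show ?thesis by (simp only: image_comp[symmetric] bij_betw_imp_surj_on[OF \<phi>(2)])
  qed
  moreover have "(\<phi> \<circ> ?c) x = \<zero>\<^bsub>?K\<^esub> \<longleftrightarrow> x \<in> N" if "x \<in> B" for x
  proof -
    have cx: "?c x \<in> carrier ?Q" using mod_homD(1)[OF c, of x] that by simp
    have "\<phi> (?c x) = \<zero>\<^bsub>?K\<^esub> \<longleftrightarrow> ?c x = \<zero>\<^bsub>?Q\<^esub>"
      using mod_hom_inj_iff[OF Q K \<phi>(1)] bij_betw_imp_inj_on[OF \<phi>(2)] cx mod_hom_zero[OF Q K \<phi>(1)] by auto
    then show ?thesis using coset_rep_zero_iff[OF Bm NB, of x] that by simp
  qed
  ultimately show ?thesis by blast
qed

definition annihilator :: "('k fps, 'n) module \<Rightarrow> 'k fps set"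
  where "annihilator M = {f \<in> carrier R. \<forall>x\<in>carrier M. f \<odot>\<^bsub>M\<^esub> x = \<zero>\<^bsub>M\<^esub>}"

lemma rsub_annihilator:
  assumes "module R M" shows "rsub (annihilator M)"
proof -
  interpret M: module R M by fact
  show ?thesis
    using M.smult_l_null M.smult_l_distr M.smult_assoc1
    by (auto simp: rsub_iff annihilator_def R_closed R_mult_closed)
qed

text \<open>A common denominator makes the annihilator a nonzero ideal of \<open>R\<close>, and
  every such ideal contains some t^s S.\<close>

lemma torsion_annihilated:
  fixes M :: "('k fps, 'n) module"
  assumes M: "module R M" and fg: "finitely_generated R M" and tor: "torsion R M"
  shows "\<exists>s. fil s \<subseteq> annihilator M"
proof -
  obtain r where "r \<in> carrier R" "r \<noteq> 0" "\<forall>x\<in>carrier M. r \<odot>\<^bsub>M\<^esub> x \<in> {\<zero>\<^bsub>M\<^esub>}"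
    using common_denominator[OF domain_R M fg submodule_zero[OF M]] tor by (auto simp: torsion_def)
  then have "annihilator M \<noteq> {0}" by (auto simp: annihilator_def)
  then obtain d u where "annihilator M \<subseteq> fil d" "u \<in> annihilator M" "fps_nth u d \<noteq> 0"
    using ex_order[OF rsubD(1)[OF rsub_annihilator[OF M]]] by metis
  then show ?thesis using fil_subset_rsub[OF rsub_annihilator[OF M]] by blast
qed

text \<open>Between \<open>N\<close> and \<open>N + R g\<close> lie the submodules \<open>N + R\<^sub>\<ge>\<^sub>j g\<close>, and consecutive ones differ by
  at most a copy of the residue field.\<close>

lemma torsion_devissage:
  fixes M :: "('k fps, 'n) module"
  assumes M: "module R M" and fg: "finitely_generated R M" and tor: "torsion R M"
    and zero: "P {\<zero>\<^bsub>M\<^esub>}"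
    and step: "\<And>N z. submodule N R M \<Longrightarrow> z \<in> carrier M \<Longrightarrow> z \<notin> N \<Longrightarrow>
      (\<And>r. r \<in> tail 1 \<Longrightarrow> r \<odot>\<^bsub>M\<^esub> z \<in> N) \<Longrightarrow> P N \<Longrightarrow> P (adjoin R M N z)"
  shows "P (carrier M)"
proof (rule fg_induct[OF M fg, where P = P])
  interpret M: module R M by fact
  show "P {\<zero>\<^bsub>M\<^esub>}" by (rule zero)
  obtain s where s: "fil s \<subseteq> annihilator M" using torsion_annihilated[OF M fg tor] by blast
  fix N g assume N: "submodule N R M" and g: "g \<in> carrier M" and PN: "P N"
  note ND = submoduleD[OF M N]
  define L where "L j = {y \<oplus>\<^bsub>M\<^esub> r \<odot>\<^bsub>M\<^esub> g | y r. y \<in> N \<and> r \<in> tail j}" for j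
  note t = ideal_inD[OF ideal_in_tail]
  have L: "submodule (L j) R M" for j
    unfolding submodule_iff[OF M]
  proof (intro conjI ballI)
    show "L j \<subseteq> carrier M" using ND(1) t(3)[of _ j] g unfolding L_def by blast
    show "\<zero>\<^bsub>M\<^esub> \<in> L j" unfolding L_def
      using ND(2) rsubD(1)[OF t(1)[of j]] M.smult_l_null[OF g]
      by (intro CollectI exI[of _ "\<zero>\<^bsub>M\<^esub>"] exI[of _ "0"]) simp
    fix x y assume "x \<in> L j" "y \<in> L j"
    then obtain u v p q where *: "x = u \<oplus>\<^bsub>M\<^esub> p \<odot>\<^bsub>M\<^esub> g" "y = v \<oplus>\<^bsub>M\<^esub> q \<odot>\<^bsub>M\<^esub> g"
      "u \<in> N" "v \<in> N" "p \<in> tail j" "q \<in> tail j" unfolding L_def by blast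
    have "x \<oplus>\<^bsub>M\<^esub> y = (u \<oplus>\<^bsub>M\<^esub> v) \<oplus>\<^bsub>M\<^esub> (p + q) \<odot>\<^bsub>M\<^esub> g"
      using M.smult_l_distr[OF t(3)[OF *(5)] t(3)[OF *(6)] g] * ND(1) t(3)[of _ j] g by (simp add: M.M.a_ac)
    then show "x \<oplus>\<^bsub>M\<^esub> y \<in> L j" unfolding L_def using * ND(3) rsubD(2)[OF t(1)[of j]] by blast
  next
    fix c x assume c: "c \<in> carrier R" and "x \<in> L j"
    then obtain u p where *: "x = u \<oplus>\<^bsub>M\<^esub> p \<odot>\<^bsub>M\<^esub> g" "u \<in> N" "p \<in> tail j" unfolding L_def by blast
    have "c \<odot>\<^bsub>M\<^esub> x = c \<odot>\<^bsub>M\<^esub> u \<oplus>\<^bsub>M\<^esub> (c * p) \<odot>\<^bsub>M\<^esub> g"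
      using M.smult_assoc1[OF c t(3)[OF *(3)] g] * ND(1) t(3)[of _ j] g c by (simp add: M.smult_r_distr)
    then show "c \<odot>\<^bsub>M\<^esub> x \<in> L j" unfolding L_def using * ND(4) c rsubD(3)[OF t(1)[of j]] by blast
  qed
  have anti: "L (Suc j) \<subseteq> L j" for j
  proof -
    have "tail (Suc j) \<subseteq> tail j" using fil_antimono[of j "Suc j"] by (auto simp: tail_def)
    then show ?thesis unfolding L_def by blast
  qed
  have NL: "N \<subseteq> L j" for j
  proof
    fix y assume "y \<in> N"
    then show "y \<in> L j" unfolding L_def using rsubD(1)[OF t(1)[of j]] M.smult_l_null[OF g] ND(1)
      by (intro CollectI exI[of _ y] exI[of _ "0"]) simp
  qed
  have base: "L s = N"
  proof
    show "L s \<subseteq> N"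
    proof
      fix x assume "x \<in> L s"
      then obtain y r where yr: "x = y \<oplus>\<^bsub>M\<^esub> r \<odot>\<^bsub>M\<^esub> g" "y \<in> N" "r \<in> tail s" unfolding L_def by blast
      then have "r \<odot>\<^bsub>M\<^esub> g = \<zero>\<^bsub>M\<^esub>" using s g unfolding tail_def annihilator_def by blast
      then show "x \<in> N" using yr ND(1) by simp
    qed
  qed (rule NL)
  have "P (L j)" if "j \<le> s" for j
    using that
  proof (induction j rule: inc_induct)
    case base
    then show ?case using \<open>L s = N\<close> PN by simp
  next
    case (step j)
    show ?case
    \<comment> \<open>If j is a gap of \<open>H\<close>, no element of \<open>R\<close> has a term
      t^j, so nothing happens. Otherwise the new element is t^j g.\<close>
    proof (cases "j \<in> H")
      case False
      have "L j \<subseteq> L (Suc j)"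
      proof
        fix x assume "x \<in> L j"
        then obtain y r where x: "x = y \<oplus>\<^bsub>M\<^esub> r \<odot>\<^bsub>M\<^esub> g" "y \<in> N" "r \<in> tail j" unfolding L_def by blast
        then have "r \<in> tail (Suc j)" using False by (auto simp: tail_def fil_Suc_iff carrier_R)
        then show "x \<in> L (Suc j)" unfolding L_def using x by blast
      qed
      then have "L j = L (Suc j)" using anti by blast
      then show ?thesis using step.IH by simp
    next
      case True
      let ?z = "fps_X ^ j \<odot>\<^bsub>M\<^esub> g"
      have Xj: "fps_X ^ j \<in> tail j" "fps_X ^ j \<in> carrier R"
        using fps_X_power_fil R_closed(7)[of j] True by (auto simp: tail_def)
      have z: "?z \<in> carrier M" using Xj g by simp
      have m: "r \<odot>\<^bsub>M\<^esub> ?z \<in> L (Suc j)" if r: "r \<in> tail 1" for r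
      proof -
        have "r * fps_X ^ j \<in> tail (Suc j)"
          using r Xj fil_mult[of r 1 "fps_X ^ j" j] R_mult_closed by (auto simp: tail_def)
        moreover have "r \<odot>\<^bsub>M\<^esub> ?z = \<zero>\<^bsub>M\<^esub> \<oplus>\<^bsub>M\<^esub> (r * fps_X ^ j) \<odot>\<^bsub>M\<^esub> g"
          using M.smult_assoc1[OF t(3)[OF r] Xj(2) g] t(3)[OF r] Xj g z by simp
        ultimately show ?thesis unfolding L_def using ND(2) by blast
      qed
      have "adjoin R M (L (Suc j)) ?z = L j"
      proof
        have "?z = \<zero>\<^bsub>M\<^esub> \<oplus>\<^bsub>M\<^esub> ?z" using z by simp
        then have "?z \<in> L j" unfolding L_def using ND(2) Xj by blast
        then show "adjoin R M (L (Suc j)) ?z \<subseteq> L j" by (rule adjoin_least[OF M L anti])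
        show "L j \<subseteq> adjoin R M (L (Suc j)) ?z"
        proof
          fix x assume "x \<in> L j"
          then obtain y r where x: "x = y \<oplus>\<^bsub>M\<^esub> r \<odot>\<^bsub>M\<^esub> g" "y \<in> N" "r \<in> tail j" unfolding L_def by blast
          let ?c = "fps_const (fps_nth r j)"
          have c: "?c \<in> carrier R" by (rule R_closed)
          have r': "r - ?c * fps_X ^ j \<in> tail (Suc j)"
            using x(3) Xj R_closed(4) R_mult_closed c
            by (auto simp: tail_def fil_Suc_iff fps_X_power_nth intro!: fil_closed fil_mult_left)
          have "r \<odot>\<^bsub>M\<^esub> g = (r - ?c * fps_X ^ j) \<odot>\<^bsub>M\<^esub> g \<oplus>\<^bsub>M\<^esub> ?c \<odot>\<^bsub>M\<^esub> ?z"
            using M.smult_l_distr[OF t(3)[OF r'] R_mult_closed[OF c Xj(2)] g] M.smult_assoc1[OF c Xj(2) g] by simp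
          then have "x = (y \<oplus>\<^bsub>M\<^esub> (r - ?c * fps_X ^ j) \<odot>\<^bsub>M\<^esub> g) \<oplus>\<^bsub>M\<^esub> ?c \<odot>\<^bsub>M\<^esub> ?z"
            using x(1) ND(1)[OF x(2)] t(3)[OF r'] c g z by (simp add: M.M.a_assoc)
          moreover have "y \<oplus>\<^bsub>M\<^esub> (r - ?c * fps_X ^ j) \<odot>\<^bsub>M\<^esub> g \<in> L (Suc j)" unfolding L_def using x(2) r' by blast
          ultimately show "x \<in> adjoin R M (L (Suc j)) ?z" unfolding adjoin_def using c by blast
        qed
      qed
      moreover have "P (adjoin R M (L (Suc j)) ?z)"
      \<comment> \<open>The step asks for an element outside the submodule. If t^j g is already
        inside, adjoining it changes nothing.\<close>
      proof (cases "?z \<in> L (Suc j)")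
        case True
        then have "adjoin R M (L (Suc j)) ?z = L (Suc j)"
          using adjoin_least[OF M L order_refl] adjoin(2)[OF M L z] by blast
        then show ?thesis using step.IH by simp
      qed (use assms(5)[OF L z _ m] step.IH in blast)
      ultimately show ?thesis by simp
    qed
  qed
  moreover have "L 0 = adjoin R M N g" by (simp add: L_def adjoin_def tail_def)
  ultimately show "P (adjoin R M N g)" by (metis le0)
qed

text \<open>A strictly monotone function from submodules to natural numbers bounds the length of
  every chain. Such a function is built along the filtration, and no composition series have to be
  compared.\<close>

lemma torsion_finite_length:
  fixes M :: "('k fps, 'n) module"
  assumes M: "module R M" and fg: "finitely_generated R M" and tor: "torsion R M"
  shows "mod_length R M < \<infinity>"
proof -
  interpret M: module R M by fact
  define P where "P N \<longleftrightarrow> (\<exists>l :: 'n set \<Rightarrow> nat. \<forall>U V. submodule U R M \<longrightarrow> submodule V R M \<longrightarrow>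
    V \<subseteq> N \<longrightarrow> U \<subset> V \<longrightarrow> l U < l V)" for N
  have "P (carrier M)"
  proof (rule torsion_devissage[OF M fg tor])
    show "P {\<zero>\<^bsub>M\<^esub>}" unfolding P_def using submoduleD(2)[OF M] by blast
    fix N z assume N: "submodule N R M" and z: "z \<in> carrier M" "z \<notin> N"
      and m: "\<And>r. r \<in> tail 1 \<Longrightarrow> r \<odot>\<^bsub>M\<^esub> z \<in> N" and "P N"
    then obtain l :: "'n set \<Rightarrow> nat" where
      l: "\<And>U V. submodule U R M \<Longrightarrow> submodule V R M \<Longrightarrow> V \<subseteq> N \<Longrightarrow> U \<subset> V \<Longrightarrow> l U < l V"
      unfolding P_def by blast
    note ND = submoduleD[OF M N]
    \<comment> \<open>The step (N + R z)/N is simple, so leaving \<open>N\<close> contributes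
      exactly one to the length.\<close>
    define l' where "l' U = l (U \<inter> N) + (if U \<subseteq> N then 0 else 1 :: nat)" for U
    \<comment> \<open>Modulo \<open>N\<close>, the module N + R z is spanned over the field by
      \<open>z\<close>, because every series without constant term sends \<open>z\<close> into
      \<open>N\<close>.\<close>
    have form: "\<exists>c n. c \<noteq> 0 \<and> n \<in> N \<and> u = fps_const c \<odot>\<^bsub>M\<^esub> z \<oplus>\<^bsub>M\<^esub> n"
      if u: "u \<in> adjoin R M N z" "u \<notin> N" for u
    proof -
      obtain y r where yr: "u = y \<oplus>\<^bsub>M\<^esub> r \<odot>\<^bsub>M\<^esub> z" "y \<in> N" "r \<in> carrier R"
        using u(1) by (auto simp: adjoin_def)
      let ?c = "fps_const (fps_nth r 0)"
      have c: "?c \<in> carrier R" by (rule R_closed)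
      have r': "r - ?c \<in> tail 1" using R_closed(4)[OF yr(3) c] by (auto simp: tail_def fil_def)
      have "r \<odot>\<^bsub>M\<^esub> z = (r - ?c) \<odot>\<^bsub>M\<^esub> z \<oplus>\<^bsub>M\<^esub> ?c \<odot>\<^bsub>M\<^esub> z"
        using M.smult_l_distr[OF ideal_inD(3)[OF ideal_in_tail r'] c z(1)] by simp
      then have eq: "u = ?c \<odot>\<^bsub>M\<^esub> z \<oplus>\<^bsub>M\<^esub> (y \<oplus>\<^bsub>M\<^esub> (r - ?c) \<odot>\<^bsub>M\<^esub> z)"
        using yr(1) ND(1)[OF yr(2)] ND(1)[OF m[OF r']] c z by (simp add: M.M.a_ac)
      have n: "y \<oplus>\<^bsub>M\<^esub> (r - ?c) \<odot>\<^bsub>M\<^esub> z \<in> N" using ND(3)[OF yr(2) m[OF r']] .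
      have "fps_nth r 0 \<noteq> 0"
      proof
        assume "fps_nth r 0 = 0"
        then have "u = y \<oplus>\<^bsub>M\<^esub> (r - ?c) \<odot>\<^bsub>M\<^esub> z" using yr(1) by simp
        then show False using n u(2) by simp
      qed
      then show ?thesis using eq n by blast
    qed
    have mono: "l' U < l' V" if U: "submodule U R M" and V: "submodule V R M" and VB: "V \<subseteq> adjoin R M N z"
      and UV: "U \<subset> V" for U V
    proof (cases "U \<inter> N = V \<inter> N")
      case False
      then have "l (U \<inter> N) < l (V \<inter> N)"
        using l[OF submodule_Int[OF M U N] submodule_Int[OF M V N]] UV by blast
      then show ?thesis using UV by (auto simp: l'_def)
    next
      case True
      note UD = submoduleD[OF M U] and VD = submoduleD[OF M V]
      \<comment> \<open>Suppose \<open>U\<close> contains some u outside \<open>N\<close>. Each v in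
        \<open>V\<close> differs from a multiple of u by an element of V and N, hence of U and N.
        Then \<open>V\<close> would equal \<open>U\<close>.\<close>
      have "U \<subseteq> N"
      proof (rule ccontr)
        assume "\<not> U \<subseteq> N"
        then obtain u where u: "u \<in> U" "u \<notin> N" by blast
        then obtain c n where cn: "c \<noteq> 0" "n \<in> N" "u = fps_const c \<odot>\<^bsub>M\<^esub> z \<oplus>\<^bsub>M\<^esub> n" using form UV VB by blast
        have "v \<in> U" if v: "v \<in> V" for v
        proof (cases "v \<in> N")
          case True
          then show ?thesis using v \<open>U \<inter> N = V \<inter> N\<close> by blast
        next
          case False
          then obtain d k where dk: "k \<in> N" "v = fps_const d \<odot>\<^bsub>M\<^esub> z \<oplus>\<^bsub>M\<^esub> k" using form v VB by blast
          let ?q = "fps_const (d / c)"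
          have q: "?q \<in> carrier R" "fps_const c \<in> carrier R" by (rule R_closed)+
          have zc: "fps_const d \<odot>\<^bsub>M\<^esub> z \<in> carrier M" using R_closed(6) z(1) by blast
          have nk: "n \<in> carrier M" "k \<in> carrier M" "?q \<odot>\<^bsub>M\<^esub> n \<in> N" using ND cn dk q by auto
          have "?q \<odot>\<^bsub>M\<^esub> u = fps_const d \<odot>\<^bsub>M\<^esub> z \<oplus>\<^bsub>M\<^esub> ?q \<odot>\<^bsub>M\<^esub> n"
            using M.smult_assoc1[OF q z(1)] cn q nk z(1) by (simp add: M.smult_r_distr)
          then have "v \<ominus>\<^bsub>M\<^esub> ?q \<odot>\<^bsub>M\<^esub> u = k \<ominus>\<^bsub>M\<^esub> ?q \<odot>\<^bsub>M\<^esub> n"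
            using dk(2) zc nk ND(1)[OF nk(3)] by (simp add: M.add_minus_add_left)
          moreover have "k \<ominus>\<^bsub>M\<^esub> ?q \<odot>\<^bsub>M\<^esub> n \<in> N" using ND(5) dk(1) nk(3) by blast
          moreover have qu: "?q \<odot>\<^bsub>M\<^esub> u \<in> U" using UD(4) q(1) u(1) by blast
          moreover have "v \<ominus>\<^bsub>M\<^esub> ?q \<odot>\<^bsub>M\<^esub> u \<in> V" using VD(5) v qu UV by blast
          ultimately have "v \<ominus>\<^bsub>M\<^esub> ?q \<odot>\<^bsub>M\<^esub> u \<in> U" using True by auto
          then have "(v \<ominus>\<^bsub>M\<^esub> ?q \<odot>\<^bsub>M\<^esub> u) \<oplus>\<^bsub>M\<^esub> ?q \<odot>\<^bsub>M\<^esub> u \<in> U" using UD(3) qu by blast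
          then show "v \<in> U" using VD(1)[OF v] UD(1)[OF qu] by (simp add: a_minus_def M.M.a_assoc M.M.l_neg)
        qed
        then show False using UV by blast
      qed
      moreover have "\<not> V \<subseteq> N" using True UV calculation by blast
      ultimately show ?thesis using True by (simp add: l'_def)
    qed
    show "P (adjoin R M N z)" unfolding P_def using mono by (intro exI[of _ l']) blast
  qed
  then obtain l :: "'n set \<Rightarrow> nat" where
    l: "\<And>U V. submodule U R M \<Longrightarrow> submodule V R M \<Longrightarrow> U \<subset> V \<Longrightarrow> l U < l V"
    unfolding P_def using submoduleD(1)[OF M] by (metis subsetI)
  have "n \<le> l (carrier M)" if N: "\<forall>i\<le>n. submodule (N i) R M" "\<forall>i<n. N i \<subset> N (Suc i)" for n N
  proof -
    have "i \<le> l (N i)" if "i \<le> n" for i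
      using that
    proof (induction i)
      case (Suc i)
      then have "l (N i) < l (N (Suc i))" using l N by simp
      then show ?case using Suc by simp
    qed simp
    then have "n \<le> l (N n)" by simp
    also have "l (N n) \<le> l (carrier M)"
    proof (cases "N n = carrier M")
      case False
      have "N n \<subseteq> carrier M" using submoduleD(1)[OF M, of "N n"] N(1) by blast
      then show ?thesis
        using False l[of "N n" "carrier M"] N(1) submodule_carrier[OF M] by (simp add: less_imp_le psubset_eq)
    qed simp
    finally show ?thesis .
  qed
  then have "mod_length R M \<le> enat (l (carrier M))"
    unfolding mod_length_def by (intro SUP_least) auto
  then show ?thesis by (metis enat_ord_code(4) le_less_trans)
qed

text \<open>An element that no nonzero scalar kills spans a copy of \<open>R\<close>, and
  \<open>R\<close> has strictly descending chains of ideals of any length.\<close>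

lemma finite_length_torsion:
  fixes M :: "('k fps, 'n) module"
  assumes M: "module R M" and fl: "mod_length R M < \<infinity>"
  shows "torsion R M"
proof (rule ccontr)
  assume "\<not> torsion R M"
  then obtain x where x: "x \<in> carrier M" and free: "\<And>r. r \<in> carrier R \<Longrightarrow> r \<noteq> 0 \<Longrightarrow> r \<odot>\<^bsub>M\<^esub> x \<noteq> \<zero>\<^bsub>M\<^esub>"
    by (auto simp: torsion_iff)
  let ?h = "\<lambda>r. r \<odot>\<^bsub>M\<^esub> x"
  have h: "?h \<in> mod_hom R (ideal_module R (carrier R)) M" by (rule smult_hom[OF M x])
  have inj: "inj_on ?h (carrier R)" using mod_hom_inj_iff[OF module_R M h] free by auto
  have "enat n \<le> mod_length R M" for n
    unfolding mod_length_def
  \<comment> \<open>The descending ideals are indexed backwards, since length counts ascending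
    chains. Multiples of \<open>a\<close> are used because they lie in \<open>H\<close>: at each
    step t^j with j = (n - Suc i) a is a new element.\<close>
  proof (rule SUP_upper, intro CollectI exI[of _ "\<lambda>i. ?h ` tail ((n - i) * a)"] conjI allI impI)
    show "submodule (?h ` tail ((n - i) * a)) R M" for i
      by (rule submodule_image[OF module_R M h ideal_inD(2)[OF ideal_in_tail]])
    fix i assume "i < n"
    then have eq: "(n - i) * a = a + (n - Suc i) * a" by (metis Suc_diff_Suc mult_Suc)
    define j where "j = (n - Suc i) * a"
    have "m * a \<in> H" for m by (induction m) (auto simp: H_zero H_add a_in_H)
    then have "j \<in> H" unfolding j_def .
    then have "fps_X ^ j \<in> tail j" "fps_X ^ j \<notin> tail (a + j)"
      using R_closed(7) fps_X_power_fil a_pos by (auto simp: tail_def fil_def fps_X_power_nth)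
    moreover have "tail (a + j) \<subseteq> tail j" using fil_antimono[of j "a + j"] by (auto simp: tail_def)
    ultimately have "tail (a + j) \<subset> tail j" by blast
    moreover have "tail j \<subseteq> carrier R" by (auto simp: tail_def)
    ultimately have "?h ` tail (a + j) \<subset> ?h ` tail j" 
      using inj by (intro image_strict_mono) (auto intro: inj_on_subset)
    then show "?h ` tail ((n - i) * a) \<subset> ?h ` tail ((n - Suc i) * a)" by (simp add: eq j_def)
  qed
  moreover obtain m where "mod_length R M = enat m" using fl by (cases "mod_length R M") auto
  ultimately have "enat (Suc m) \<le> enat m" by metis
  then show False by simp
qed

lemma fl_modules_iff: "M \<in> fl_modules R \<longleftrightarrow> M \<in> fg_modules R \<and> torsion R M"
  using torsion_finite_length finite_length_torsion by (auto simp: fl_modules_def fg_modules_iff)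

end

section \<open>Generating the torsion and the torsionfree modules\<close>

context thick_numerical
begin

lemma has_copy_torsion:
  fixes M :: "('k fps, 'n) module"
  assumes k: "has_copy R X (rquot (tail 1))"
    and M: "module R M" and fg: "finitely_generated R M" and tor: "torsion R M"
  shows "has_copy R X M"
proof -
  have "has_copy R X (M\<lparr>carrier := carrier M\<rparr>)"
  proof (rule torsion_devissage[OF M fg tor])
    show "has_copy R X (M\<lparr>carrier := {\<zero>\<^bsub>M\<^esub>}\<rparr>)"
      by (rule has_copy_zero[OF module_submodule[OF M submodule_zero[OF M]]]) simp
    fix N z assume N: "submodule N R M" and z: "z \<in> carrier M" "z \<notin> N"
      and m: "\<And>r. r \<in> tail 1 \<Longrightarrow> r \<odot>\<^bsub>M\<^esub> z \<in> N" and copy: "has_copy R X (M\<lparr>carrier := N\<rparr>)"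
    let ?B = "adjoin R M N z"
    note B = adjoin[OF M N z(1)]
    obtain f where f: "f \<in> mod_hom R (M\<lparr>carrier := ?B\<rparr>) (rquot (tail 1))"
      "f ` ?B = carrier (rquot (tail 1))" "\<And>x. x \<in> ?B \<Longrightarrow> f x = \<zero>\<^bsub>rquot (tail 1)\<^esub> \<longleftrightarrow> x \<in> N"
      using residue_field_quotient[OF M N z m] by blast
    have "submodule N R (M\<lparr>carrier := ?B\<rparr>)" using N B(2) by (simp add: submodule_submodule_iff[OF M B(1)])
    then show "has_copy R X (M\<lparr>carrier := ?B\<rparr>)"
      by (rule has_copy_extension[OF sub ext module_submodule[OF M B(1)] module_rquot[OF ideal_in_tail] _ f(1)])
        (use f copy k in simp_all)
  qed
  then show ?thesis by simp
qed

text \<open>The filtration consists of the pure closures of the submodules N, so that its quotients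
  are torsionfree of rank at most one and hence embed into \<open>R\<close>. It starts at zero
  because \<open>M\<close> is torsionfree.\<close>

lemma has_copy_torsionfree:
  fixes M :: "('k fps, 'n) module"
  assumes S: "has_copy R X (ideal_module R (fil c))"
    and M: "module R M" and fg: "finitely_generated R M" and tf: "torsionfree R M"
  shows "has_copy R X M"
proof -
  note pc = pure_closure[OF domain_R M]
  have "has_copy R X (M\<lparr>carrier := pure_closure R M (carrier M)\<rparr>)"
  proof (rule fg_induct[OF M fg])
    have "pure_closure R M {\<zero>\<^bsub>M\<^esub>} = {\<zero>\<^bsub>M\<^esub>}" using tf torsionfree_iff[OF domain_R M] by simp
    then show "has_copy R X (M\<lparr>carrier := pure_closure R M {\<zero>\<^bsub>M\<^esub>}\<rparr>)"
      using has_copy_zero[OF module_submodule[OF M submodule_zero[OF M]]] by simp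
    fix N g assume N: "submodule N R M" and g: "g \<in> carrier M"
      and copy: "has_copy R X (M\<lparr>carrier := pure_closure R M N\<rparr>)"
    let ?N = "pure_closure R M N"
    let ?P = "pure_closure R M (adjoin R M ?N g)"
    note A' = adjoin[OF M pc(1)[OF N] g]
    have "has_copy R X (M\<lparr>carrier := ?P\<rparr>)"
    proof (cases "g \<in> ?N")
      case True
      then have "adjoin R M ?N g = ?N" using adjoin_least[OF M pc(1)[OF N] order_refl] A'(2) by blast
      then show ?thesis using copy pc(3)[OF N] by simp
    next
      case False
      have P: "submodule ?P R M" by (rule pc(1)[OF A'(1)])
      have Pm: "module R (M\<lparr>carrier := ?P\<rparr>)" by (rule module_submodule[OF M P])
      obtain h where h: "h \<in> mod_hom R (M\<lparr>carrier := ?P\<rparr>) (ideal_module R (carrier R))"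
        and ker: "\<And>x. x \<in> ?P \<Longrightarrow> h x = 0 \<longleftrightarrow> x \<in> ?N"
        using rank_one_quotient[OF domain_R M pc(1)[OF N] pc(3)[OF N] g False fg_submodule[OF M fg P]] by auto
      let ?I = "h ` ?P"
      have I: "rsub ?I"
        using submodule_image[OF Pm module_R h submodule_carrier[OF Pm]] by (simp add: submodule_ideal_iff[OF rsub_R])
      have h': "h \<in> mod_hom R (M\<lparr>carrier := ?P\<rparr>) (ideal_module R ?I)"
        using mod_hom_cod[OF h, of ?I] by simp
      have "?N \<subseteq> ?P" using A'(2) pc(2)[OF A'(1)] by blast
      then have "submodule ?N R (M\<lparr>carrier := ?P\<rparr>)"
        using pc(1)[OF N] by (simp add: submodule_submodule_iff[OF M P])
      then show ?thesis
        by (rule has_copy_extension[OF sub ext Pm module_ideal[OF I] _ h'])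
          (use ker copy has_copy_ideal[OF S I] in simp_all)
    qed
    then show "has_copy R X (M\<lparr>carrier := pure_closure R M (adjoin R M N g)\<rparr>)" 
      by (simp only: pure_closure_adjoin[OF domain_R M N g])
  qed
  moreover have "pure_closure R M (carrier M) = carrier M"
    using pc(1,2)[OF submodule_carrier[OF M]] submoduleD(1)[OF M] by blast
  ultimately show ?thesis by simp
qed

end

context numerical_ring
begin

text \<open>Follow the filtration by pure closures. A generator that enlarges the pure closure gives
  a map to \<open>R\<close> that does not kill it, and a generator that does not enlarge it leaves
  the previous map in place.\<close>

lemma ex_nonzero_functional:
  fixes M :: "('k fps, 'n) module"
  assumes M: "module R M" and fg: "finitely_generated R M" and tf: "torsionfree R M"
    and nz: "carrier M \<noteq> {\<zero>\<^bsub>M\<^esub>}"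
  shows "\<exists>h\<in>mod_hom R M (ideal_module R (carrier R)). \<exists>x\<in>carrier M. h x \<noteq> 0"
proof -
  note pc = pure_closure[OF domain_R M]
  define P where "P N \<longleftrightarrow> pure_closure R M N = {\<zero>\<^bsub>M\<^esub>} \<or>
    (\<exists>h\<in>mod_hom R (M\<lparr>carrier := pure_closure R M N\<rparr>) (ideal_module R (carrier R)).
      \<exists>x\<in>pure_closure R M N. h x \<noteq> 0)" for N
  have "P (carrier M)"
  proof (rule fg_induct[OF M fg])
    show "P {\<zero>\<^bsub>M\<^esub>}" using tf torsionfree_iff[OF domain_R M] by (simp add: P_def)
    fix N g assume N: "submodule N R M" and g: "g \<in> carrier M" and "P N"
    let ?N = "pure_closure R M N"
    let ?P = "pure_closure R M (adjoin R M ?N g)"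
    note A' = adjoin[OF M pc(1)[OF N] g]
    note PP = pure_closure_adjoin[OF domain_R M N g]
    show "P (adjoin R M N g)"
    proof (cases "g \<in> ?N")
      case True
      then have "adjoin R M ?N g = ?N" using adjoin_least[OF M pc(1)[OF N] order_refl] A'(2) by blast
      then have "pure_closure R M (adjoin R M N g) = ?N" using PP pc(3)[OF N] by simp
      then show ?thesis using \<open>P N\<close> by (simp add: P_def)
    next
      case False
      have P: "submodule ?P R M" by (rule pc(1)[OF A'(1)])
      show ?thesis
        using rank_one_quotient[OF domain_R M pc(1)[OF N] pc(3)[OF N] g False fg_submodule[OF M fg P]] False
        unfolding P_def PP by auto
    qed
  qed
  moreover have "pure_closure R M (carrier M) = carrier M"
    using pc(1,2)[OF submodule_carrier[OF M]] submoduleD(1)[OF M] by blast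
  ultimately show ?thesis using nz by (simp add: P_def)
qed

end

section \<open>IKE-closed subcategories\<close>

lemma smult_endo:
  assumes "module R M" "r \<in> carrier R"
  shows "(\<lambda>x. r \<odot>\<^bsub>M\<^esub> x) \<in> mod_hom R M M"
proof -
  interpret M: module R M by fact
  show ?thesis
    using assms(2) by (auto intro!: mod_homI simp: M.smult_r_distr M.smult_assoc1[symmetric] M.R.m_comm)
qed

context numerical_ring
begin

text \<open>A module killed by the maximal ideal is a vector space over the residue field. A
  generator outside the span of the earlier ones yields a nonzero functional.\<close>

lemma ex_residue_field_map:
  fixes V :: "('k fps, 'n) module"
  assumes V: "module R V" and fg: "finitely_generated R V" and nz: "carrier V \<noteq> {\<zero>\<^bsub>V\<^esub>}"
    and m: "\<And>r x. r \<in> tail 1 \<Longrightarrow> x \<in> carrier V \<Longrightarrow> r \<odot>\<^bsub>V\<^esub> x = \<zero>\<^bsub>V\<^esub>"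
  shows "\<exists>f\<in>mod_hom R V (rquot (tail 1)). f ` carrier V = carrier (rquot (tail 1))"
proof -
  let ?K = "rquot (tail 1)"
  define P where "P N \<longleftrightarrow> N = {\<zero>\<^bsub>V\<^esub>} \<or> (\<exists>f\<in>mod_hom R (V\<lparr>carrier := N\<rparr>) ?K. f ` N = carrier ?K)" for N
  have "P (carrier V)"
  proof (rule fg_induct[OF V fg, where P = P])
    fix N g assume N: "submodule N R V" and g: "g \<in> carrier V" and "P N"
    show "P (adjoin R V N g)"
    proof (cases "g \<in> N")
      case True
      then have "adjoin R V N g = N" using adjoin_least[OF V N order_refl] adjoin(2)[OF V N g] by blast
      then show ?thesis using \<open>P N\<close> by simp
    next
      case False
      have "r \<odot>\<^bsub>V\<^esub> g \<in> N" if "r \<in> tail 1" for r using m[OF that g] submoduleD(2)[OF V N] by simp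
      then show ?thesis using residue_field_quotient[OF V N g False] unfolding P_def by blast
    qed
  qed (simp add: P_def)
  then show ?thesis using nz by (simp add: P_def)
qed

text \<open>Let h be the largest exponent in \<open>H\<close> such that t^h does not kill
  \<open>L\<close>. Then V = t^h L is nonzero, and the maximal ideal kills it because all of
  \<open>R\<^sub>>\<^sub>h\<close> kills \<open>L\<close>. The residue field is the image of a
  composite V -> R/m -> V.\<close>

lemma IKE_residue_field:
  fixes X :: "('k fps, 'm) module set" and L :: "('k fps, 'n) module"
  assumes X: "IKE_closed R X" and L: "module R L" and copy: "has_copy R X L"
    and tor: "torsion R L" and nz: "carrier L \<noteq> {\<zero>\<^bsub>L\<^esub>}"
  shows "has_copy R X (rquot (tail 1))"
proof -
  interpret L: module R L by fact
  have sub: "subcategory R X" using X by (simp add: IKE_closed_def)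
  have fg: "finitely_generated R L" by (rule has_copy_fg[OF sub copy L])
  obtain s where s: "fil s \<subseteq> annihilator L" using torsion_annihilated[OF L fg tor] by blast
  define P where "P h \<longleftrightarrow> h \<in> H \<and> fps_X ^ h \<notin> annihilator L" for h
  have "P 0" using nz L.smult_one L.M.zero_closed H_zero unfolding P_def annihilator_def
    by (auto simp: R_closed)
  moreover have "\<forall>h. P h \<longrightarrow> h \<le> s"
  proof (intro allI impI)
    fix h assume "P h"
    then have "(fps_X ^ h :: 'k fps) \<notin> fil s" using s by (auto simp: P_def)
    then have "\<not> s \<le> h" using fps_X_power_fil[of h] fil_antimono by blast
    then show "h \<le> s" by simp
  qed
  ultimately have "\<exists>h. P h \<and> (\<forall>n. P n \<longrightarrow> n \<le> h)" by (rule Nat.ex_has_greatest_nat)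
  then obtain h where h: "P h" "\<And>n. P n \<Longrightarrow> n \<le> h" by blast
  have XR: "fps_X ^ h \<in> carrier R" using h(1) R_closed(7) by (simp add: P_def)
  have subI: "rsub (tail (Suc h))" by (rule ideal_inD(1)[OF ideal_in_tail])
  \<comment> \<open>An order j that occurs in this ideal is an element of \<open>H\<close> above h,
    so t^j kills \<open>L\<close> by the choice of h. From order s on everything kills
    \<open>L\<close>, and elimination fills in the rest.\<close>
  have "tail (Suc h) \<subseteq> tail (Suc h) \<inter> annihilator L"
  proof (rule rsub_subset_by_orders[OF subI rsub_Int[OF subI rsub_annihilator[OF L]], of s])
    show "tail (Suc h) \<inter> fil s \<subseteq> tail (Suc h) \<inter> annihilator L" using s by blast
    fix j f assume f: "f \<in> tail (Suc h)" "fps_nth f j \<noteq> 0"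
    then have j: "j \<in> H" "\<not> j < Suc h" using filD[of f "Suc h" j] by (auto simp: tail_def carrier_R)
    then have "fps_X ^ j \<in> annihilator L" using h(2)[of j] by (auto simp: P_def)
    moreover have "(fps_X ^ j :: 'k fps) \<in> fil (Suc h)" using fps_X_power_fil[of j] fil_antimono[of "Suc h" j] j(2) by auto
    then have "fps_X ^ j \<in> tail (Suc h)" using R_closed(7)[OF j(1)] by (simp add: tail_def)
    ultimately show "\<exists>g\<in>tail (Suc h) \<inter> annihilator L. g \<in> fil j \<and> fps_nth g j \<noteq> 0"
      using fps_X_power_fil[of j] by (intro bexI[of _ "fps_X ^ j"]) (auto simp: fps_X_power_nth)
  qed auto
  then have kill: "tail (Suc h) \<subseteq> annihilator L" by blast
  let ?s = "\<lambda>x. fps_X ^ h \<odot>\<^bsub>L\<^esub> x"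
  have endo: "?s \<in> mod_hom R L L" by (rule smult_endo[OF L XR])
  define V where "V = L\<lparr>carrier := ?s ` carrier L\<rparr>"
  have subV: "submodule (?s ` carrier L) R L" by (rule submodule_image[OF L L endo submodule_carrier[OF L]])
  have V: "module R V" unfolding V_def by (rule module_submodule[OF L subV])
  have copyV: "has_copy R X V" unfolding V_def by (rule has_copy_image[OF X L L copy copy endo])
  obtain v where v: "v \<in> carrier V" "v \<noteq> \<zero>\<^bsub>V\<^esub>"
    using h(1) XR by (auto simp: P_def annihilator_def V_def)
  have m: "r \<odot>\<^bsub>V\<^esub> x = \<zero>\<^bsub>V\<^esub>" if rx: "r \<in> tail 1" "x \<in> carrier V" for r x
  proof -
    obtain y where y: "y \<in> carrier L" "x = ?s y" using rx(2) by (auto simp: V_def)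
    have r: "r \<in> carrier R" using ideal_inD(3)[OF ideal_in_tail rx(1)] .
    have "r * fps_X ^ h \<in> tail (Suc h)"
      using rx(1) fil_mult[of r 1 "fps_X ^ h" h] fps_X_power_fil R_mult_closed[OF r XR] by (auto simp: tail_def)
    then have "(r * fps_X ^ h) \<odot>\<^bsub>L\<^esub> y = \<zero>\<^bsub>L\<^esub>" using kill y(1) by (auto simp: annihilator_def)
    then show ?thesis using L.smult_assoc1[OF r XR y(1)] y(2) by (simp add: V_def)
  qed
  let ?K = "rquot (tail 1)"
  have K: "module R ?K" by (rule module_rquot[OF ideal_in_tail])
  have "carrier V \<noteq> {\<zero>\<^bsub>V\<^esub>}" using v by blast
  then obtain f where f: "f \<in> mod_hom R V ?K" "f ` carrier V = carrier ?K"
    using ex_residue_field_map[OF V has_copy_fg[OF sub copyV V]] m by blast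
  \<comment> \<open>The embedding of the residue field that sends 1 to a nonzero \<open>v\<close>;
    composed with \<open>f\<close> it becomes an endomorphism of \<open>V\<close>.\<close>
  define j where "j = (\<lambda>r. r \<odot>\<^bsub>V\<^esub> v)"
  have jR: "j \<in> mod_hom R (ideal_module R (carrier R)) V" unfolding j_def by (rule smult_hom[OF V v(1)])
  have j: "j \<in> mod_hom R ?K V" "\<And>r. r \<in> carrier R \<Longrightarrow> j (rep (tail 1) r) = j r"
    using quot_hom[OF module_R ideal_inD(2)[OF ideal_in_tail] V jR, of 1] m[OF _ v(1)] by (auto simp: j_def)
  have "inj_on j (carrier ?K)"
    unfolding mod_hom_inj_iff[OF K V j(1)]
  proof (intro ballI impI)
    fix q assume "q \<in> carrier ?K" "j q = \<zero>\<^bsub>V\<^esub>"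
    then obtain r where r: "r \<in> carrier R" "q = rep (tail 1) r" "r \<odot>\<^bsub>V\<^esub> v = \<zero>\<^bsub>V\<^esub>"
      using j(2) unfolding j_def rquot_carrier by auto
    have "r \<in> tail 1"
      by (rule residue_kernel[OF V submodule_zero[OF V] v(1) _ _ r(1)]) (use v r m in auto)
    then show "q = \<zero>\<^bsub>?K\<^esub>" using rep_zero_iff[OF ideal_in_tail r(1)] r(2) by simp
  qed
  then have "mod_iso R (V\<lparr>carrier := j ` carrier ?K\<rparr>) ?K"
    by (intro mod_iso_sym[OF K] mod_iso_image[OF K V j(1)])
  moreover have "has_copy R X (V\<lparr>carrier := j ` carrier ?K\<rparr>)"
    using has_copy_image[OF X V V copyV copyV mod_hom_comp[OF f(1) j(1)]] by (simp only: image_comp[symmetric] f(2))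
  ultimately show ?thesis by (rule has_copy_iso[rotated])
qed

text \<open>I + J is the image of addition from the direct sum of \<open>I\<close> and
  \<open>J\<close>. Image closure needs the target in the subcategory as well, hence the ambient
  \<open>K\<close>.\<close>

lemma IKE_add:
  fixes X :: "('k fps, 'm) module set"
  assumes X: "IKE_closed R X" and I: "rsub I" and J: "rsub J" and K: "rsub K"
    and copies: "has_copy R X (ideal_module R I)" "has_copy R X (ideal_module R J)" "has_copy R X (ideal_module R K)"
    and "I \<subseteq> K" "J \<subseteq> K"
  shows "has_copy R X (ideal_module R ((\<lambda>(x, y). x + y) ` (I \<times> J)))"
proof -
  have X': "subcategory R X" "extension_closed R X" using X by (auto simp: IKE_closed_def)
  let ?D = "direct_sum (ideal_module R I) (ideal_module R J)"
  show ?thesis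
    using has_copy_image[OF X module_direct_sum[OF module_ideal[OF I] module_ideal[OF J]] module_ideal[OF K]
        has_copy_direct_sum[OF X' module_ideal[OF I] module_ideal[OF J] copies(1,2)] copies(3)
        add_hom[OF assms(8,9) K]] by simp
qed

text \<open>If \<open>d\<close> is the least order of an element of \<open>I\<close>, then \<open>\<cc> I = t\<^sup>e\<^sup>+\<^sup>d S\<close> is a finite sum of
  copies \<open>t\<^sup>e\<^sup>+\<^sup>i I\<close> of \<open>I\<close> inside \<open>I\<close>.\<close>

lemma IKE_ideal_S:
  fixes X :: "('k fps, 'm) module set"
  assumes X: "IKE_closed R X" and I: "rsub I" "I \<noteq> {0}" and copy: "has_copy R X (ideal_module R I)"
  shows "\<exists>c. has_copy R X (ideal_module R (fil c))"
proof -
  interpret X: thick_subcategory R embed fps_unpair X by (rule IKE_thick[OF X])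
  obtain d u where du: "I \<subseteq> fil d" "u \<in> I" "fps_nth u d \<noteq> 0"
    using ex_order[OF rsubD(1)[OF I(1)] I(2)] by metis
  have XI: "fps_X ^ (e + i) * f \<in> I" if "f \<in> I" for f i
    using rsubD(3)[OF I(1) _ that] R_closed(7)[OF H_conductor] by simp
  have scaled: "rsub ((*) (fps_X ^ (e + i)) ` I)" "has_copy R X (ideal_module R ((*) (fps_X ^ (e + i)) ` I))" for i
  proof -
    show "has_copy R X (ideal_module R ((*) (fps_X ^ (e + i)) ` I))"
      by (rule has_copy_iso[OF copy mod_iso_scale[OF I(1)]]) simp
    have "(*) (fps_X ^ (e + i)) \<in> mod_hom R (ideal_module R I) (ideal_module R UNIV)"
      by (auto intro!: mod_homI simp: algebra_simps)
    then show "rsub ((*) (fps_X ^ (e + i)) ` I)"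
      using submodule_image[OF module_ideal[OF I(1)] module_S] submodule_carrier[OF module_ideal[OF I(1)]]
      by fastforce
  qed
  \<comment> \<open>Partial sums of the shifted copies of \<open>I\<close>. They stay inside
    \<open>I\<close> because \<open>IKE_add\<close> needs a target that is known to belong to
    \<open>X\<close>.\<close>
  have chain: "\<exists>J. rsub J \<and> J \<subseteq> I \<inter> fil (e + d) \<and> has_copy R X (ideal_module R J) \<and>
    (\<forall>i<n. (*) (fps_X ^ (e + i)) ` I \<subseteq> J)" for n
  proof (induction n)
    case 0
    have z: "rsub {0}" by (simp add: rsub_iff)
    then show ?case using X.has_copy_zero[OF module_ideal[OF z]] rsubD(1)[OF I(1)]
      by (intro exI[of _ "{0}"]) (simp add: fil_closed)
  next
    case (Suc n)
    then obtain J where J: "rsub J" "J \<subseteq> I \<inter> fil (e + d)" "has_copy R X (ideal_module R J)"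
      "\<forall>i<n. (*) (fps_X ^ (e + i)) ` I \<subseteq> J" by blast
    let ?T = "(*) (fps_X ^ (e + n)) ` I"
    let ?J = "(\<lambda>(x, y). x + y) ` (J \<times> ?T)"
    have "?T \<subseteq> fil (e + d)"
    proof
      fix y assume "y \<in> ?T"
      then obtain f where "f \<in> fil d" "y = fps_X ^ (e + n) * f" using du(1) by auto
      then have "y \<in> fil (e + n + d)" using fil_mult[OF fps_X_power_fil] by blast
      then show "y \<in> fil (e + d)" using fil_antimono[of "e + d" "e + n + d"] by auto
    qed
    then have T: "?T \<subseteq> I \<inter> fil (e + d)" using XI by auto
    have sub: "J \<subseteq> I" "?T \<subseteq> I" using J(2) T by blast+
    have "has_copy R X (ideal_module R ?J)"
      using IKE_add[OF X J(1) scaled(1) I(1) J(3) scaled(2) copy sub] .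
    moreover have "rsub ?J"
      using submodule_image[OF module_direct_sum[OF module_ideal[OF J(1)] module_ideal[OF scaled(1)]] module_S
          add_hom[of J UNIV ?T]] submodule_carrier[OF module_direct_sum[OF module_ideal[OF J(1)] module_ideal[OF scaled(1)]]]
        rsub_fil[of 0] by simp
    moreover have "?J \<subseteq> I \<inter> fil (e + d)"
    proof
      fix z assume "z \<in> ?J"
      then obtain x y where "z = x + y" "x \<in> J" "y \<in> ?T" by (elim imageE) (auto simp del: image_iff)
      then show "z \<in> I \<inter> fil (e + d)"
        using subsetD[OF J(2)] subsetD[OF T] rsubD(2)[OF rsub_Int[OF I(1) rsub_fil[of "e + d"]]] by metis
    qed
    moreover have JJ: "J \<subseteq> ?J" "?T \<subseteq> ?J"
      using rsubD(1)[OF scaled(1)[of n]] rsubD(1)[OF J(1)] by force+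
    moreover have "(*) (fps_X ^ (e + i)) ` I \<subseteq> ?J" if "i < Suc n" for i
      using that J(4) JJ by (cases "i = n") (auto simp: less_Suc_eq intro: order_trans)
    ultimately show ?case by blast
  qed
  \<comment> \<open>The shifts with i < e reach all orders from e + d up to, but not including, e +
    d + e; beyond that, \<open>fil_subset_rsub\<close> applies to the element for i = 0. Taking
    \<open>Suc e\<close> shifts keeps that element available when e = 0.\<close>
  obtain J where J: "rsub J" "J \<subseteq> I \<inter> fil (e + d)" "has_copy R X (ideal_module R J)"
    "\<forall>i<Suc e. (*) (fps_X ^ (e + i)) ` I \<subseteq> J" using chain[of "Suc e"] by blast
  have J2: "J \<subseteq> fil (e + d)" using J(2) by simp
  have Xu: "fps_X ^ (e + i) * u \<in> J" if "i < Suc e" for i using J(4) that du(2) by blast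
  have ord: "fps_X ^ (e + i) * u \<in> fil (e + i + d)" "fps_nth (fps_X ^ (e + i) * u) (e + i + d) \<noteq> 0" for i
    using fil_mult[OF fps_X_power_fil, of u d "e + i"] du fps_X_power_mult_nth[of "e + i" u "e + i + d"] by auto
  have "fil (e + d) \<subseteq> J"
  proof (rule rsub_subset_by_orders[OF rsub_fil J(1) J2, of "e + d + e"])
    show "fil (e + d) \<inter> fil (e + d + e) \<subseteq> J"
      using fil_subset_rsub[OF J(1) Xu[of 0], of "e + d"] ord[of 0] by auto
    fix j f assume j: "j < e + d + e" "f \<in> fil (e + d)" "fps_nth f j \<noteq> 0"
    then have "\<not> j < e + d" using filD by blast
    then have "j = e + (j - e - d) + d" "j - e - d < Suc e" using j(1) by auto
    then show "\<exists>g\<in>J. g \<in> fil j \<and> fps_nth g j \<noteq> 0" using Xu ord by metis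
  qed
  then have "J = fil (e + d)" using J2 by blast
  then show ?thesis using J(3) by blast
qed

text \<open>Choose a nonzero r that kills the torsion of \<open>M\<close>. Then r M is torsionfree:
  from s r x = 0 with s nonzero it follows that x is torsion, hence r x = 0. It is nonzero because
  \<open>M\<close> is not torsion.\<close>

lemma IKE_nontorsion:
  fixes X :: "('k fps, 'm) module set"
  assumes X: "IKE_closed R X" and M: "M \<in> X" and nt: "\<not> torsion R M"
  shows "\<exists>c. has_copy R X (ideal_module R (fil c))"
proof -
  have sub: "subcategory R X" using X by (simp add: IKE_closed_def)
  have Mm: "module R M" and fg: "finitely_generated R M" using subcategoryD(1,2)[OF sub M] .
  interpret M: module R M by fact
  let ?T = "pure_closure R M {\<zero>\<^bsub>M\<^esub>}"
  have T: "submodule ?T R M" by (rule pure_closure(1)[OF domain_R Mm submodule_zero[OF Mm]])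
  have Tm: "module R (M\<lparr>carrier := ?T\<rparr>)" by (rule module_submodule[OF Mm T])
  have "pure_closure R (M\<lparr>carrier := ?T\<rparr>) {\<zero>\<^bsub>M\<^esub>} = ?T" by (auto simp: pure_closure_def)
  then obtain r where r: "r \<in> carrier R" "r \<noteq> 0" "\<And>x. x \<in> ?T \<Longrightarrow> r \<odot>\<^bsub>M\<^esub> x = \<zero>\<^bsub>M\<^esub>"
    using common_denominator[OF domain_R Tm fg_submodule[OF Mm fg T] submodule_zero[OF Tm]] by auto
  let ?s = "\<lambda>x. r \<odot>\<^bsub>M\<^esub> x"
  have endo: "?s \<in> mod_hom R M M" by (rule smult_endo[OF Mm r(1)])
  define L where "L = M\<lparr>carrier := ?s ` carrier M\<rparr>"
  have subL: "submodule (?s ` carrier M) R M" by (rule submodule_image[OF Mm Mm endo submodule_carrier[OF Mm]])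
  have L: "module R L" unfolding L_def by (rule module_submodule[OF Mm subL])
  interpret L: module R L by (rule L)
  have copyL: "has_copy R X L"
    unfolding L_def by (rule has_copy_image[OF X Mm Mm has_copyI[OF M] has_copyI[OF M] endo])
  have tf: "torsionfree R L"
    unfolding torsionfree_def
  proof (intro ballI impI)
    fix s y assume s: "s \<in> carrier R" and y: "y \<in> carrier L" and 0: "s \<noteq> \<zero>\<^bsub>R\<^esub> \<and> s \<odot>\<^bsub>L\<^esub> y = \<zero>\<^bsub>L\<^esub>"
    obtain x where x: "x \<in> carrier M" "y = r \<odot>\<^bsub>M\<^esub> x" using y by (auto simp: L_def)
    have "(s * r) \<odot>\<^bsub>M\<^esub> x = \<zero>\<^bsub>M\<^esub>" using M.smult_assoc1[OF s r(1) x(1)] x(2) 0 by (simp add: L_def)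
    moreover have "s * r \<noteq> 0" "s * r \<in> carrier R" using 0 r R_mult_closed[OF s r(1)] by auto
    ultimately have "x \<in> ?T" using x(1) unfolding pure_closure_def by (auto intro!: bexI[of _ "s * r"])
    then show "y = \<zero>\<^bsub>L\<^esub>" using r(3) x(2) by (simp add: L_def)
  qed
  obtain x where x: "x \<in> carrier M" "\<And>s. s \<in> carrier R \<Longrightarrow> s \<noteq> 0 \<Longrightarrow> s \<odot>\<^bsub>M\<^esub> x \<noteq> \<zero>\<^bsub>M\<^esub>"
    using nt by (auto simp: torsion_iff)
  define y where "y = r \<odot>\<^bsub>M\<^esub> x"
  have y: "y \<in> carrier L" "y \<noteq> \<zero>\<^bsub>L\<^esub>" using x r by (auto simp: y_def L_def)
  then have "carrier L \<noteq> {\<zero>\<^bsub>L\<^esub>}" by blast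
  then obtain h z where h: "h \<in> mod_hom R L (ideal_module R (carrier R))" and z: "z \<in> carrier L" "h z \<noteq> 0"
    using ex_nonzero_functional[OF L has_copy_fg[OF sub copyL L] tf] by blast
  let ?I = "h ` carrier L"
  have I: "rsub ?I" "?I \<subseteq> carrier R"
    using submodule_image[OF L module_R h submodule_carrier[OF L]] by (simp_all add: submodule_ideal_iff[OF rsub_R])
  \<comment> \<open>As \<open>L\<close> is torsionfree and \<open>y\<close> is nonzero, 1 |-> y
    embeds \<open>R\<close> into \<open>L\<close>. This turns the functional \<open>h\<close> into
    an endomorphism of \<open>L\<close> whose image is a copy of the ideal
    \<open>?I\<close>.\<close>
  let ?j = "\<lambda>s. s \<odot>\<^bsub>L\<^esub> y"
  have j: "?j \<in> mod_hom R (ideal_module R (carrier R)) L" by (rule smult_hom[OF L y(1)])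
  have "inj_on ?j (carrier R)"
    using mod_hom_inj_iff[OF module_R L j] tf y by (auto simp: torsionfree_def)
  then have inj: "inj_on ?j ?I" using I(2) inj_on_subset by blast
  have jI: "?j \<in> mod_hom R (ideal_module R ?I) L" using mod_hom_dom[OF j, of ?I] I(2) by simp
  have "mod_iso R (ideal_module R ?I) (L\<lparr>carrier := ?j ` ?I\<rparr>)"
    using mod_iso_image[OF module_ideal[OF I(1)] L jI] inj by simp
  then have "mod_iso R (L\<lparr>carrier := ?j ` ?I\<rparr>) (ideal_module R ?I)"
    by (rule mod_iso_sym[OF module_ideal[OF I(1)]])
  moreover have "has_copy R X (L\<lparr>carrier := ?j ` ?I\<rparr>)"
    using has_copy_image[OF X L L copyL copyL mod_hom_comp[OF h j]] by (simp only: image_comp)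
  ultimately have "has_copy R X (ideal_module R ?I)" by (rule has_copy_iso[rotated])
  moreover have "?I \<noteq> {0}" using z by blast
  ultimately show ?thesis using IKE_ideal_S[OF X I(1)] by blast
qed

text \<open>One module with nonzero torsion forces all of \<open>fl_modules\<close> into
  \<open>X\<close>, and one nontorsion module forces all of \<open>tf_modules\<close>. The answers
  to these two questions give the four cases.\<close>

lemma IKE_cases:
  fixes X :: "('k fps, 'm) module set"
  assumes X: "IKE_closed R X"
  shows "X \<in> {zero_modules R, fl_modules R, tf_modules R, fg_modules R}"
proof -
  interpret X: thick_numerical H a e R embed X
    using numerical_ring_axioms IKE_thick[OF X] by (simp add: thick_numerical_def)
  have sub: "subcategory R X" by (rule X.sub)
  note XD = subcategoryD[OF sub]
  let ?T = "\<lambda>M. pure_closure R M {\<zero>\<^bsub>M\<^esub>}"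
  have T: "submodule (?T M) R M" if "module R M" for M :: "('k fps, 'm) module"
    by (rule pure_closure(1)[OF domain_R that submodule_zero[OF that]])
  have Ttor: "torsion R (M\<lparr>carrier := ?T M\<rparr>)" for M :: "('k fps, 'm) module"
    by (auto simp: torsion_def pure_closure_def)
  have fl: "fl_modules R \<subseteq> X" if M: "M \<in> X" and nz: "?T M \<noteq> {\<zero>\<^bsub>M\<^esub>}" for M
  proof -
    have Mm: "module R M" and fg: "finitely_generated R M" using XD(1,2)[OF M] .
    interpret M: module R M by fact
    have Tm: "module R (M\<lparr>carrier := ?T M\<rparr>)" by (rule module_submodule[OF Mm T[OF Mm]])
    obtain r where r: "r \<in> carrier R" "r \<noteq> 0" "\<And>x. x \<in> ?T M \<Longrightarrow> r \<odot>\<^bsub>M\<^esub> x = \<zero>\<^bsub>M\<^esub>"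
      using common_denominator[OF domain_R Tm fg_submodule[OF Mm fg T[OF Mm]] submodule_zero[OF Tm]] Ttor[of M]
      by (auto simp: torsion_def)
    have "a_kernel M M (\<lambda>x. r \<odot>\<^bsub>M\<^esub> x) = ?T M"
    proof (intro equalityI subsetI)
      fix x assume "x \<in> a_kernel M M (\<lambda>x. r \<odot>\<^bsub>M\<^esub> x)"
      then show "x \<in> ?T M" using r(1,2) by (auto simp: a_kernel_def' pure_closure_def)
    next
      fix x assume x: "x \<in> ?T M"
      then show "x \<in> a_kernel M M (\<lambda>x. r \<odot>\<^bsub>M\<^esub> x)"
        using r(3)[OF x] submoduleD(1)[OF Mm T[OF Mm] x] by (simp add: a_kernel_def')
    qed
    then have "M\<lparr>carrier := ?T M\<rparr> \<in> X"
      using X M smult_endo[OF Mm r(1)] unfolding IKE_closed_def kernel_closed_def by metis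
    then have "has_copy R X (rquot (tail 1))"
      using IKE_residue_field[OF X Tm has_copyI Ttor] nz by simp
    then have "N \<in> X" if "N \<in> fl_modules R" for N :: "('k fps, 'm) module"
      using that X.has_copy_torsion has_copyD[OF sub] by (auto simp: fl_modules_iff fg_modules_iff)
    then show ?thesis by blast
  qed
  have tf: "tf_modules R \<subseteq> X" if "M \<in> X" "\<not> torsion R M" for M
    using IKE_nontorsion[OF X that] X.has_copy_torsionfree has_copyD[OF sub]
    by (auto simp: tf_modules_def fg_modules_iff)
  have zero: "zero_modules R \<subseteq> X"
    using X.has_copy_zero has_copyD[OF sub] by (auto simp: zero_modules_def fg_modules_iff)
  have tf_iff: "torsionfree R M \<longleftrightarrow> ?T M = {\<zero>\<^bsub>M\<^esub>}" if "M \<in> X" for M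
    using torsionfree_iff[OF domain_R] XD(1)[OF that] by blast
  consider (zero) "\<forall>M\<in>X. torsion R M \<and> ?T M = {\<zero>\<^bsub>M\<^esub>}"
    | (fl) "\<forall>M\<in>X. torsion R M" "\<exists>M\<in>X. ?T M \<noteq> {\<zero>\<^bsub>M\<^esub>}"
    | (tf) "\<exists>M\<in>X. \<not> torsion R M" "\<forall>M\<in>X. ?T M = {\<zero>\<^bsub>M\<^esub>}"
    | (fg) "\<exists>M\<in>X. \<not> torsion R M" "\<exists>M\<in>X. ?T M \<noteq> {\<zero>\<^bsub>M\<^esub>}" by blast
  then show ?thesis
  proof cases
    case zero
    then have "X \<subseteq> zero_modules R" using XD(3) by (auto simp: zero_modules_def torsion_def)
    then show ?thesis using \<open>zero_modules R \<subseteq> X\<close> by blast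
  next
    case fl
    then have "X \<subseteq> fl_modules R" using XD(3) by (auto simp: fl_modules_iff)
    then show ?thesis using \<open>\<And>M. M \<in> X \<Longrightarrow> ?T M \<noteq> {\<zero>\<^bsub>M\<^esub>} \<Longrightarrow> fl_modules R \<subseteq> X\<close> fl(2) by blast
  next
    case tf
    then have "X \<subseteq> tf_modules R" using XD(3) tf_iff by (auto simp: tf_modules_def)
    then show ?thesis using \<open>\<And>M. M \<in> X \<Longrightarrow> \<not> torsion R M \<Longrightarrow> tf_modules R \<subseteq> X\<close> tf(1) by blast
  next
    case fg
    then have flX: "fl_modules R \<subseteq> X" and tfX: "tf_modules R \<subseteq> X" using fl tf by blast+
    have "M \<in> X" if M: "M \<in> fg_modules R" for M
    proof -
      have Mm: "module R M" and fgM: "finitely_generated R M" using M by (auto simp: fg_modules_iff)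
      let ?Q = "quot M (?T M)"
      have Q: "module R ?Q" by (rule module_quot[OF Mm T[OF Mm]])
      have c: "coset_rep M (?T M) \<in> mod_hom R M ?Q" by (rule coset_rep_hom[OF Mm T[OF Mm]])
      note z = coset_rep_zero_iff[OF Mm T[OF Mm]]
      have "M\<lparr>carrier := ?T M\<rparr> \<in> fl_modules R"
        using fg_modules_submodule[OF M T[OF Mm]] Ttor by (simp add: fl_modules_iff)
      then have copyT: "has_copy R X (M\<lparr>carrier := ?T M\<rparr>)" using flX has_copyI by blast
      have "torsionfree R ?Q"
        unfolding torsionfree_def
      proof (intro ballI impI)
        fix s q assume s: "s \<in> carrier R" and "q \<in> carrier ?Q" and 0: "s \<noteq> \<zero>\<^bsub>R\<^esub> \<and> s \<odot>\<^bsub>?Q\<^esub> q = \<zero>\<^bsub>?Q\<^esub>"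
        then obtain x where x: "x \<in> carrier M" "q = coset_rep M (?T M) x"
          unfolding quot_surj[symmetric] by blast
        have sx: "s \<odot>\<^bsub>M\<^esub> x \<in> carrier M" using submoduleD(4)[OF Mm submodule_carrier[OF Mm] s x(1)] .
        have "coset_rep M (?T M) (s \<odot>\<^bsub>M\<^esub> x) = \<zero>\<^bsub>?Q\<^esub>" using mod_homD(3)[OF c s x(1)] 0 x(2) by simp
        then have "s \<odot>\<^bsub>M\<^esub> x \<in> ?T M" using z[OF sx] by simp
        then have "x \<in> pure_closure R M (?T M)" using s 0 x(1) by (auto simp: pure_closure_def[of _ _ "?T M"])
        then have "x \<in> ?T M" using pure_closure(3)[OF domain_R Mm submodule_zero[OF Mm]] by simp
        then show "q = \<zero>\<^bsub>?Q\<^esub>" using z[OF x(1)] x(2) by simp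
      qed
      moreover have "?Q \<in> fg_modules R" using fg_image[OF Mm Q c quot_surj fgM] Q by (simp add: fg_modules_iff)
      ultimately have copyQ: "has_copy R X ?Q" using tfX has_copyI[of ?Q X] by (auto simp: tf_modules_def)
      have "has_copy R X M"
        by (rule has_copy_extension[OF X.sub X.ext Mm Q T[OF Mm] c quot_surj z copyT copyQ])
      then show "M \<in> X" by (rule has_copyD[OF sub _ M])
    qed
    then have "X = fg_modules R" using XD(3) by blast
    then show ?thesis by blast
  qed
qed

text \<open>Images and kernels are submodules, so closure under submodules and extensions yields
  both conclusions at once. The condition on zero modules provides nonemptiness.\<close>

lemma closed_subcategoryI:
  fixes Q :: "('k fps, 'm) module \<Rightarrow> bool"
  assumes zero: "\<And>M. M \<in> fg_modules R \<Longrightarrow> carrier M = {\<zero>\<^bsub>M\<^esub>} \<Longrightarrow> Q M"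
    and iso: "\<And>M N. M \<in> fg_modules R \<Longrightarrow> N \<in> fg_modules R \<Longrightarrow> Q M \<Longrightarrow> mod_iso R M N \<Longrightarrow> Q N"
    and subm: "\<And>M N. M \<in> fg_modules R \<Longrightarrow> Q M \<Longrightarrow> submodule N R M \<Longrightarrow> Q (M\<lparr>carrier := N\<rparr>)"
    and ext: "\<And>L M N f g. L \<in> fg_modules R \<Longrightarrow> M \<in> fg_modules R \<Longrightarrow> N \<in> fg_modules R \<Longrightarrow>
      Q L \<Longrightarrow> Q N \<Longrightarrow> short_exact R L M N f g \<Longrightarrow> Q M"
  shows "IKE_closed R {M \<in> fg_modules R. Q M}" "torsionfree_subcategory R {M \<in> fg_modules R. Q M}"
proof -
  let ?X = "{M \<in> fg_modules R. Q M}"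
  have z: "rsub {0}" by (simp add: rsub_iff)
  obtain M :: "('k fps, 'm) module" where M: "M \<in> fg_modules R" "mod_iso R M (ideal_module R {0})"
    using ex_copy[OF module_ideal[OF z] fg_rsub[OF z]] by blast
  then obtain f where "bij_betw f (carrier M) {0 :: 'k fps}" unfolding mod_iso_def by auto
  then have "is_singleton (carrier M)" using bij_betw_same_card[of f "carrier M"] by (simp add: is_singleton_altdef)
  then obtain x where "carrier M = {x}" by (auto simp: is_singleton_def)
  moreover have "\<zero>\<^bsub>M\<^esub> \<in> carrier M"
    using submoduleD(2)[OF _ submodule_carrier] M(1) by (auto simp: fg_modules_iff)
  ultimately have "M \<in> ?X" using zero[OF M(1)] M(1) by auto
  then have sub: "subcategory R ?X" unfolding subcategory_def using iso by blast
  have subc: "submodule_closed R ?X"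
    unfolding submodule_closed_def using subm fg_modules_submodule by blast
  have extc: "extension_closed R ?X" unfolding extension_closed_def using ext by blast
  have "image_closed R ?X"
    unfolding image_closed_def
  proof (intro ballI)
    fix M N f assume *: "M \<in> ?X" "N \<in> ?X" "f \<in> mod_hom R M N"
    then have "submodule (f ` carrier M) R N"
      using submodule_image[of R M N f "carrier M"] submodule_carrier[of R M] by (simp add: fg_modules_iff)
    then show "N\<lparr>carrier := f ` carrier M\<rparr> \<in> ?X" using subc *(2) unfolding submodule_closed_def by blast
  qed
  moreover have "kernel_closed R ?X"
    unfolding kernel_closed_def
  proof (intro ballI)
    fix M N f assume *: "M \<in> ?X" "N \<in> ?X" "f \<in> mod_hom R M N"
    then have "submodule (a_kernel M N f) R M" by (intro submodule_kernel) (auto simp: fg_modules_iff)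
    then show "M\<lparr>carrier := a_kernel M N f\<rparr> \<in> ?X" using subc *(1) unfolding submodule_closed_def by blast
  qed
  ultimately show "IKE_closed R ?X" "torsionfree_subcategory R ?X"
    using sub subc extc by (auto simp: IKE_closed_def torsionfree_subcategory_def)
qed

lemma fl_closed:
  "IKE_closed R (fl_modules R :: ('k fps, 'm) module set)"
  "torsionfree_subcategory R (fl_modules R :: ('k fps, 'm) module set)"
proof -
  have eq: "fl_modules R = {M \<in> fg_modules R. torsion R M}" using fl_modules_iff by auto
  have iso: "torsion R N" if "M \<in> fg_modules R" "N \<in> fg_modules R" "torsion R M" "mod_iso R M N"
    for M N :: "('k fps, 'm) module"
    using torsion_iso that by (auto simp: fg_modules_iff)
  have ext: "torsion R M" if mods: "L \<in> fg_modules R" "M \<in> fg_modules R" "N \<in> fg_modules R"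
    and tor: "torsion R L" "torsion R N" and ex: "short_exact R L M N f g"
    for L M N :: "('k fps, 'm) module" and f g
    unfolding torsion_iff
  proof
    have m: "module R L" "module R M" "module R N" using mods by (auto simp: fg_modules_iff)
    interpret M: module R M by (rule m)
    have f: "f \<in> mod_hom R L M" and g: "g \<in> mod_hom R M N" and ker: "f ` carrier L = a_kernel M N g"
      using ex by (auto simp: short_exact_def)
    fix x assume x: "x \<in> carrier M"
    then obtain r where r: "r \<in> carrier R" "r \<noteq> 0" "r \<odot>\<^bsub>N\<^esub> g x = \<zero>\<^bsub>N\<^esub>"
      using tor(2) mod_homD(1)[OF g] by (auto simp: torsion_iff)
    then have "r \<odot>\<^bsub>M\<^esub> x \<in> a_kernel M N g" using mod_homD(3)[OF g r(1) x] x by (simp add: a_kernel_def')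
    then obtain y where y: "y \<in> carrier L" "r \<odot>\<^bsub>M\<^esub> x = f y" unfolding ker[symmetric] by blast
    then obtain s where s: "s \<in> carrier R" "s \<noteq> 0" "s \<odot>\<^bsub>L\<^esub> y = \<zero>\<^bsub>L\<^esub>" using tor(1) by (auto simp: torsion_iff)
    have "(s * r) \<odot>\<^bsub>M\<^esub> x = \<zero>\<^bsub>M\<^esub>"
      using M.smult_assoc1[OF s(1) r(1) x] y(2) mod_homD(3)[OF f s(1) y(1)] s(3) mod_hom_zero[OF m(1,2) f] by simp
    then show "\<exists>r\<in>carrier R. r \<noteq> \<zero>\<^bsub>R\<^esub> \<and> r \<odot>\<^bsub>M\<^esub> x = \<zero>\<^bsub>M\<^esub>"
      using r s R_mult_closed by (intro bexI[of _ "s * r"]) auto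
  qed
  have zero: "torsion R M" if "M \<in> fg_modules R" "carrier M = {\<zero>\<^bsub>M\<^esub>}" for M :: "('k fps, 'm) module"
  proof -
    interpret M: module R M using that(1) by (simp add: fg_modules_iff)
    show ?thesis using that(2) R_closed(2) M.smult_one[of "\<zero>\<^bsub>M\<^esub>"]
      by (auto simp: torsion_iff intro!: bexI[of _ 1])
  qed
  have subm: "torsion R (M\<lparr>carrier := N\<rparr>)" if "M \<in> fg_modules R" "torsion R M" "submodule N R M"
    for M :: "('k fps, 'm) module" and N
    using that submoduleD(1)[of R M N] by (auto simp: torsion_iff fg_modules_iff)
  show "IKE_closed R (fl_modules R :: ('k fps, 'm) module set)"
    "torsionfree_subcategory R (fl_modules R :: ('k fps, 'm) module set)"
    unfolding eq by (rule closed_subcategoryI[where Q = "torsion R", OF zero iso subm ext]; assumption)+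
qed

lemma tf_closed:
  "IKE_closed R (tf_modules R :: ('k fps, 'm) module set)"
  "torsionfree_subcategory R (tf_modules R :: ('k fps, 'm) module set)"
proof -
  have iso: "torsionfree R N" if "M \<in> fg_modules R" "N \<in> fg_modules R" "torsionfree R M" "mod_iso R M N"
    for M N :: "('k fps, 'm) module"
    using torsionfree_iso that by (auto simp: fg_modules_iff)
  have ext: "torsionfree R M" if mods: "L \<in> fg_modules R" "M \<in> fg_modules R" "N \<in> fg_modules R"
    and tf: "torsionfree R L" "torsionfree R N" and ex: "short_exact R L M N f g"
    for L M N :: "('k fps, 'm) module" and f g
    unfolding torsionfree_def
  proof (intro ballI impI)
    have m: "module R L" "module R M" "module R N" using mods by (auto simp: fg_modules_iff)
    have f: "f \<in> mod_hom R L M" "inj_on f (carrier L)" and g: "g \<in> mod_hom R M N"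
      and ker: "f ` carrier L = a_kernel M N g"
      using ex by (auto simp: short_exact_def)
    interpret L: module R L by (rule m)
    fix r x assume *: "r \<in> carrier R" "x \<in> carrier M" "r \<noteq> \<zero>\<^bsub>R\<^esub> \<and> r \<odot>\<^bsub>M\<^esub> x = \<zero>\<^bsub>M\<^esub>"
    then have "r \<odot>\<^bsub>N\<^esub> g x = \<zero>\<^bsub>N\<^esub>"
      using mod_homD(3)[OF g *(1,2)] mod_hom_zero[OF m(2,3) g] by simp
    then have "g x = \<zero>\<^bsub>N\<^esub>" using tf(2) * mod_homD(1)[OF g] by (auto simp: torsionfree_def)
    then have "x \<in> a_kernel M N g" using *(2) by (simp add: a_kernel_def')
    then obtain y where y: "y \<in> carrier L" "x = f y" unfolding ker[symmetric] by blast
    have "f (r \<odot>\<^bsub>L\<^esub> y) = \<zero>\<^bsub>M\<^esub>" using mod_homD(3)[OF f(1) *(1) y(1)] * y(2) by simp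
    then have "r \<odot>\<^bsub>L\<^esub> y = \<zero>\<^bsub>L\<^esub>" using mod_hom_inj_iff[OF m(1,2) f(1)] f(2) L.smult_closed[OF *(1) y(1)] by blast
    then have "y = \<zero>\<^bsub>L\<^esub>" using tf(1) * y(1) by (auto simp: torsionfree_def)
    then show "x = \<zero>\<^bsub>M\<^esub>" using y(2) mod_hom_zero[OF m(1,2) f(1)] by simp
  qed
  have zero: "torsionfree R M" if "M \<in> fg_modules R" "carrier M = {\<zero>\<^bsub>M\<^esub>}" for M :: "('k fps, 'm) module"
    using that(2) by (simp add: torsionfree_def)
  have subm: "torsionfree R (M\<lparr>carrier := N\<rparr>)" if "M \<in> fg_modules R" "torsionfree R M" "submodule N R M"
    for M :: "('k fps, 'm) module" and N
    using that submoduleD(1)[of R M N] by (auto simp: torsionfree_def fg_modules_iff)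
  show "IKE_closed R (tf_modules R :: ('k fps, 'm) module set)"
    "torsionfree_subcategory R (tf_modules R :: ('k fps, 'm) module set)"
    unfolding tf_modules_def
    by (rule closed_subcategoryI[where Q = "torsionfree R", OF zero iso subm ext]; assumption)+
qed

lemma zero_closed:
  "IKE_closed R (zero_modules R :: ('k fps, 'm) module set)"
  "torsionfree_subcategory R (zero_modules R :: ('k fps, 'm) module set)"
proof -
  let ?Q = "\<lambda>M :: ('k fps, 'm) module. carrier M = {\<zero>\<^bsub>M\<^esub>}"
  have iso: "?Q N" if h: "M \<in> fg_modules R" "N \<in> fg_modules R" "?Q M" "mod_iso R M N" for M N
  proof -
    obtain f where f: "f \<in> mod_hom R M N" "f ` carrier M = carrier N"
      using h(4) by (auto simp: mod_iso_def bij_betw_def)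
    then show ?thesis using h(1-3) mod_hom_zero[OF _ _ f(1)] by (auto simp: fg_modules_iff)
  qed
  have ext: "?Q M" if mods: "L \<in> fg_modules R" "M \<in> fg_modules R" "N \<in> fg_modules R"
    and z: "?Q L" "?Q N" and ex: "short_exact R L M N f g" for L M N f g
  proof -
    have m: "module R L" "module R M" "module R N" using mods by (auto simp: fg_modules_iff)
    have f: "f \<in> mod_hom R L M" and g: "g \<in> mod_hom R M N"
      and ker: "f ` carrier L = a_kernel M N g"
      using ex by (auto simp: short_exact_def)
    have "a_kernel M N g = carrier M" using mod_homD(1)[OF g] z(2) by (auto simp: a_kernel_def')
    moreover have "f ` carrier L = {\<zero>\<^bsub>M\<^esub>}" using z(1) mod_hom_zero[OF m(1,2) f] by (metis image_empty image_insert)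
    ultimately show ?thesis using ker by simp
  qed
  have subm: "?Q (M\<lparr>carrier := N\<rparr>)" if "M \<in> fg_modules R" "?Q M" "submodule N R M" for M N
  proof -
    have m: "module R M" using that(1) by (simp add: fg_modules_iff)
    have "N \<subseteq> {\<zero>\<^bsub>M\<^esub>}" unfolding that(2)[symmetric] using submoduleD(1)[OF m that(3)] by (rule subsetI)
    then have "N = {\<zero>\<^bsub>M\<^esub>}" using submoduleD(2)[OF m that(3)] by auto
    then show ?thesis by simp
  qed
  show "IKE_closed R (zero_modules R :: ('k fps, 'm) module set)"
    "torsionfree_subcategory R (zero_modules R :: ('k fps, 'm) module set)"
    unfolding zero_modules_def
    by (rule closed_subcategoryI[where Q = ?Q, OF _ iso subm ext]; assumption)+
qed

lemma fg_closed:
  "IKE_closed R (fg_modules R :: ('k fps, 'm) module set)"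
  "torsionfree_subcategory R (fg_modules R :: ('k fps, 'm) module set)"
  using closed_subcategoryI[of "\<lambda>_. True"] by simp_all

section \<open>The conductor\<close>

text \<open>If f has order d and f S lies in \<open>R\<close>, then \<open>R\<close> contains t^d S,
  so every n >= d lies in \<open>H\<close>. As \<open>e\<close> is least, e <= d. Conversely, t^e S
  is an ideal of S that lies in \<open>R\<close>.\<close>

lemma conductor_eq:
  assumes least: "\<And>d. (\<And>n. d \<le> n \<Longrightarrow> n \<in> H) \<Longrightarrow> e \<le> d"
  shows "conductor H = (fil e :: 'k fps set)"
proof (intro equalityI subsetI)
  have R: "carrier (semigroup_ring H) = carrier R" by (simp add: R_eq)
  fix f :: "'k fps"
  { assume f: "f \<in> fil e"
    then have "f \<in> carrier R" using fil_subset_R by blast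
    then have "fps_to_fls f \<in> fraction_field (carrier R)"
      unfolding fraction_field_def using R_closed(2) by (intro CollectI exI[of _ f] exI[of _ 1]) simp
    moreover have "f * s \<in> carrier R" for s
      using fil_mult_left[OF f, of s] fil_subset_R[of e] by (auto simp: mult.commute)
    ultimately show "f \<in> conductor H"
      by (auto simp: conductor_def R simp flip: fls_times_fps_to_fls) }
  assume "f \<in> conductor H"
  then have fs: "f * s \<in> carrier R" for s
    by (auto simp: conductor_def R simp flip: fls_times_fps_to_fls)
  show "f \<in> fil e"
  proof (cases "f = 0")
    case False
    then obtain d where d: "f \<in> fil d" "fps_nth f d \<noteq> 0"
      using ex_order[of "{0, f}"] by (metis insertCI insert_absorb2 insert_subset singleton_insert_inj_eq fps_zero_nth insertE singletonD)
    have "n \<in> H" if "d \<le> n" for n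
    proof -
      have "(fps_X ^ n :: 'k fps) \<in> fil (d + (n - d))" using fps_X_power_fil[of n] that by simp
      then obtain w where "fps_X ^ n = f * w" using fil_divide[OF d] by blast
      then have "(fps_X ^ n :: 'k fps) \<in> carrier R" using fs by simp
      then show ?thesis by (auto simp: carrier_R fps_X_power_nth)
    qed
    then show ?thesis using least fil_antimono d(1) by blast
  qed (simp add: fil_closed)
qed

text \<open>Representatives and cosets are two surjections from \<open>R\<close> with kernel
  \<open>A\<close>.\<close>

lemma quotient_module_copy:
  assumes A: "ideal_in A"
  shows "module R (quotient_module R A)" "mod_iso R (rquot A) (quotient_module R A)"
proof -
  interpret R: cring R by (rule cring_R)
  let ?c = "\<lambda>r. A +>\<^bsub>R\<^esub> r"
  note AD = rsubD[OF ideal_inD(1)[OF A]]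
  have neg: "\<ominus>\<^bsub>R\<^esub> x = - x" if "x \<in> carrier R" for x
    by (rule R.minus_equality) (use that R_closed in auto)
  have AD3: "x * r \<in> A" if "r \<in> carrier R" "x \<in> A" for r x
    using AD(3)[OF that] by (simp add: mult.commute)
  have "subgroup A (add_monoid R)"
    by (rule R.add.subgroupI) (use AD ideal_inD(3)[OF A] neg in auto)
  then have idl: "ideal A R"
    using AD(3) AD3 by (intro idealI R.ring_axioms) auto
  then interpret A: ideal A R .
  have hom: "?c \<in> ring_hom R (R Quot A)" by (rule A.rcos_ring_hom)
  have h: "?c \<in> mod_hom R (ideal_module R (carrier R)) (quotient_module R A)"
  proof (rule mod_homI)
    fix x y r assume x: "x \<in> carrier (ideal_module R (carrier R))" 
    show "?c x \<in> carrier (quotient_module R A)"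
      using ring_hom_closed[OF hom] x by (simp add: quotient_module_def module_via_def)
    { assume "y \<in> carrier (ideal_module R (carrier R))"
      then show "?c (x \<oplus>\<^bsub>ideal_module R (carrier R)\<^esub> y) = ?c x \<oplus>\<^bsub>quotient_module R A\<^esub> ?c y"
        using ring_hom_add[OF hom, of x y] x by (simp add: quotient_module_def module_via_def) }
    assume "r \<in> carrier R"
    then show "?c (r \<odot>\<^bsub>ideal_module R (carrier R)\<^esub> x) = r \<odot>\<^bsub>quotient_module R A\<^esub> ?c x"
      using ring_hom_mult[OF hom, of r x] x by (simp add: quotient_module_def module_via_def)
  qed
  have surj: "?c ` carrier (ideal_module R (carrier R)) = carrier (quotient_module R A)"
    by (auto simp: quotient_module_def module_via_def FactRing_def A_RCOSETS_def')
  have zero: "\<zero>\<^bsub>quotient_module R A\<^esub> = A" by (simp add: quotient_module_def module_via_def FactRing_def)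
  have ker: "?c r = A \<longleftrightarrow> r \<in> A" if "r \<in> carrier R" for r
    using A.a_rcos_const[of r] A.a_rcos_self[of r] that by auto
  show Q: "module R (quotient_module R A)"
    by (rule module_hom_image[OF module_R h surj]) (use ker[OF R_closed(1)] rsubD(1)[OF ideal_inD(1)[OF A]] zero in simp)
  show "mod_iso R (rquot A) (quotient_module R A)"
    by (rule first_iso[OF module_R module_rquot[OF A] Q rep_hom[OF A] _ h surj])
      (use ker rep_zero_iff[OF A] zero in \<open>simp_all add: rquot_carrier\<close>)
qed

end

section \<open>The extension closures\<close>

lemma ext_closure_eqI:
  assumes "subcategory R Y" "has_copy R Y M" "summand_closed R Y" "extension_closed R Y"
    and "\<And>X. subcategory R X \<Longrightarrow> has_copy R X M \<Longrightarrow> summand_closed R X \<Longrightarrow> extension_closed R X \<Longrightarrow> Y \<subseteq> X"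
  shows "ext_closure R M = Y"
  using assms unfolding ext_closure_def has_copy_def by (intro equalityI Inter_lower Inter_greatest) auto

context numerical_ring
begin

lemma thick_numericalI:
  assumes "subcategory R X" "summand_closed R X" "extension_closed R X"
  shows "thick_numerical H a e R embed X"
  using assms numerical_ring_axioms big_universe_axioms
  by (simp add: thick_numerical_def thick_subcategory_def thick_subcategory_axioms_def)

text \<open>The condition e <= s places t^s S inside \<open>R\<close>, where it equals
  \<open>tail s\<close>; the scalar t^s then shows that the quotient is torsion. With s = 0 the
  quotient would be zero, and the descent to the residue field could not start.\<close>

lemma ext_closure_quotient:
  assumes "1 \<le> s" "e \<le> s"
  shows "ext_closure R (quotient_module R (fil s)) = (fl_modules R :: ('k fps, 'm) module set)"
proof (rule ext_closure_eqI)
  have s: "fil s = tail s" using fil_subset_R[OF assms(2)] by (auto simp: tail_def)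
  note q = quotient_module_copy[OF ideal_in_tail[of s], folded s]
  let ?F = "fl_modules R :: ('k fps, 'm) module set"
  show sub: "subcategory R ?F" "extension_closed R ?F" using fl_closed(1) by (auto simp: IKE_closed_def)
  show "summand_closed R ?F" by (rule IKE_summand_closed[OF fl_closed(1)])
  have K: "module R (rquot (fil s))" using module_rquot[OF ideal_in_tail[of s]] by (simp add: s)
  have surj: "rep (fil s) ` carrier (ideal_module R (carrier R)) = carrier (rquot (fil s))" by (rule quot_surj)
  have rep: "rep (fil s) \<in> mod_hom R (ideal_module R (carrier R)) (rquot (fil s))"
    using rep_hom[OF ideal_in_tail[of s]] by (simp add: s)
  have fg: "finitely_generated R (rquot (fil s))"
    using fg_image[OF module_R K rep surj] fg_rsub[OF rsub_R] by blast
  have tor: "torsion R (rquot (fil s))"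
    unfolding torsion_iff
  proof
    fix x assume x: "x \<in> carrier (rquot (fil s))"
    then obtain f where f: "f \<in> carrier R" "x = rep (fil s) f" using surj by auto
    have X: "fps_X ^ s \<in> carrier R" using R_closed(7)[OF H_conductor[OF assms(2)]] .
    have "fps_X ^ s * f \<in> fil s" using fil_mult[OF fps_X_power_fil, of f 0 s] by simp
    then have "rep (fil s) (fps_X ^ s * f) = \<zero>\<^bsub>rquot (fil s)\<^esub>"
      using rep_zero_iff[OF ideal_in_tail[of s] R_mult_closed[OF X f(1)]] by (simp add: s)
    then show "\<exists>r\<in>carrier R. r \<noteq> \<zero>\<^bsub>R\<^esub> \<and> r \<odot>\<^bsub>rquot (fil s)\<^esub> x = \<zero>\<^bsub>rquot (fil s)\<^esub>"
      using mod_homD(3)[OF rep X, of f] f X by (intro bexI[of _ "fps_X ^ s"]) auto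
  qed
  obtain M :: "('k fps, 'm) module" where M: "M \<in> fg_modules R" "mod_iso R M (rquot (fil s))"
    using ex_copy[OF K fg] by blast
  have Mm: "module R M" using M(1) by (simp add: fg_modules_iff)
  have "torsion R M" by (rule torsion_iso[OF K Mm tor mod_iso_sym[OF Mm M(2)]])
  then have "M \<in> ?F" using M(1) by (simp add: fl_modules_iff)
  then show "has_copy R ?F (quotient_module R (fil s))"
    using mod_iso_trans[OF M(2) q(2)] unfolding has_copy_def by blast
  fix X :: "('k fps, 'm) module set"
  assume X: "subcategory R X" "has_copy R X (quotient_module R (fil s))" "summand_closed R X" "extension_closed R X"
  interpret X: thick_numerical H a e R embed X by (rule thick_numericalI[OF X(1,3,4)])
  have "has_copy R X (rquot (tail s))" using has_copy_iso[OF X(2) mod_iso_sym[OF K q(2)]] by (simp add: s)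
  then have k: "has_copy R X (rquot (tail 1))" using X.has_copy_residue_field assms(1) by blast
  show "?F \<subseteq> X"
  proof
    fix M :: "('k fps, 'm) module" assume "M \<in> ?F"
    then have M: "M \<in> fg_modules R" "module R M" "finitely_generated R M" "torsion R M"
      by (auto simp: fl_modules_iff fg_modules_iff)
    show "M \<in> X" by (rule has_copyD[OF X(1) X.has_copy_torsion[OF k M(2-4)] M(1)])
  qed
qed

lemma ext_closure_fil:
  "ext_closure R (ideal_module R (fil s)) = (tf_modules R :: ('k fps, 'm) module set)"
proof (rule ext_closure_eqI)
  let ?F = "tf_modules R :: ('k fps, 'm) module set"
  show sub: "subcategory R ?F" "extension_closed R ?F" using tf_closed(1) by (auto simp: IKE_closed_def)
  show "summand_closed R ?F" by (rule IKE_summand_closed[OF tf_closed(1)])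
  have I: "module R (ideal_module R (fil s))" by (rule module_ideal[OF rsub_fil])
  obtain M :: "('k fps, 'm) module" where M: "M \<in> fg_modules R" "mod_iso R M (ideal_module R (fil s))"
    using ex_copy[OF I fg_rsub[OF rsub_fil]] by blast
  have Mm: "module R M" using M(1) by (simp add: fg_modules_iff)
  have "torsionfree R (ideal_module R (fil s))" by (auto simp: torsionfree_def)
  then have "torsionfree R M" by (rule torsionfree_iso[OF I Mm _ mod_iso_sym[OF Mm M(2)]])
  then have "M \<in> ?F" using M(1) by (simp add: tf_modules_def)
  then show "has_copy R ?F (ideal_module R (fil s))" using M(2) unfolding has_copy_def by blast
  fix X :: "('k fps, 'm) module set"
  assume X: "subcategory R X" "has_copy R X (ideal_module R (fil s))" "summand_closed R X" "extension_closed R X"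
  interpret X: thick_numerical H a e R embed X by (rule thick_numericalI[OF X(1,3,4)])
  show "?F \<subseteq> X"
    using X.has_copy_torsionfree[OF X(2)] has_copyD[OF X(1)] by (auto simp: tf_modules_def fg_modules_iff)
qed

lemma IKE_closed_iff:
  fixes X :: "('k fps, 'm) module set"
  shows "IKE_closed R X \<longleftrightarrow> X \<in> {zero_modules R, fl_modules R, tf_modules R, fg_modules R}"
  using IKE_cases[of X] zero_closed(1) fl_closed(1) tf_closed(1) fg_closed(1) by auto

lemma IKE_torsionfree:
  fixes X :: "('k fps, 'm) module set"
  shows "IKE_closed R X \<Longrightarrow> torsionfree_subcategory R X"
  using IKE_cases[of X] zero_closed(2) fl_closed(2) tf_closed(2) fg_closed(2) by auto

end

text \<open>The bound a a comes from division with remainder: if n = q a + p with p < a <= q, then n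
  = (q - p) a + p (a + 1). Only the generators a and a + 1 enter here, and r >= 1 supplies the
  second.\<close>

lemma nat_combinations_interval:
  fixes a r :: nat
  assumes "a \<ge> 2" "r \<ge> 1"
  defines "H \<equiv> nat_combinations {a..a + r}"
  shows "0 \<in> H" "\<And>x y. x \<in> H \<Longrightarrow> y \<in> H \<Longrightarrow> x + y \<in> H" "a \<in> H" "\<And>h. h \<in> H \<Longrightarrow> h \<noteq> 0 \<Longrightarrow> a \<le> h"
    "\<And>n. a * a \<le> n \<Longrightarrow> n \<in> H"
proof -
  have memI: "(\<Sum>x\<in>{a..a + r}. c x * x) \<in> H" for c :: "nat \<Rightarrow> nat"
    unfolding H_def nat_combinations_def by blast
  show "0 \<in> H" using memI[of "\<lambda>_. 0"] by simp
  show add: "x + y \<in> H" if xy: "x \<in> H" "y \<in> H" for x y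
  proof -
    obtain c d :: "nat \<Rightarrow> nat" where "x = (\<Sum>x\<in>{a..a + r}. c x * x)" "y = (\<Sum>x\<in>{a..a + r}. d x * x)"
      using xy unfolding H_def nat_combinations_def by blast
    then have "x + y = (\<Sum>x\<in>{a..a + r}. (c x + d x) * x)" by (simp add: sum.distrib distrib_right)
    then show ?thesis using memI by simp
  qed
  have single: "m * b \<in> H" if "b \<in> {a..a + r}" for m b
  proof -
    have "(\<Sum>x\<in>{a..a + r}. (if x = b then m else 0) * x) = (\<Sum>x\<in>{a..a + r}. if x = b then m * b else 0)"
      by (rule sum.cong) auto
    also have "\<dots> = m * b" using that by simp
    finally show ?thesis using memI by metis
  qed
  show "a \<in> H" using single[of a 1] by simp
  show "a \<le> h" if h: "h \<in> H" "h \<noteq> 0" for h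
  proof -
    obtain c :: "nat \<Rightarrow> nat" where c: "h = (\<Sum>x\<in>{a..a + r}. c x * x)"
      using h(1) unfolding H_def nat_combinations_def by blast
    then have "(\<Sum>x\<in>{a..a + r}. c x * x) \<noteq> 0" using h(2) by simp
    then obtain x where x: "x \<in> {a..a + r}" "c x * x \<noteq> 0"
      by (rule sum.not_neutral_contains_not_neutral)
    then have "x \<le> c x * x" by simp
    also have "\<dots> \<le> h" unfolding c by (rule member_le_sum) (use x in auto)
    finally show ?thesis using x by simp
  qed
  show "n \<in> H" if n: "a * a \<le> n" for n
  proof -
    have "a \<le> n div a" using n assms(1) by (simp add: less_eq_div_iff_mult_less_eq)
    moreover have "n mod a < a" using assms(1) by simp
    ultimately have le: "n mod a \<le> n div a" by simp
    have "(n div a - n mod a) * a \<in> H" by (rule single) simp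
    moreover have "(n mod a) * (a + 1) \<in> H" by (rule single) (use assms(2) in simp)
    ultimately have "(n div a - n mod a) * a + (n mod a) * (a + 1) \<in> H" by (rule add)
    moreover have "(n div a - n mod a) * a + (n mod a) * (a + 1) = n div a * a + n mod a"
      using le by (simp add: diff_mult_distrib algebra_simps)
    ultimately show ?thesis by simp
  qed
qed

theorem theorem6p7:
  fixes a r :: nat
    and H :: "nat set"
    and R :: "('k::field) fps ring"
    and \<cc> :: "'k fps set"
    and embed :: "'k fps \<Rightarrow> 'm"
  assumes "a \<ge> 2" and "r \<ge> 1"
    and "H = nat_combinations {a..a + r}"
    and "infinite (UNIV :: 'k set)"
    and "R = semigroup_ring H"
    and "\<cc> = conductor H"
    and large_universe: "inj embed"
  shows "(ext_closure R (quotient_module R \<cc>) :: ('k fps, 'm) module set) = fl_modules R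
    \<and> (ext_closure R (ideal_module R \<cc>) :: ('k fps, 'm) module set) = tf_modules R
    \<and> {X :: ('k fps, 'm) module set. IKE_closed R X}
        = {zero_modules R, fl_modules R, tf_modules R, fg_modules R}
    \<and> (\<forall>X :: ('k fps, 'm) module set. IKE_closed R X \<longrightarrow> torsionfree_subcategory R X)"
proof -
  note H = nat_combinations_interval[OF assms(1,2), folded assms(3)]
  \<comment> \<open>The least bound beyond which \<open>H\<close> has no gaps; a a witnesses that
    such a bound exists.\<close>
  define e where "e = (LEAST d. \<forall>n\<ge>d. n \<in> H)"
  have e: "\<forall>n\<ge>e. n \<in> H" unfolding e_def by (rule LeastI[of _ "a * a"]) (use H(5) in blast)
  have least: "e \<le> d" if "\<And>n. d \<le> n \<Longrightarrow> n \<in> H" for d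
    unfolding e_def by (rule Least_le) (use that in blast)
  interpret numerical_ring H a e R embed
    by unfold_locales (use H e assms in auto)
  \<comment> \<open>The generators are at least 2, so 1 is a gap. Thus \<open>e\<close> is positive
    and R/c is nonzero.\<close>
  have "1 \<notin> H" using H(4)[of 1] assms(1) by auto
  then have "\<not> e \<le> 1" using e by blast
  then have "1 \<le> e" by simp
  moreover have "\<cc> = fil e" using conductor_eq[OF least] assms(6) by simp
  ultimately show ?thesis
    using ext_closure_quotient[of e] ext_closure_fil[of e] IKE_closed_iff IKE_torsionfree by auto
qed

end
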